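(* Let $P$ be a (not necessarily connected) minuscule poset. Then the distributive lattice $J(P)$ of order ideals of $P$ is CDE.
   Context: For a finite poset $Q$, the down-degree of $q$ is $\#\{r\in Q:r\lessdot q\}$; $X_Q$ is the down-degree random variable under the uniform distribution, and $Y_Q$ is the down-degree random variable under the distribution assigning $q$ probability proportional to the number of maximal chains of $Q$ containing $q$. $Q$ is CDE if $\mathbb{E}(X_Q)=\mathbb{E}(Y_Q)$. $J(P)$ is the set of order ideals (down-closed subsets) of $P$ ordered by inclusion. Connected minuscule posets: for an irreducible crystallographic root system $\Phi$ with simple roots, order $\Phi^+$ by $\beta\le\gamma$ iff $\gamma-\beta$ is a nonnegative integer combination of simple roots; for a simple root $\alpha$ whose coefficient in the highest root is $1$ (a minuscule simple root), the subposet $\{\beta\in\Phi^+:\beta\ge\alpha\}$ is a connected minuscule poset. A minuscule poset is a finite disjoint union of connected minuscule posets. *)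

theory Defs
  imports "HOL-Analysis.Analysis" "HOL-Probability.Probability"
begin

section \<open>Finite posets and the CDE property\<close>

text \<open>A poset is a carrier \<open>Q\<close> together with a reflexive order relation \<open>r \<subseteq> Q \<times> Q\<close>, where
  \<open>(p, q) \<in> r\<close> means \<open>p \<le> q\<close>. A nonempty carrier is required so that the two probability
  distributions below exist.\<close>

definition finite_poset :: "'a set \<Rightarrow> 'a rel \<Rightarrow> bool" where
  "finite_poset Q r \<longleftrightarrow> finite Q \<and> Q \<noteq> {} \<and> partial_order_on Q r"

definition covers :: "'a set \<Rightarrow> 'a rel \<Rightarrow> 'a \<Rightarrow> 'a \<Rightarrow> bool" where
  "covers Q r q p \<longleftrightarrow> p \<in> Q \<and> q \<in> Q \<and> p \<noteq> q \<and> (p, q) \<in> r \<and>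
     \<not> (\<exists>z\<in>Q. z \<noteq> p \<and> z \<noteq> q \<and> (p, z) \<in> r \<and> (z, q) \<in> r)"

definition down_degree :: "'a set \<Rightarrow> 'a rel \<Rightarrow> 'a \<Rightarrow> nat" where
  "down_degree Q r q = card {p \<in> Q. covers Q r q p}"

definition maximal_chains :: "'a set \<Rightarrow> 'a rel \<Rightarrow> 'a set set" where
  "maximal_chains Q r =
     {C \<in> Chains r. C \<subseteq> Q \<and> (\<forall>D\<in>Chains r. D \<subseteq> Q \<longrightarrow> C \<subseteq> D \<longrightarrow> D = C)}"

definition chain_count :: "'a set \<Rightarrow> 'a rel \<Rightarrow> 'a \<Rightarrow> nat" where
  "chain_count Q r q = card {C \<in> maximal_chains Q r. q \<in> C}"

text \<open>The function embedded here is a probability mass function on every finite nonempty poset: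
  see \<open>pmf_chain_pmf\<close> below.\<close>

definition chain_pmf :: "'a set \<Rightarrow> 'a rel \<Rightarrow> 'a pmf" where
  "chain_pmf Q r = embed_pmf (\<lambda>q.
     if q \<in> Q then real (chain_count Q r q) / (\<Sum>p\<in>Q. real (chain_count Q r p)) else 0)"

definition cde :: "'a set \<Rightarrow> 'a rel \<Rightarrow> bool" where
  "cde Q r \<longleftrightarrow> finite_poset Q r \<and>
     measure_pmf.expectation (pmf_of_set Q) (\<lambda>q. real (down_degree Q r q)) =
     measure_pmf.expectation (chain_pmf Q r) (\<lambda>q. real (down_degree Q r q))"

lemma chain_extends_to_maximal:
  assumes "finite Q" "C \<in> Chains r" "C \<subseteq> Q"
  shows "\<exists>D\<in>maximal_chains Q r. C \<subseteq> D"
proof -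
  let ?S = "{D \<in> Chains r. D \<subseteq> Q}"
  have "finite ?S" using assms(1) by (auto intro: finite_subset[of _ "Pow Q"])
  moreover have "C \<in> ?S" using assms by auto
  ultimately obtain D where "D \<in> ?S" "C \<subseteq> D" "\<forall>E\<in>?S. D \<subseteq> E \<longrightarrow> D = E"
    using finite_has_maximal2[of ?S C] by blast
  then show ?thesis unfolding maximal_chains_def by blast
qed

lemma chain_count_pos:
  assumes "finite_poset Q r" "q \<in> Q"
  shows "chain_count Q r q > 0"
proof -
  have fin: "finite Q" and refl: "(q, q) \<in> r"
    using assms by (auto simp: finite_poset_def order_on_defs refl_on_def)
  have "{q} \<in> Chains r" using refl by (auto simp: Chains_def)
  then obtain D where "D \<in> maximal_chains Q r" "q \<in> D"
    using chain_extends_to_maximal[OF fin, of "{q}" r] assms(2) by auto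
  moreover have "finite (maximal_chains Q r)"
    using fin by (auto intro: finite_subset[of _ "Pow Q"] simp: maximal_chains_def)
  ultimately show ?thesis unfolding chain_count_def by (subst card_gt_0_iff) auto
qed

lemma pmf_chain_pmf:
  assumes "finite_poset Q r"
  shows "pmf (chain_pmf Q r) q =
    (if q \<in> Q then real (chain_count Q r q) / (\<Sum>p\<in>Q. real (chain_count Q r p)) else 0)"
proof -
  let ?s = "\<Sum>p\<in>Q. real (chain_count Q r p)"
  let ?f = "\<lambda>q. if q \<in> Q then real (chain_count Q r q) / ?s else 0"
  have fin: "finite Q" "Q \<noteq> {}" using assms by (auto simp: finite_poset_def)
  have pos: "?s > 0" using fin chain_count_pos[OF assms] by (intro sum_pos) auto
  have nn: "?f x \<ge> 0" for x by (simp add: sum_nonneg)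
  have "(\<integral>\<^sup>+x. ennreal (?f x) \<partial>count_space UNIV) = (\<Sum>x\<in>Q. ennreal (?f x))"
    using fin by (intro nn_integral_count_space'[of Q]) auto
  also have "\<dots> = ennreal (\<Sum>x\<in>Q. ?f x)" by (intro sum_ennreal nn)
  also have "(\<Sum>x\<in>Q. ?f x) = 1"
    using pos by (simp add: sum_divide_distrib[symmetric])
  finally show ?thesis unfolding chain_pmf_def by (subst pmf_embed_pmf) (use nn in \<open>simp_all\<close>)
qed

lemma cde_iff_sums:
  assumes "finite_poset Q r"
  shows "cde Q r \<longleftrightarrow>
    (\<Sum>q\<in>Q. real (down_degree Q r q)) / real (card Q) =
    (\<Sum>q\<in>Q. real (chain_count Q r q) * real (down_degree Q r q)) /
      (\<Sum>q\<in>Q. real (chain_count Q r q))"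
proof -
  have fin: "finite Q" "Q \<noteq> {}" using assms by (auto simp: finite_poset_def)
  have sub: "set_pmf (chain_pmf Q r) \<subseteq> Q"
    by (auto simp: set_pmf_iff pmf_chain_pmf[OF assms] split: if_splits)
  have "measure_pmf.expectation (chain_pmf Q r) (\<lambda>q. real (down_degree Q r q)) =
    (\<Sum>q\<in>Q. real (down_degree Q r q) * pmf (chain_pmf Q r) q)"
    using fin sub by (intro integral_measure_pmf_real) auto
  also have "\<dots> = (\<Sum>q\<in>Q. real (chain_count Q r q) * real (down_degree Q r q)) /
      (\<Sum>q\<in>Q. real (chain_count Q r q))"
    unfolding sum_divide_distrib
    by (intro sum.cong refl) (simp add: pmf_chain_pmf[OF assms])
  finally show ?thesis
    using assms fin by (simp add: cde_def integral_pmf_of_set)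
qed

text \<open>The order ideals are ordered by inclusion, i.e. by \<open>relation_of (\<subseteq>)\<close>.\<close>

definition order_ideals :: "'a set \<Rightarrow> 'a rel \<Rightarrow> 'a set set" where
  "order_ideals P r = {I. I \<subseteq> P \<and> (\<forall>x\<in>I. \<forall>y\<in>P. (y, x) \<in> r \<longrightarrow> y \<in> I)}"

definition poset_isomorphic :: "'a set \<Rightarrow> 'a rel \<Rightarrow> 'b set \<Rightarrow> 'b rel \<Rightarrow> bool" where
  "poset_isomorphic A r B s \<longleftrightarrow>
     (\<exists>f. bij_betw f A B \<and> (\<forall>x\<in>A. \<forall>y\<in>A. (x, y) \<in> r \<longleftrightarrow> (f x, f y) \<in> s))"


section \<open>Root systems\<close>

text \<open>A root system is not required to span the ambient type: it is a root system in the
  Euclidean space \<open>span \<Phi>\<close>. This lets root systems of different ranks live in one ambient space.\<close>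

definition crystallographic_root_system :: "'v::euclidean_space set \<Rightarrow> bool" where
  "crystallographic_root_system \<Phi> \<longleftrightarrow>
     finite \<Phi> \<and> 0 \<notin> \<Phi> \<and>
     (\<forall>\<alpha>\<in>\<Phi>. \<Phi> \<inter> span {\<alpha>} = {\<alpha>, - \<alpha>}) \<and>
     (\<forall>\<alpha>\<in>\<Phi>. \<forall>\<beta>\<in>\<Phi>. \<beta> - (2 * (\<beta> \<bullet> \<alpha>) / (\<alpha> \<bullet> \<alpha>)) *\<^sub>R \<alpha> \<in> \<Phi>) \<and>
     (\<forall>\<alpha>\<in>\<Phi>. \<forall>\<beta>\<in>\<Phi>. 2 * (\<beta> \<bullet> \<alpha>) / (\<alpha> \<bullet> \<alpha>) \<in> \<int>)"

definition irreducible_root_system :: "'v::euclidean_space set \<Rightarrow> bool" where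
  "irreducible_root_system \<Phi> \<longleftrightarrow>
     crystallographic_root_system \<Phi> \<and> \<Phi> \<noteq> {} \<and>
     \<not> (\<exists>A B. A \<noteq> {} \<and> B \<noteq> {} \<and> A \<inter> B = {} \<and> A \<union> B = \<Phi> \<and> (\<forall>a\<in>A. \<forall>b\<in>B. a \<bullet> b = 0))"

definition nonneg_combinations :: "'v::euclidean_space set \<Rightarrow> 'v set" where
  "nonneg_combinations \<Delta> = {v. \<exists>c :: 'v \<Rightarrow> nat. v = (\<Sum>\<delta>\<in>\<Delta>. real (c \<delta>) *\<^sub>R \<delta>)}"

definition simple_roots :: "'v::euclidean_space set \<Rightarrow> 'v set \<Rightarrow> bool" where
  "simple_roots \<Phi> \<Delta> \<longleftrightarrow> \<Delta> \<subseteq> \<Phi> \<and> independent \<Delta> \<and>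
     (\<forall>\<beta>\<in>\<Phi>. \<beta> \<in> nonneg_combinations \<Delta> \<or> - \<beta> \<in> nonneg_combinations \<Delta>)"

definition positive_roots :: "'v::euclidean_space set \<Rightarrow> 'v set \<Rightarrow> 'v set" where
  "positive_roots \<Phi> \<Delta> = \<Phi> \<inter> nonneg_combinations \<Delta>"

definition root_le :: "'v::euclidean_space set \<Rightarrow> 'v \<Rightarrow> 'v \<Rightarrow> bool" where
  "root_le \<Delta> \<beta> \<gamma> \<longleftrightarrow> \<gamma> - \<beta> \<in> nonneg_combinations \<Delta>"

definition highest_root :: "'v::euclidean_space set \<Rightarrow> 'v set \<Rightarrow> 'v \<Rightarrow> bool" where
  "highest_root \<Phi> \<Delta> \<theta> \<longleftrightarrow>
     \<theta> \<in> positive_roots \<Phi> \<Delta> \<and> (\<forall>\<beta>\<in>positive_roots \<Phi> \<Delta>. root_le \<Delta> \<beta> \<theta>)"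

definition minuscule_simple_root :: "'v::euclidean_space set \<Rightarrow> 'v set \<Rightarrow> 'v \<Rightarrow> bool" where
  "minuscule_simple_root \<Phi> \<Delta> \<alpha> \<longleftrightarrow>
     \<alpha> \<in> \<Delta> \<and> (\<exists>\<theta>. highest_root \<Phi> \<Delta> \<theta> \<and> representation \<Delta> \<theta> \<alpha> = 1)"

definition roots_above :: "'v::euclidean_space set \<Rightarrow> 'v set \<Rightarrow> 'v \<Rightarrow> 'v set" where
  "roots_above \<Phi> \<Delta> \<alpha> = {\<beta> \<in> positive_roots \<Phi> \<Delta>. root_le \<Delta> \<alpha> \<beta>}"


section \<open>Minuscule posets\<close>

text \<open>Posets are considered up to isomorphism. The first argument only names the ambient Euclidean
  space of the root systems. It may have any dimension at least the ranks involved, so for finitely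
  many components a single type is no restriction.\<close>

definition connected_minuscule_poset ::
    "'v::euclidean_space itself \<Rightarrow> 'a set \<Rightarrow> 'a rel \<Rightarrow> bool" where
  "connected_minuscule_poset _ A r \<longleftrightarrow>
     (\<exists>(\<Phi> :: 'v set) \<Delta> \<alpha>. irreducible_root_system \<Phi> \<and> simple_roots \<Phi> \<Delta> \<and>
        minuscule_simple_root \<Phi> \<Delta> \<alpha> \<and>
        poset_isomorphic A r (roots_above \<Phi> \<Delta> \<alpha>)
          (relation_of (root_le \<Delta>) (roots_above \<Phi> \<Delta> \<alpha>)))"

text \<open>\<open>\<C>\<close> is the set of components; it may be empty, in which case \<open>P\<close> is empty. The last
  conjunct says that elements of different components are incomparable.\<close>

definition minuscule_poset ::
    "'v::euclidean_space itself \<Rightarrow> 'a set \<Rightarrow> 'a rel \<Rightarrow> bool" where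
  "minuscule_poset T P r \<longleftrightarrow> partial_order_on P r \<and>
     (\<exists>\<C>. finite \<C> \<and> partition_on P \<C> \<and>
        (\<forall>A\<in>\<C>. connected_minuscule_poset T A (Restr r A)) \<and>
        (\<forall>A\<in>\<C>. \<forall>B\<in>\<C>. A \<noteq> B \<longrightarrow> (\<forall>x\<in>A. \<forall>y\<in>B. (x, y) \<notin> r)))"

end

theory Submission
  imports Defs
begin

text \<open>
  Call \<open>p\<close> addable to an ideal \<open>I\<close> if \<open>I \<union> {p}\<close> is an ideal, and removable if \<open>I - {p}\<close> is one. The
  down-degree of \<open>I\<close> in \<open>J(P)\<close> is its number of removable elements. Under the uniform distribution and
  under the maximal chain distribution, every \<open>p\<close> is addable as often as it is removable. So it is
  enough to write the down-degree as a constant plus a combination of the functions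
  \<open>[p addable] - [p removable]\<close>; this property is invariant under isomorphism and passes to disjoint
  unions, which leaves the connected case.

  There, \<open>P\<close> is the set of roots on which a coweight \<open>\<omega>\<close> (orthogonal to the simple roots other
  than \<open>\<alpha>\<close>) takes the value \<open>1\<close>. Each ideal \<open>I\<close> has a base \<open>D\<close> of the root system whose positive roots
  are those of grade \<open>0\<close>, those in \<open>P - I\<close> and the negatives of those in \<open>I\<close>. The elements of \<open>D\<close> of
  grade \<open>1\<close> are the addable elements and those of grade \<open>-1\<close> are the negatives of the removable ones.
  Adding \<open>\<beta>\<close> to \<open>I\<close> replaces \<open>D\<close> by its reflection in \<open>\<beta>\<close>. Hence the coefficient of \<open>\<omega>\<close> at an addable
  \<open>\<beta>\<close> is a number \<open>c(\<beta>)\<close> that does not depend on \<open>I\<close> (distinct addable roots are orthogonal), and after \<open>\<beta>\<close>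
  has been added the coefficient at \<open>-\<beta>\<close> is \<open>c(\<beta>) - 2/(\<beta>,\<beta>)\<close>. Pairing \<open>\<omega>\<close> with its expansion in \<open>D\<close> expresses
  \<open>(\<omega>, \<omega>)\<close> as the sum of \<open>c(\<beta>)\<close> over the addable \<open>\<beta>\<close> minus the sum of \<open>c(\<beta>) - 2/(\<beta>,\<beta>)\<close> over the
  removable \<open>\<beta>\<close>,
  which is the claim if all roots in \<open>P\<close> have the same length. Otherwise there are two lengths. If no
  long root has grade \<open>0\<close>, the number of long roots in \<open>D\<close>, which does not depend on \<open>I\<close>, gives a second
  linear relation (type C). If some long root has grade \<open>0\<close>, then \<open>P\<close> is a chain (type B).
\<close>

section \<open>Toggles and the CDE property\<close>

definition addable :: "'a set \<Rightarrow> 'a rel \<Rightarrow> 'a set \<Rightarrow> 'a set" where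
  "addable P r I = {p \<in> P - I. insert p I \<in> order_ideals P r}"

definition removable :: "'a set \<Rightarrow> 'a rel \<Rightarrow> 'a set \<Rightarrow> 'a set" where
  "removable P r I = {p \<in> I. I - {p} \<in> order_ideals P r}"

text \<open>\<open>f p\<close> multiplies the statistic that is 1 if \<open>p\<close> is addable, -1
  if it is removable and 0 otherwise. The mean of this statistic vanishes under both distributions,
  so \<open>c\<close> is the common mean of the down-degree.\<close>

definition toggle_cde :: "'a set \<Rightarrow> 'a rel \<Rightarrow> bool" where
  "toggle_cde P r \<longleftrightarrow> (\<exists>c f. \<forall>I\<in>order_ideals P r.
     real (card (removable P r I)) = c + (\<Sum>p\<in>addable P r I. f p) - (\<Sum>p\<in>removable P r I. f p))"

section \<open>Order ideals of a finite poset and their covering relation\<close>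

locale finite_order =
  fixes P :: "'a set" and r :: "'a rel"
  assumes fin: "finite P" and po: "partial_order_on P r"
begin

abbreviation "J \<equiv> order_ideals P r"

lemma idealD: "I \<in> J \<Longrightarrow> x \<in> I \<Longrightarrow> y \<in> P \<Longrightarrow> (y, x) \<in> r \<Longrightarrow> y \<in> I"
  and ideal_subset: "I \<in> J \<Longrightarrow> I \<subseteq> P"
  by (auto simp: order_ideals_def)

lemma refl_in: "x \<in> P \<Longrightarrow> (x, x) \<in> r"
  and rel_trans: "(x, y) \<in> r \<Longrightarrow> (y, z) \<in> r \<Longrightarrow> (x, z) \<in> r"
  and rel_antisym: "(x, y) \<in> r \<Longrightarrow> (y, x) \<in> r \<Longrightarrow> x = y"
  using partial_order_onD[OF po] by (blast dest: refl_onD transD antisymD)+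

lemma empty_ideal: "{} \<in> J" and full_ideal: "P \<in> J"
  by (auto simp: order_ideals_def)

lemma finite_ideal: "I \<in> J \<Longrightarrow> finite I"
  by (metis finite_subset ideal_subset fin)

lemma finite_ideals: "finite J"
  by (rule finite_subset[of _ "Pow P"]) (auto simp: order_ideals_def fin)

lemma addable_iff:
  assumes I: "I \<in> J"
  shows "p \<in> addable P r I \<longleftrightarrow> p \<in> P \<and> p \<notin> I \<and> (\<forall>y\<in>P - I. (y, p) \<in> r \<longrightarrow> y = p)"
proof -
  have "insert p I \<in> J \<longleftrightarrow> (\<forall>y\<in>P. (y, p) \<in> r \<longrightarrow> y \<in> insert p I)" if "p \<in> P"
    using that ideal_subset[OF I] idealD[OF I] by (simp add: order_ideals_def; blast)
  then show ?thesis by (simp add: addable_def; blast)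
qed

lemma removable_iff:
  assumes I: "I \<in> J"
  shows "p \<in> removable P r I \<longleftrightarrow> p \<in> I \<and> (\<forall>y\<in>I. (p, y) \<in> r \<longrightarrow> y = p)"
proof -
  have "I - {p} \<in> J \<longleftrightarrow> (\<forall>y\<in>I. (p, y) \<in> r \<longrightarrow> y = p)" if "p \<in> I"
    using that ideal_subset[OF I] idealD[OF I] by (simp add: order_ideals_def; blast)
  then show ?thesis by (simp add: removable_def; blast)
qed

lemma minimal_exists:
  assumes "S \<subseteq> P" "S \<noteq> {}"
  shows "\<exists>m\<in>S. \<forall>y\<in>S. (y, m) \<in> r \<longrightarrow> y = m"
proof -
  have "finite r" by (rule finite_subset[OF partial_order_onD(4)[OF po]]) (simp add: fin)
  then have wf: "wf (r - Id)" using partial_order_on_well_order_on po by blast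
  obtain x where "x \<in> S" using assms(2) by blast
  then obtain m where "m \<in> S" "\<And>y. (y, m) \<in> r - Id \<Longrightarrow> y \<notin> S" using wfE_min[OF wf] by metis
  then show ?thesis by blast
qed

lemma maximal_exists:
  assumes "S \<subseteq> P" "S \<noteq> {}"
  shows "\<exists>m\<in>S. \<forall>y\<in>S. (m, y) \<in> r \<longrightarrow> y = m"
proof -
  interpret op: finite_order P "r\<inverse>" by unfold_locales (simp_all add: fin po)
  show ?thesis using op.minimal_exists[OF assms] by simp
qed

text \<open>A minimal element of \<open>I - K\<close> works: whatever lies strictly below it is in
  \<open>I\<close> but not in \<open>I - K\<close>, hence in \<open>K\<close>.\<close>

lemma addable_between:
  assumes "I \<in> J" "K \<in> J" "K \<subset> I"
  shows "\<exists>p\<in>I - K. p \<in> addable P r K"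
proof -
  have "I - K \<subseteq> P" "I - K \<noteq> {}" using assms ideal_subset by auto
  from minimal_exists[OF this] obtain p where p: "p \<in> I - K"
    "\<And>y. y \<in> I - K \<Longrightarrow> (y, p) \<in> r \<Longrightarrow> y = p" by blast
  have "p \<in> addable P r K"
    unfolding addable_iff[OF assms(2)] using p idealD[OF assms(1)] ideal_subset[OF assms(1)] by blast
  with p show ?thesis by blast
qed

text \<open>A maximal element of \<open>I - K\<close> works: anything of \<open>I\<close> strictly
  above it would lie in \<open>K\<close>, and \<open>K\<close>, being down-closed, would then
  contain it.\<close>

lemma removable_between:
  assumes "I \<in> J" "K \<in> J" "K \<subset> I"
  shows "\<exists>p\<in>I - K. p \<in> removable P r I"
proof -
  have "I - K \<subseteq> P" "I - K \<noteq> {}" using assms ideal_subset by auto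
  from maximal_exists[OF this] obtain p where p: "p \<in> I - K"
    "\<And>y. y \<in> I - K \<Longrightarrow> (p, y) \<in> r \<Longrightarrow> y = p" by blast
  have "p \<in> removable P r I"
    unfolding removable_iff[OF assms(1)] using p idealD[OF assms(2)] ideal_subset[OF assms(1)] by blast
  with p show ?thesis by blast
qed

lemma insert_addable: "p \<in> addable P r I \<Longrightarrow> insert p I \<in> J"
  and remove_removable: "p \<in> removable P r I \<Longrightarrow> I - {p} \<in> J"
  by (auto simp: addable_def removable_def)

lemma addable_remove: "I \<in> J \<Longrightarrow> p \<in> removable P r I \<Longrightarrow> p \<in> addable P r (I - {p})"
  using ideal_subset by (auto simp: addable_def removable_def insert_absorb)

lemma finite_poset_ideals: "finite_poset J (relation_of (\<subseteq>) J)"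
  using empty_ideal finite_ideals
  by (auto simp: finite_poset_def order_on_defs relation_of_def refl_on_def trans_def antisym_def)

text \<open>If \<open>I\<close> covers \<open>K\<close>, a removable element \<open>p\<close> of
  \<open>I\<close> outside \<open>K\<close> gives an ideal \<open>I - {p}\<close> between the two,
  which can only be \<open>K\<close>.\<close>

lemma covers_ideals_iff:
  assumes "I \<in> J"
  shows "covers J (relation_of (\<subseteq>) J) I K \<longleftrightarrow> (\<exists>p\<in>removable P r I. K = I - {p})"
proof
  assume c: "covers J (relation_of (\<subseteq>) J) I K"
  then have K: "K \<in> J" "K \<subset> I" and no: "\<And>L. L \<in> J \<Longrightarrow> K \<subseteq> L \<Longrightarrow> L \<subseteq> I \<Longrightarrow> L = K \<or> L = I"
    by (auto simp: covers_def relation_of_def)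
  obtain p where p: "p \<in> I - K" "p \<in> removable P r I" using removable_between[OF assms K] by blast
  then have "I - {p} = K" using no[of "I - {p}"] remove_removable[OF p(2)] K by blast
  then show "\<exists>p\<in>removable P r I. K = I - {p}" using p by blast
next
  assume "\<exists>p\<in>removable P r I. K = I - {p}"
  then obtain p where p: "p \<in> I" "K = I - {p}" "K \<in> J" by (auto simp: removable_def)
  then show "covers J (relation_of (\<subseteq>) J) I K"
    using assms by (auto simp: covers_def relation_of_def)
qed

lemma down_degree_ideals:
  assumes "I \<in> J"
  shows "down_degree J (relation_of (\<subseteq>) J) I = card (removable P r I)"
proof -
  have "{K \<in> J. covers J (relation_of (\<subseteq>) J) I K} = (\<lambda>p. I - {p}) ` removable P r I"
    using covers_ideals_iff[OF assms] by (auto simp: removable_def)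
  moreover have "inj_on (\<lambda>p. I - {p}) (removable P r I)"
    by (auto simp: inj_on_def removable_def)
  ultimately show ?thesis by (simp add: down_degree_def card_image)
qed

section \<open>Maximal chains of ideals as sequences of single additions\<close>

text \<open>Each member other than \<open>P\<close> is followed by one with exactly one more
  element, so these families are the linear extensions of the poset. They turn out to be the maximal
  chains of \<open>J\<close> (\<open>maximal_chains_ideals\<close>), and the stepwise form allows
  single steps to be moved.\<close>

definition saturated :: "'a set set \<Rightarrow> bool" where
  "saturated C \<longleftrightarrow> C \<subseteq> J \<and> {} \<in> C \<and> P \<in> C \<and> (\<forall>K\<in>C. \<forall>L\<in>C. K \<subseteq> L \<or> L \<subseteq> K) \<and>
     (\<forall>K\<in>C. K \<noteq> P \<longrightarrow> (\<exists>q\<in>P - K. insert q K \<in> C))"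

lemma saturatedI:
  assumes "\<And>K. K \<in> C \<Longrightarrow> K \<in> J" "{} \<in> C" "P \<in> C"
    and "\<And>K L. K \<in> C \<Longrightarrow> L \<in> C \<Longrightarrow> K \<subseteq> L \<or> L \<subseteq> K"
    and "\<And>K. K \<in> C \<Longrightarrow> K \<noteq> P \<Longrightarrow> \<exists>q\<in>P - K. insert q K \<in> C"
  shows "saturated C"
  unfolding saturated_def by (intro conjI ballI impI subsetI assms)

lemma finite_saturatedD: "saturated C \<Longrightarrow> finite C"
  using finite_subset[OF _ finite_ideals] by (auto simp: saturated_def)

lemma saturatedD:
  assumes "saturated C"
  shows "K \<in> C \<Longrightarrow> K \<in> J" "{} \<in> C" "P \<in> C"
    and "K \<in> C \<Longrightarrow> L \<in> C \<Longrightarrow> K \<subseteq> L \<or> L \<subseteq> K"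
    and "K \<in> C \<Longrightarrow> K \<noteq> P \<Longrightarrow> \<exists>q\<in>P - K. insert q K \<in> C"
  using assms by (auto simp: saturated_def)

lemma chain_family_max:
  assumes "finite S" "S \<noteq> {}" "\<And>K L. K \<in> S \<Longrightarrow> L \<in> S \<Longrightarrow> K \<subseteq> L \<or> L \<subseteq> K"
  shows "\<exists>M\<in>S. \<forall>K\<in>S. K \<subseteq> M"
proof -
  obtain M where M: "M \<in> S" "\<And>K. K \<in> S \<Longrightarrow> M \<subseteq> K \<Longrightarrow> M = K"
    using finite_has_maximal[OF assms(1,2)] by blast
  then show ?thesis using assms(3) by (metis order_refl)
qed

lemma chain_family_min:
  assumes "finite S" "S \<noteq> {}" "\<And>K L. K \<in> S \<Longrightarrow> L \<in> S \<Longrightarrow> K \<subseteq> L \<or> L \<subseteq> K"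
  shows "\<exists>M\<in>S. \<forall>K\<in>S. M \<subseteq> K"
proof -
  obtain M where M: "M \<in> S" "\<And>K. K \<in> S \<Longrightarrow> K \<subseteq> M \<Longrightarrow> M = K"
    using finite_has_minimal[OF assms(1,2)] by blast
  then show ?thesis using assms(3) by (metis order_refl)
qed

lemma Chains_ideals:
  "C \<in> Chains (relation_of (\<subseteq>) J) \<longleftrightarrow> C \<subseteq> J \<and> (\<forall>K\<in>C. \<forall>L\<in>C. K \<subseteq> L \<or> L \<subseteq> K)"
  unfolding Chains_def relation_of_def by blast

text \<open>\<open>K\<close> is the largest member without \<open>p\<close>. The next member has one
  element more and contains \<open>p\<close>, so it can only be \<open>insert p K\<close>.\<close>

lemma saturated_step:
  assumes C: "saturated C" and p: "p \<in> P"
  shows "\<exists>!K. K \<in> C \<and> p \<notin> K \<and> insert p K \<in> C"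
proof -
  have "finite {K \<in> C. p \<notin> K}" using finite_saturatedD[OF C] by simp
  moreover have "{} \<in> {K \<in> C. p \<notin> K}" using saturatedD(2)[OF C] by simp
  ultimately obtain K where K: "K \<in> C" "p \<notin> K" "\<And>L. L \<in> C \<Longrightarrow> p \<notin> L \<Longrightarrow> L \<subseteq> K"
    using chain_family_max[of "{K \<in> C. p \<notin> K}"] saturatedD(4)[OF C] by blast
  have "K \<noteq> P" using K p by auto
  then obtain q where q: "q \<in> P - K" "insert q K \<in> C" using saturatedD(5)[OF C] K by blast
  then have "q = p" using K(2) K(3)[of "insert q K"] by blast
  show ?thesis
  proof (rule ex1I[of _ K])
    show "K \<in> C \<and> p \<notin> K \<and> insert p K \<in> C" using K q \<open>q = p\<close> by blast
    fix L assume L: "L \<in> C \<and> p \<notin> L \<and> insert p L \<in> C"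
    then have "L \<subseteq> K" using K by blast
    moreover have "K \<subseteq> insert p L \<or> insert p L \<subseteq> K" using L K saturatedD(4)[OF C] by blast
    ultimately show "L = K" using K(2) by blast
  qed
qed

text \<open>In a maximal chain let \<open>M\<close> be the member after \<open>K\<close>. Adding to
  \<open>K\<close> an element of \<open>M\<close> addable to \<open>K\<close> gives an ideal
  comparable with all members, hence itself a member. Conversely, nothing fits strictly between
  \<open>K\<close> and \<open>insert q K\<close>, so a saturated family cannot be enlarged.\<close>

lemma maximal_chains_ideals: "maximal_chains J (relation_of (\<subseteq>) J) = Collect saturated"
proof (intro set_eqI iffI)
  fix C assume "C \<in> maximal_chains J (relation_of (\<subseteq>) J)"
  then have sub: "C \<subseteq> J" and ch: "\<And>K L. K \<in> C \<Longrightarrow> L \<in> C \<Longrightarrow> K \<subseteq> L \<or> L \<subseteq> K"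
    and mx: "\<And>D. D \<subseteq> J \<Longrightarrow> \<forall>K\<in>D. \<forall>L\<in>D. K \<subseteq> L \<or> L \<subseteq> K \<Longrightarrow> C \<subseteq> D \<Longrightarrow> D = C"
    by (simp_all add: maximal_chains_def Chains_ideals)
  have in_C: "X \<in> C" if "X \<in> J" "\<And>K. K \<in> C \<Longrightarrow> K \<subseteq> X \<or> X \<subseteq> K" for X
    using mx[of "insert X C"] that sub ch by blast
  have finC: "finite C" by (rule finite_subset[OF sub finite_ideals])
  have "saturated C"
  proof (rule saturatedI)
    show "{} \<in> C" using in_C empty_ideal by blast
    show PC: "P \<in> C" using in_C full_ideal sub ideal_subset by blast
    fix K assume K: "K \<in> C" "K \<noteq> P"
    let ?S = "{L \<in> C. K \<subset> L}"
    have "P \<in> ?S" using K PC sub ideal_subset by blast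
    then have ne: "?S \<noteq> {}" by blast
    have fS: "finite ?S" using finC by simp
    have "L \<subseteq> M \<or> M \<subseteq> L" if "L \<in> ?S" "M \<in> ?S" for L M using ch that by simp
    from chain_family_min[OF fS ne this] have "\<exists>M\<in>?S. \<forall>L\<in>?S. M \<subseteq> L" .
    then obtain M where M: "M \<in> C" "K \<subset> M" "\<And>L. L \<in> C \<Longrightarrow> K \<subset> L \<Longrightarrow> M \<subseteq> L" by auto
    obtain q where q: "q \<in> M - K" "q \<in> addable P r K"
      using addable_between[of M K] M K sub by blast
    have "insert q K \<in> C"
    proof (rule in_C)
      show "insert q K \<in> J" using insert_addable q by blast
      fix L assume L: "L \<in> C"
      show "L \<subseteq> insert q K \<or> insert q K \<subseteq> L"
        using ch[OF L K(1)] M(3)[OF L] q by blast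
    qed
    then show "\<exists>q\<in>P - K. insert q K \<in> C" using q by (auto simp: addable_def)
  qed (use sub ch in blast)+
  then show "C \<in> Collect saturated" by simp
next
  fix C assume "C \<in> Collect saturated"
  then have C: "saturated C" by simp
  have "X \<in> C" if D: "D \<subseteq> J" "\<forall>K\<in>D. \<forall>L\<in>D. K \<subseteq> L \<or> L \<subseteq> K" "C \<subseteq> D" and X: "X \<in> D" for D X
  proof (rule ccontr)
    assume XC: "X \<notin> C"
    let ?S = "{K \<in> C. K \<subseteq> X}"
    have "finite ?S" using finite_saturatedD[OF C] by simp
    moreover have "?S \<noteq> {}" using saturatedD(2)[OF C] by auto
    moreover have "K \<subseteq> L \<or> L \<subseteq> K" if "K \<in> ?S" "L \<in> ?S" for K L
      using saturatedD(4)[OF C] that by simp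
    ultimately have "\<exists>M\<in>?S. \<forall>K\<in>?S. K \<subseteq> M" by (rule chain_family_max)
    then obtain K where K: "K \<in> C" "K \<subseteq> X" "\<And>L. L \<in> C \<Longrightarrow> L \<subseteq> X \<Longrightarrow> L \<subseteq> K" by auto
    have "X \<subseteq> P" using ideal_subset D(1) X by (meson subsetD)
    then have "K \<noteq> P" using K(1,2) XC by (metis subset_antisym)
    then obtain q where q: "q \<in> P - K" "insert q K \<in> C" using saturatedD(5)[OF C] K(1) by meson
    then have "X \<subseteq> insert q K \<or> insert q K \<subseteq> X" using D(2,3) X by (meson subsetD)
    then show False
    proof
      assume "X \<subseteq> insert q K"
      then have "X = K \<or> X = insert q K" using K(2) by blast
      then show False using XC K(1) q(2) by metis
    next
      assume "insert q K \<subseteq> X"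
      then show False using K(3)[OF q(2)] q(1) by simp
    qed
  qed
  then have "D = C" if "D \<subseteq> J" "\<forall>K\<in>D. \<forall>L\<in>D. K \<subseteq> L \<or> L \<subseteq> K" "C \<subseteq> D" for D
    using that by (meson subsetI subset_antisym)
  moreover have "C \<subseteq> J" "\<forall>K\<in>C. \<forall>L\<in>C. K \<subseteq> L \<or> L \<subseteq> K"
    using C by (simp_all add: saturated_def)
  ultimately show "C \<in> maximal_chains J (relation_of (\<subseteq>) J)"
    by (simp add: maximal_chains_def Chains_ideals)
qed

section \<open>Moving the step of a chain at which a given element is added\<close>

text \<open>Moves the step at which \<open>p\<close> is added down to \<open>I\<close>; the second map moves it up to \<open>H\<close>.\<close>

definition add_early :: "'a \<Rightarrow> 'a set set \<Rightarrow> 'a set \<Rightarrow> 'a set set" where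
  "add_early p C I = {L \<in> C. L \<subseteq> I} \<union> insert p ` {L \<in> C. I \<subseteq> L}"

definition add_late :: "'a \<Rightarrow> 'a set set \<Rightarrow> 'a set \<Rightarrow> 'a set set" where
  "add_late p C H = {L \<in> C. H \<subseteq> L} \<union> (\<lambda>L. L - {p}) ` {L \<in> C. L \<subseteq> H}"

text \<open>All members above \<open>I\<close> receive \<open>p\<close>. They remain ideals because
  \<open>p\<close> is minimal outside \<open>I\<close>, and the step that added \<open>p\<close> in
  \<open>C\<close> collapses because both of its ends now contain \<open>p\<close>.\<close>

lemma saturated_add_early:
  assumes C: "saturated C" and I: "I \<in> C" and p: "p \<in> addable P r I"
  shows "saturated (add_early p C I)"
proof (rule saturatedI)
  have IJ: "I \<in> J" using C I saturatedD by blast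
  have pP: "p \<in> P" "p \<notin> I" using p by (auto simp: addable_def)
  note ch = saturatedD(4)[OF C]
  show "{} \<in> add_early p C I" using saturatedD(2)[OF C] by (auto simp: add_early_def)
  have "insert p P = P" using pP by blast
  then show "P \<in> add_early p C I"
    using saturatedD(3)[OF C] ideal_subset[OF IJ] unfolding add_early_def by (metis (mono_tags, lifting) UnCI image_eqI mem_Collect_eq)
  show "K \<in> J" if K: "K \<in> add_early p C I" for K
  proof (cases "K \<in> C")
    case True then show ?thesis using C saturatedD by blast
  next
    case False
    then obtain L where L: "L \<in> C" "I \<subseteq> L" "K = insert p L"
      using K unfolding add_early_def by blast
    then have LJ: "L \<in> J" using C saturatedD by blast
    show ?thesis
      using p[unfolded addable_iff[OF IJ]] L LJ pP unfolding order_ideals_def by blast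
  qed
  show "K \<subseteq> L \<or> L \<subseteq> K" if "K \<in> add_early p C I" "L \<in> add_early p C I" for K L
    using that ch unfolding add_early_def by blast
  fix K assume K: "K \<in> add_early p C I" "K \<noteq> P"
  consider "K \<in> C" "K \<subset> I" | "K = I" | L where "L \<in> C" "I \<subseteq> L" "K = insert p L"
    using K unfolding add_early_def by blast
  then show "\<exists>q\<in>P - K. insert q K \<in> add_early p C I"
  proof cases
    case 1
    then obtain q where q: "q \<in> P - K" "insert q K \<in> C" using saturatedD(5)[OF C] K by blast
    then have "insert q K \<subseteq> I" using ch[OF q(2) I] 1 by blast
    then show ?thesis using q unfolding add_early_def by blast
  next
    case 2
    then show ?thesis using pP I unfolding add_early_def by blast
  next
    case 3
    then have "L \<noteq> P" using K pP by blast
    then obtain q where q: "q \<in> P - L" "insert q L \<in> C" using saturatedD(5)[OF C] 3 by blast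
    show ?thesis
    proof (cases "q = p")
      case False
      then have "insert q K = insert p (insert q L)" "q \<notin> K" using 3 q by auto
      then show ?thesis using q 3 unfolding add_early_def by blast
    next
      \<comment> \<open>Here \<open>C\<close> adds \<open>p\<close> to \<open>L\<close>. Both ends
        of that step have become \<open>K\<close>, so the step of \<open>C\<close> after it is
        used.\<close>
      case True
      then have KC: "K \<in> C" using 3 q by simp
      then obtain q' where q': "q' \<in> P - K" "insert q' K \<in> C" using saturatedD(5)[OF C] K by blast
      then have "insert q' K = insert p (insert q' K)" using 3 by blast
      then show ?thesis using q' 3 unfolding add_early_def by blast
    qed
  qed
qed

text \<open>Removing \<open>p\<close> from the members inside \<open>H\<close> keeps them ideals
  because \<open>p\<close> is maximal in \<open>H\<close>. The step of \<open>C\<close> that added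
  \<open>p\<close> collapses, and the step from \<open>H - {p}\<close> to \<open>H\<close> adds it
  instead.\<close>

lemma saturated_add_late:
  assumes C: "saturated C" and H: "H \<in> C" and p: "p \<in> removable P r H"
  shows "saturated (add_late p C H)"
proof (rule saturatedI)
  have HJ: "H \<in> J" using C H saturatedD by blast
  have pH: "p \<in> H" "p \<in> P" using p ideal_subset[OF HJ] by (auto simp: removable_def)
  note ch = saturatedD(4)[OF C]
  show "{} \<in> add_late p C H" using saturatedD(2)[OF C] unfolding add_late_def by blast
  show "P \<in> add_late p C H" using saturatedD(3)[OF C] ideal_subset[OF HJ] unfolding add_late_def by blast
  show "K \<in> J" if K: "K \<in> add_late p C H" for K
  proof (cases "K \<in> C")
    case True then show ?thesis using C saturatedD by blast
  next
    case False
    then obtain L where L: "L \<in> C" "L \<subseteq> H" "K = L - {p}"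
      using K unfolding add_late_def by blast
    then have LJ: "L \<in> J" using C saturatedD by blast
    show ?thesis
      using p[unfolded removable_iff[OF HJ]] L LJ pH unfolding order_ideals_def by blast
  qed
  show "K \<subseteq> L \<or> L \<subseteq> K" if "K \<in> add_late p C H" "L \<in> add_late p C H" for K L
    using that ch unfolding add_late_def by blast
  fix K assume K: "K \<in> add_late p C H" "K \<noteq> P"
  consider "K \<in> C" "H \<subseteq> K" | "K = H - {p}" | L where "L \<in> C" "L \<subset> H" "K = L - {p}"
    using K unfolding add_late_def by blast
  then show "\<exists>q\<in>P - K. insert q K \<in> add_late p C H"
  proof cases
    case 1
    then obtain q where q: "q \<in> P - K" "insert q K \<in> C" using saturatedD(5)[OF C] K by blast
    then show ?thesis using 1 unfolding add_late_def by blast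
  next
    case 2
    then have "insert p K = H" using pH by blast
    then show ?thesis using pH H 2 unfolding add_late_def by blast
  next
    case 3
    have next_step: "\<exists>q\<in>P - M. insert q M \<in> C \<and> insert q M \<subseteq> H" if M: "M \<in> C" "M \<subset> H" for M
    proof -
      have "M \<noteq> P" using that ideal_subset[OF HJ] by blast
      then obtain q where q: "q \<in> P - M" "insert q M \<in> C" using saturatedD(5)[OF C] M(1) by blast
      then show ?thesis using ch[OF q(2) H] M(2) by blast
    qed
    have eq: "K = H - {p} \<Longrightarrow> ?thesis"
    proof -
      assume "K = H - {p}"
      then have "insert p K = H" "p \<notin> K" using pH by blast+
      then show ?thesis using pH H unfolding add_late_def by blast
    qed
    obtain q where q: "q \<in> P - L" "insert q L \<in> C" "insert q L \<subseteq> H" using next_step 3 by blast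
    show ?thesis
    proof (cases "q = p")
      case False
      then have "insert q K = insert q L - {p}" "q \<notin> K" using 3 q by auto
      then show ?thesis using q unfolding add_late_def by blast
    next
      case True
      show ?thesis
      \<comment> \<open>The step of \<open>C\<close> at \<open>L\<close> is the one that adds
        \<open>p\<close> and collapses. If it ends at \<open>H\<close>, then \<open>p\<close> is
        added now; otherwise the following step of \<open>C\<close> is taken, with \<open>p\<close>
        removed.\<close>
      proof (cases "insert p L = H")
        case True
        then have "K = H - {p}" using 3 q \<open>q = p\<close> by blast
        then show ?thesis by (rule eq)
      next
        case False
        then have "insert p L \<subset> H" using q True by blast
        then obtain q' where q': "q' \<in> P - insert p L" "insert q' (insert p L) \<in> C" "insert q' (insert p L) \<subseteq> H"
          using next_step[of "insert p L"] q True by blast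
        then have "insert q' K = insert q' (insert p L) - {p}" "q' \<notin> K" using 3 q by auto
        then show ?thesis using q' unfolding add_late_def by blast
      qed
    qed
  qed
qed

text \<open>\<open>K\<close> is the member at which \<open>C\<close> itself adds \<open>p\<close>,
  so \<open>insert p K\<close> is the height to which the step has to be moved back.\<close>

lemma add_late_early:
  assumes C: "saturated C" and I: "I \<in> C" "p \<in> addable P r I"
    and K: "K \<in> C" "p \<notin> K" "insert p K \<in> C"
  shows "add_late p (add_early p C I) (insert p K) = C"
proof -
  note ch = saturatedD(4)[OF C]
  have pI: "p \<notin> I" using I by (auto simp: addable_def)
  have IK: "I \<subseteq> K" using ch[OF I(1) K(3)] ch[OF I(1) K(1)] pI by blast
  \<comment> \<open>\<open>K\<close> and \<open>insert p K\<close> are consecutive in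
    \<open>C\<close>: every other member lies below the first or above the second.\<close>
  have step: "L \<subseteq> K \<or> insert p K \<subseteq> L" if "L \<in> C" for L
    using ch[OF that K(1)] ch[OF that K(3)] K(2) by blast
  show ?thesis
  proof
    show "add_late p (add_early p C I) (insert p K) \<subseteq> C"
    proof
      fix X assume "X \<in> add_late p (add_early p C I) (insert p K)"
      then consider L where "L \<in> C" "I \<subseteq> L" "X = insert p L" "insert p K \<subseteq> X"
        | "X \<in> C"
        | L where "L \<in> C" "L \<subseteq> I" "X = L - {p}"
        | L where "L \<in> C" "I \<subseteq> L" "X = insert p L - {p}" "insert p L \<subseteq> insert p K"
        unfolding add_late_def add_early_def using pI K(2) by blast
      then show "X \<in> C"
      proof cases
        case 1
        show ?thesis
        proof (cases "L \<subseteq> K")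
          case True
          then have "L = K" using 1 K(2) by blast
          then show ?thesis using 1 K by simp
        next
          case False
          then show ?thesis using step[OF 1(1)] 1 by (simp add: insert_absorb)
        qed
      next
        case 3
        then have "X = L" using pI by blast
        then show ?thesis using 3 by simp
      next
        case 4
        show ?thesis
        proof (cases "p \<in> L")
          case True
          then have "L = insert p K" using step[OF 4(1)] 4 K(2) by blast
          then show ?thesis using 4 K by simp
        qed (use 4 in simp)
      qed
    qed
    show "C \<subseteq> add_late p (add_early p C I) (insert p K)"
    proof
      fix L assume L: "L \<in> C"
      show "L \<in> add_late p (add_early p C I) (insert p K)"
      proof (cases "insert p K \<subseteq> L")
        case True
        then have "L = insert p L" "I \<subseteq> L" using IK by auto
        then have "L \<in> add_early p C I" using L unfolding add_early_def by blast
        then show ?thesis using True unfolding add_late_def by blast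
      next
        case False
        then have LK: "L \<subseteq> K" using step[OF L] by blast
        show ?thesis
        proof (cases "L \<subseteq> I")
          case True
          then have "L = L - {p}" "L \<in> add_early p C I" "L \<subseteq> insert p K"
            using L pI LK unfolding add_early_def by auto
          then show ?thesis unfolding add_late_def by blast
        next
          case False
          then have "insert p L \<in> add_early p C I" "insert p L \<subseteq> insert p K" "L = insert p L - {p}"
            using L LK K(2) ch[OF L I(1)] unfolding add_early_def by auto
          then show ?thesis unfolding add_late_def by blast
        qed
      qed
    qed
  qed
qed

lemma add_early_late:
  assumes C: "saturated C" and H: "H \<in> C" "p \<in> removable P r H"
    and K: "K \<in> C" "p \<notin> K" "insert p K \<in> C"
  shows "add_early p (add_late p C H) K = C"
proof -
  note ch = saturatedD(4)[OF C]
  have pH: "p \<in> H" using H by (auto simp: removable_def)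
  have KH: "insert p K \<subseteq> H" using ch[OF H(1) K(3)] ch[OF H(1) K(1)] pH K(2) by blast
  have step: "L \<subseteq> K \<or> insert p K \<subseteq> L" if "L \<in> C" for L
    using ch[OF that K(1)] ch[OF that K(3)] K(2) by blast
  show ?thesis
  proof
    show "add_early p (add_late p C H) K \<subseteq> C"
    proof
      fix X assume "X \<in> add_early p (add_late p C H) K"
      then consider L where "L \<in> C" "L \<subseteq> H" "X = L - {p}" "X \<subseteq> K"
        | "X \<in> C"
        | L where "L \<in> C" "H \<subseteq> L" "X = insert p L"
        | L where "L \<in> C" "L \<subseteq> H" "X = insert p (L - {p})" "K \<subseteq> L - {p}"
        unfolding add_late_def add_early_def by auto
      then show "X \<in> C"
      proof cases
        case 1
        show ?thesis
        proof (cases "p \<in> L")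
          case True
          then have "X = K" using step[OF 1(1)] 1 K(2) by blast
          then show ?thesis using K by simp
        qed (use 1 in simp)
      next
        case 3
        then have "X = L" using pH by blast
        then show ?thesis using 3 by simp
      next
        case 4
        show ?thesis
        proof (cases "p \<in> L")
          case False
          then have "X = insert p K" using step[OF 4(1)] 4 by blast
          then show ?thesis using K by simp
        qed (use 4 in \<open>simp add: insert_absorb\<close>)
      qed
    qed
    show "C \<subseteq> add_early p (add_late p C H) K"
    proof
      fix L assume L: "L \<in> C"
      show "L \<in> add_early p (add_late p C H) K"
      proof (cases "L \<subseteq> K")
        case True
        then have "L = L - {p}" "L \<subseteq> H" using K(2) KH by auto
        then have "L \<in> add_late p C H" using L unfolding add_late_def by blast
        then show ?thesis using True unfolding add_early_def by blast
      next
        case False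
        then have LK: "insert p K \<subseteq> L" using step[OF L] by blast
        show ?thesis
        proof (cases "H \<subseteq> L")
          case True
          then have "L = insert p L" "L \<in> add_late p C H" "K \<subseteq> L"
            using L pH LK unfolding add_late_def by auto
          then show ?thesis unfolding add_early_def by blast
        next
          case False
          then have "L - {p} \<in> add_late p C H" "K \<subseteq> L - {p}" "L = insert p (L - {p})"
            using L LK K(2) ch[OF L H(1)] unfolding add_late_def by auto
          then show ?thesis unfolding add_early_def by blast
        qed
      qed
    qed
  qed
qed

section \<open>Balance of additions and removals under both distributions\<close>

lemma chain_count_ideals: "chain_count J (relation_of (\<subseteq>) J) I = card {C. saturated C \<and> I \<in> C}"
  by (simp add: chain_count_def maximal_chains_ideals)

lemma finite_saturated: "finite {C. saturated C}"
  by (rule finite_subset[of _ "Pow J"]) (auto simp: finite_ideals dest: saturatedD)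

text \<open>\<open>K\<close> is determined by \<open>C\<close> through
  \<open>saturated_step\<close>, so recording it does not change the count. It is carried along
  because the inverse of a move has to know where \<open>p\<close> was added.\<close>

lemma sum_marked_chains:
  assumes "p \<in> P" "S \<subseteq> J"
  shows "(\<Sum>I\<in>S. chain_count J (relation_of (\<subseteq>) J) I) =
    card {(C, I, K). saturated C \<and> I \<in> C \<and> I \<in> S \<and> K \<in> C \<and> p \<notin> K \<and> insert p K \<in> C}"
    (is "_ = card ?T")
proof -
  let ?A = "SIGMA I:S. {C. saturated C \<and> I \<in> C}"
  have finS: "finite S" by (rule finite_subset[OF assms(2) finite_ideals])
  have "bij_betw (\<lambda>(C, I, K). (I, C)) ?T ?A"
    unfolding bij_betw_def
  proof
    show "inj_on (\<lambda>(C, I, K). (I, C)) ?T"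
      using saturated_step[OF _ assms(1)] by (auto simp: inj_on_def)
    have "(I, C) \<in> (\<lambda>(C, I, K). (I, C)) ` ?T" if IC: "I \<in> S" "saturated C" "I \<in> C" for I C
    proof -
      obtain K where "K \<in> C" "p \<notin> K" "insert p K \<in> C" using saturated_step[OF IC(2) assms(1)] by blast
      then show ?thesis using IC by (intro image_eqI[of _ _ "(C, I, K)"]) auto
    qed
    then show "(\<lambda>(C, I, K). (I, C)) ` ?T = ?A" by auto
  qed
  then have "card ?T = card ?A" by (rule bij_betw_same_card)
  also have "\<dots> = (\<Sum>I\<in>S. card {C. saturated C \<and> I \<in> C})"
    by (rule card_SigmaI) (use finS finite_subset[OF _ finite_saturated] in \<open>auto simp: Collect_mono\<close>)
  finally show ?thesis by (simp add: chain_count_ideals)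
qed

text \<open>Given a chain \<open>C\<close> with a marked member \<open>I\<close> to which
  \<open>p\<close> can be added, add \<open>p\<close> already at \<open>I\<close> and mark
  \<open>insert p K\<close> instead, where \<open>K\<close> is the place at which \<open>C\<close>
  added \<open>p\<close>. From the new mark \<open>p\<close> can be removed, and the old mark
  \<open>I\<close> has become the place of addition, which makes the map invertible.\<close>

lemma chain_count_toggle:
  assumes "p \<in> P"
  shows "(\<Sum>I | I \<in> J \<and> p \<in> addable P r I. chain_count J (relation_of (\<subseteq>) J) I) =
    (\<Sum>I | I \<in> J \<and> p \<in> removable P r I. chain_count J (relation_of (\<subseteq>) J) I)"
proof -
  let ?A = "{(C, I, K). saturated C \<and> I \<in> C \<and> I \<in> {I. I \<in> J \<and> p \<in> addable P r I} \<and> K \<in> C \<and> p \<notin> K \<and> insert p K \<in> C}"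
  let ?B = "{(C, I, K). saturated C \<and> I \<in> C \<and> I \<in> {I. I \<in> J \<and> p \<in> removable P r I} \<and> K \<in> C \<and> p \<notin> K \<and> insert p K \<in> C}"
  let ?f = "\<lambda>(C, I, K). (add_early p C I, insert p K, I)"
  let ?g = "\<lambda>(C, H, K). (add_late p C H, K, H - {p})"
  have "bij_betw ?f ?A ?B"
  proof (rule bij_betw_byWitness[where f' = ?g])
    show "\<forall>a\<in>?A. ?g (?f a) = a"
      using add_late_early by (auto simp: addable_def)
    show "\<forall>a\<in>?B. ?f (?g a) = a"
      using add_early_late by (auto simp: removable_def)
    show "?f ` ?A \<subseteq> ?B"
    proof clarsimp
      fix C I K assume h: "saturated C" "I \<in> C" "I \<in> J" "p \<in> addable P r I" "K \<in> C" "p \<notin> K" "insert p K \<in> C"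
      have pI: "p \<notin> I" using h by (auto simp: addable_def)
      have IK: "I \<subseteq> K" using saturatedD(4)[OF h(1)] h pI by blast
      have KJ: "K \<in> J" "insert p K \<in> J" using saturatedD(1)[OF h(1)] h by blast+
      have "p \<in> removable P r (insert p K)" using KJ h(6) by (auto simp: removable_def)
      then show "saturated (add_early p C I) \<and> insert p K \<in> add_early p C I \<and> insert p K \<in> J \<and>
        p \<in> removable P r (insert p K) \<and> I \<in> add_early p C I \<and> p \<notin> I \<and> insert p I \<in> add_early p C I"
        using saturated_add_early[OF h(1,2,4)] KJ pI IK h unfolding add_early_def by blast
    qed
    show "?g ` ?B \<subseteq> ?A"
    proof clarsimp
      fix C H K assume h: "saturated C" "H \<in> C" "H \<in> J" "p \<in> removable P r H" "K \<in> C" "p \<notin> K" "insert p K \<in> C"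
      have pH: "p \<in> H" using h by (auto simp: removable_def)
      have KH: "insert p K \<subseteq> H" using saturatedD(4)[OF h(1)] h pH by blast
      have KJ: "K \<in> J" "insert p K \<in> J" using saturatedD(1)[OF h(1)] h by blast+
      have "p \<in> addable P r K" using KJ h(6) assms by (auto simp: addable_def)
      moreover have "K = K - {p}" using h(6) by simp
      then have "K \<in> add_late p C H" using KH h unfolding add_late_def by blast
      moreover have "insert p H = H" using pH by blast
      ultimately show "saturated (add_late p C H) \<and> K \<in> add_late p C H \<and> K \<in> J \<and>
        p \<in> addable P r K \<and> H - {p} \<in> add_late p C H \<and> insert p H \<in> add_late p C H"
        using saturated_add_late[OF h(1,2,4)] KJ h unfolding add_late_def by auto
    qed
  qed
  then have "card ?A = card ?B" by (rule bij_betw_same_card)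
  then show ?thesis
    by (subst (1 2) sum_marked_chains[OF assms]) auto
qed

text \<open>Inserting \<open>p\<close> is a bijection between the two families, with the removal of
  \<open>p\<close> as its inverse.\<close>

lemma uniform_toggle:
  assumes "p \<in> P"
  shows "card {I. I \<in> J \<and> p \<in> addable P r I} = card {I. I \<in> J \<and> p \<in> removable P r I}"
  by (rule bij_betw_same_card[of "insert p"], rule bij_betw_byWitness[where f' = "\<lambda>I. I - {p}"])
     (use assms in \<open>auto simp: addable_def removable_def insert_absorb dest: ideal_subset\<close>)

text \<open>\<open>w\<close> is a distribution before normalisation: the constant 1 for the uniform
  one, \<open>chain_count\<close> for the one given by maximal chains. Exchanging the sums over
  ideals and over elements leaves, for each \<open>p\<close>, the multiple \<open>f p\<close> of a
  difference that vanishes by balance.\<close>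

lemma expectation_removable:
  fixes w :: "'a set \<Rightarrow> real"
  assumes f: "\<And>I. I \<in> J \<Longrightarrow> real (card (removable P r I)) =
      c + (\<Sum>p\<in>addable P r I. f p) - (\<Sum>p\<in>removable P r I. f p)"
    and w: "\<And>p. p \<in> P \<Longrightarrow> (\<Sum>I | I \<in> J \<and> p \<in> addable P r I. w I) = (\<Sum>I | I \<in> J \<and> p \<in> removable P r I. w I)"
  shows "(\<Sum>I\<in>J. w I * real (card (removable P r I))) = c * (\<Sum>I\<in>J. w I)"
proof -
  have swap: "(\<Sum>I\<in>J. w I * (\<Sum>p\<in>T I. f p)) = (\<Sum>p\<in>P. f p * (\<Sum>I | I \<in> J \<and> p \<in> T I. w I))"
    if T: "\<And>I. I \<in> J \<Longrightarrow> T I \<subseteq> P" for T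
  proof -
    have "(\<Sum>I\<in>J. w I * (\<Sum>p\<in>T I. f p)) = (\<Sum>I\<in>J. \<Sum>p | p \<in> P \<and> p \<in> T I. w I * f p)"
      by (intro sum.cong refl) (use T in \<open>auto simp: sum_distrib_left intro!: sum.cong\<close>)
    also have "\<dots> = (\<Sum>p\<in>P. \<Sum>I | I \<in> J \<and> p \<in> T I. w I * f p)"
      by (rule sum.swap_restrict[OF finite_ideals fin])
    finally show ?thesis by (simp add: sum_distrib_left mult.commute)
  qed
  have "(\<Sum>I\<in>J. w I * real (card (removable P r I))) =
      (\<Sum>I\<in>J. c * w I + w I * (\<Sum>p\<in>addable P r I. f p) - w I * (\<Sum>p\<in>removable P r I. f p))"
    by (intro sum.cong refl) (simp add: f algebra_simps)
  also have "\<dots> = c * (\<Sum>I\<in>J. w I) + (\<Sum>I\<in>J. w I * (\<Sum>p\<in>addable P r I. f p))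
      - (\<Sum>I\<in>J. w I * (\<Sum>p\<in>removable P r I. f p))"
    by (simp add: sum.distrib sum_subtractf sum_distrib_left)
  also have "\<dots> = c * (\<Sum>I\<in>J. w I)"
    using w by (subst (1 2) swap) (auto simp: addable_def removable_def dest: ideal_subset)
  finally show ?thesis .
qed

lemma toggle_cde_imp_cde:
  assumes "toggle_cde P r"
  shows "cde J (relation_of (\<subseteq>) J)"
proof -
  let ?R = "relation_of (\<subseteq>) J"
  obtain c f where f: "\<And>I. I \<in> J \<Longrightarrow> real (card (removable P r I)) =
      c + (\<Sum>p\<in>addable P r I. f p) - (\<Sum>p\<in>removable P r I. f p)"
    using assms unfolding toggle_cde_def by blast
  have J: "J \<noteq> {}" using empty_ideal by blast
  have "(\<Sum>I\<in>J. real (card (removable P r I))) = c * real (card J)"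
    using expectation_removable[OF f, of "\<lambda>_. 1"] uniform_toggle by simp
  moreover have "(\<Sum>I\<in>J. real (chain_count J ?R I) * real (card (removable P r I))) =
      c * (\<Sum>I\<in>J. real (chain_count J ?R I))"
    by (rule expectation_removable[OF f])
       (simp_all add: chain_count_toggle flip: of_nat_sum)
  moreover have "(\<Sum>I\<in>J. real (chain_count J ?R I)) > 0"
    using J finite_ideals chain_count_pos[OF finite_poset_ideals] by (intro sum_pos) auto
  moreover have "real (card J) > 0" using J finite_ideals by (simp add: card_gt_0_iff)
  ultimately show ?thesis
    unfolding cde_iff_sums[OF finite_poset_ideals]
    by (simp add: down_degree_ideals cong: sum.cong)
qed

end

section \<open>Isomorphisms, disjoint unions and chains\<close>

lemma order_ideals_image:
  assumes bij: "bij_betw f A B" and iso: "\<And>x y. x \<in> A \<Longrightarrow> y \<in> A \<Longrightarrow> (x, y) \<in> r \<longleftrightarrow> (f x, f y) \<in> s"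
    and I: "I \<subseteq> A"
  shows "f ` I \<in> order_ideals B s \<longleftrightarrow> I \<in> order_ideals A r"
proof -
  have inj: "inj_on f A" and B: "B = f ` A" using bij by (auto simp: bij_betw_def)
  have mem: "f y \<in> f ` I \<longleftrightarrow> y \<in> I" if "y \<in> A" for y
    using inj_on_image_mem_iff[OF inj that I] .
  have "f ` I \<in> order_ideals B s \<longleftrightarrow> (\<forall>x\<in>I. \<forall>y\<in>A. (f y, f x) \<in> s \<longrightarrow> f y \<in> f ` I)"
    using I by (auto simp: order_ideals_def B)
  also have "\<dots> \<longleftrightarrow> (\<forall>x\<in>I. \<forall>y\<in>A. (y, x) \<in> r \<longrightarrow> y \<in> I)"
    using I iso mem by (meson subsetD)
  finally show ?thesis using I by (simp add: order_ideals_def)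
qed

lemma toggle_cde_isomorphic:
  assumes "poset_isomorphic A r B s" "toggle_cde B s"
  shows "toggle_cde A r"
proof -
  obtain f where bij: "bij_betw f A B"
    and iso: "\<And>x y. x \<in> A \<Longrightarrow> y \<in> A \<Longrightarrow> (x, y) \<in> r \<longleftrightarrow> (f x, f y) \<in> s"
    using assms(1) by (auto simp: poset_isomorphic_def)
  obtain c h where h: "\<And>I. I \<in> order_ideals B s \<Longrightarrow> real (card (removable B s I)) =
      c + (\<Sum>p\<in>addable B s I. h p) - (\<Sum>p\<in>removable B s I. h p)"
    using assms(2) unfolding toggle_cde_def by blast
  have inj: "inj_on f A" and B: "B = f ` A" using bij by (auto simp: bij_betw_def)
  note ideal = order_ideals_image[OF bij iso]
  show ?thesis
    unfolding toggle_cde_def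
  proof (intro exI[of _ c] exI[of _ "h \<circ> f"] ballI)
    fix I assume I: "I \<in> order_ideals A r"
    then have sub: "I \<subseteq> A" by (simp add: order_ideals_def)
    have fI: "f ` I \<in> order_ideals B s" using ideal[OF _ _ sub] I by blast
    have "f p \<in> addable B s (f ` I) \<longleftrightarrow> p \<in> addable A r I" if "p \<in> A" for p
      using ideal[of "insert p I"] inj_on_image_mem_iff[OF inj that sub] that sub
      by (auto simp: addable_def B)
    then have add: "addable B s (f ` I) = f ` addable A r I"
      by (auto simp: addable_def B)
    have "f ` I - {f p} = f ` (I - {p})" if "p \<in> I" for p
      using inj_on_image_set_diff[OF inj, of I "{p}"] that sub by auto
    then have "f p \<in> removable B s (f ` I) \<longleftrightarrow> p \<in> removable A r I" if "p \<in> I" for p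
      using ideal[of "I - {p}"] that sub by (auto simp: removable_def)
    then have rem: "removable B s (f ` I) = f ` removable A r I"
      by (auto simp: removable_def)
    have "inj_on f (addable A r I)" "inj_on f (removable A r I)"
      using sub by (auto intro: inj_on_subset[OF inj] simp: addable_def removable_def)
    then show "real (card (removable A r I)) =
        c + (\<Sum>p\<in>addable A r I. (h \<circ> f) p) - (\<Sum>p\<in>removable A r I. (h \<circ> f) p)"
      using h[OF fI] by (simp add: add rem sum.reindex card_image)
  qed
qed

lemma order_ideals_disjoint_union:
  assumes part: "partition_on P \<C>"
    and cross: "\<And>A B x y. A \<in> \<C> \<Longrightarrow> B \<in> \<C> \<Longrightarrow> A \<noteq> B \<Longrightarrow> x \<in> A \<Longrightarrow> y \<in> B \<Longrightarrow> (x, y) \<notin> r"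
  shows "I \<in> order_ideals P r \<longleftrightarrow> I \<subseteq> P \<and> (\<forall>A\<in>\<C>. I \<inter> A \<in> order_ideals A (Restr r A))"
proof -
  have P: "P = \<Union>\<C>" using part by (simp add: partition_on_def)
  show ?thesis
  proof (intro iffI conjI ballI)
    assume I: "I \<in> order_ideals P r"
    then show "I \<subseteq> P" by (simp add: order_ideals_def)
    fix A assume "A \<in> \<C>"
    then show "I \<inter> A \<in> order_ideals A (Restr r A)" using I P by (auto simp: order_ideals_def)
  next
    assume I: "I \<subseteq> P \<and> (\<forall>A\<in>\<C>. I \<inter> A \<in> order_ideals A (Restr r A))"
    have "y \<in> I" if xy: "x \<in> I" "y \<in> P" "(y, x) \<in> r" for x y
    proof -
      obtain A B where "A \<in> \<C>" "B \<in> \<C>" "y \<in> A" "x \<in> B" using xy I P by blast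
      moreover from this have "A = B" using cross xy by blast
      ultimately show ?thesis using I xy by (auto simp: order_ideals_def)
    qed
    then show "I \<in> order_ideals P r" using I by (auto simp: order_ideals_def)
  qed
qed

text \<open>The constants of the blocks add up and their multipliers glue together, because toggling
  \<open>p\<close> changes an ideal only inside the block of \<open>p\<close>.\<close>

lemma toggle_cde_disjoint_union:
  assumes fin: "finite P" and part: "partition_on P \<C>"
    and cross: "\<And>A B x y. A \<in> \<C> \<Longrightarrow> B \<in> \<C> \<Longrightarrow> A \<noteq> B \<Longrightarrow> x \<in> A \<Longrightarrow> y \<in> B \<Longrightarrow> (x, y) \<notin> r"
    and comp: "\<And>A. A \<in> \<C> \<Longrightarrow> toggle_cde A (Restr r A)"
  shows "toggle_cde P r"
proof -
  have P: "P = \<Union>\<C>" and disj: "\<And>A B. A \<in> \<C> \<Longrightarrow> B \<in> \<C> \<Longrightarrow> A \<noteq> B \<Longrightarrow> A \<inter> B = {}"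
    using part by (auto simp: partition_on_def disjoint_def)
  have finC: "finite \<C>" using fin P finite_UnionD by blast
  have finA: "finite A" if "A \<in> \<C>" for A using finite_subset[OF _ fin, of A] that P by blast
  have ideal: "K \<in> order_ideals P r \<longleftrightarrow> K \<subseteq> P \<and> (\<forall>A\<in>\<C>. K \<inter> A \<in> order_ideals A (Restr r A))" for K
    by (rule order_ideals_disjoint_union[OF part]) (rule cross)
  obtain c h where h: "\<And>A I. A \<in> \<C> \<Longrightarrow> I \<in> order_ideals A (Restr r A) \<Longrightarrow>
      real (card (removable A (Restr r A) I)) =
      c A + (\<Sum>p\<in>addable A (Restr r A) I. h A p) - (\<Sum>p\<in>removable A (Restr r A) I. h A p)"
    using comp unfolding toggle_cde_def by metis
  \<comment> \<open>The block containing \<open>p\<close>; the blocks are disjoint, so the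
    description is unique on \<open>P\<close>.\<close>
  define blk where "blk p = (THE A. A \<in> \<C> \<and> p \<in> A)" for p
  have blk: "blk p = A" if "A \<in> \<C>" "p \<in> A" for p A
    unfolding blk_def using that disj by (intro the_equality) auto
  show ?thesis
    unfolding toggle_cde_def
  proof (intro exI[of _ "\<Sum>A\<in>\<C>. c A"] exI[of _ "\<lambda>p. h (blk p) p"] ballI)
    fix I assume I: "I \<in> order_ideals P r"
    then have IP: "I \<subseteq> P" and IA: "\<And>A. A \<in> \<C> \<Longrightarrow> I \<inter> A \<in> order_ideals A (Restr r A)"
      using ideal[of I] by auto
    have other: "insert p I \<inter> B = I \<inter> B" "(I - {p}) \<inter> B = I \<inter> B"
      if "A \<in> \<C>" "p \<in> A" "B \<in> \<C>" "B \<noteq> A" for A B p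
      using that disj[of A B] by auto
    have add: "p \<in> addable P r I \<longleftrightarrow> p \<in> addable A (Restr r A) (I \<inter> A)" if A: "A \<in> \<C>" "p \<in> A" for p A
    proof -
      have "insert p I \<in> order_ideals P r \<longleftrightarrow> insert p I \<inter> A \<in> order_ideals A (Restr r A)"
      proof -
        have "insert p I \<inter> B \<in> order_ideals B (Restr r B)" if "B \<in> \<C>" "B \<noteq> A" for B
          using IA[OF that(1)] other(1)[OF A that] by simp
        moreover have "insert p I \<subseteq> P" using IP A P by blast
        ultimately show ?thesis using ideal[of "insert p I"] A(1) by metis
      qed
      moreover have "insert p I \<inter> A = insert p (I \<inter> A)" using A by blast
      ultimately show ?thesis using A P by (auto simp: addable_def)
    qed
    have rem: "p \<in> removable P r I \<longleftrightarrow> p \<in> removable A (Restr r A) (I \<inter> A)" if A: "A \<in> \<C>" "p \<in> A" for p A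
    proof -
      have "I - {p} \<in> order_ideals P r \<longleftrightarrow> (I - {p}) \<inter> A \<in> order_ideals A (Restr r A)"
      proof -
        have "(I - {p}) \<inter> B \<in> order_ideals B (Restr r B)" if "B \<in> \<C>" "B \<noteq> A" for B
          using IA[OF that(1)] other(2)[OF A that] by simp
        moreover have "I - {p} \<subseteq> P" using IP by blast
        ultimately show ?thesis using ideal[of "I - {p}"] A(1) by metis
      qed
      moreover have "(I - {p}) \<inter> A = I \<inter> A - {p}" by blast
      ultimately show ?thesis using A by (auto simp: removable_def)
    qed
    have addU: "addable P r I = (\<Union>A\<in>\<C>. addable A (Restr r A) (I \<inter> A))"
      using add P by (fastforce simp: addable_def)
    have remU: "removable P r I = (\<Union>A\<in>\<C>. removable A (Restr r A) (I \<inter> A))"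
    proof (intro set_eqI iffI)
      fix p assume p: "p \<in> removable P r I"
      then obtain A where A: "A \<in> \<C>" "p \<in> A" using IP P by (auto simp: removable_def)
      then show "p \<in> (\<Union>A\<in>\<C>. removable A (Restr r A) (I \<inter> A))" using rem[OF A] p by blast
    next
      fix p assume "p \<in> (\<Union>A\<in>\<C>. removable A (Restr r A) (I \<inter> A))"
      then obtain A where A: "A \<in> \<C>" "p \<in> removable A (Restr r A) (I \<inter> A)" by blast
      then have "p \<in> A" by (simp add: removable_def)
      then show "p \<in> removable P r I" using rem[OF A(1)] A(2) by blast
    qed
    have sumA: "(\<Sum>p\<in>addable P r I. g p) = (\<Sum>A\<in>\<C>. \<Sum>p\<in>addable A (Restr r A) (I \<inter> A). g p)" for g :: "'a \<Rightarrow> real"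
      unfolding addU using finC finA disj
      by (intro sum.UNION_disjoint) (auto simp: addable_def)
    have sumR: "(\<Sum>p\<in>removable P r I. g p) = (\<Sum>A\<in>\<C>. \<Sum>p\<in>removable A (Restr r A) (I \<inter> A). g p)" for g :: "'a \<Rightarrow> real"
      unfolding remU using finC finA disj
      by (intro sum.UNION_disjoint) (auto simp: removable_def)
    have "real (card (removable P r I)) = (\<Sum>A\<in>\<C>. real (card (removable A (Restr r A) (I \<inter> A))))"
      using sumR[of "\<lambda>_. 1"] by simp
    also have "\<dots> = (\<Sum>A\<in>\<C>. c A) + (\<Sum>A\<in>\<C>. \<Sum>p\<in>addable A (Restr r A) (I \<inter> A). h A p)
        - (\<Sum>A\<in>\<C>. \<Sum>p\<in>removable A (Restr r A) (I \<inter> A). h A p)"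
      by (simp add: h IA sum.distrib sum_subtractf)
    also have "(\<Sum>A\<in>\<C>. \<Sum>p\<in>addable A (Restr r A) (I \<inter> A). h A p) = (\<Sum>p\<in>addable P r I. h (blk p) p)"
      unfolding sumA by (intro sum.cong refl) (auto simp: addable_def blk)
    also have "(\<Sum>A\<in>\<C>. \<Sum>p\<in>removable A (Restr r A) (I \<inter> A). h A p) = (\<Sum>p\<in>removable P r I. h (blk p) p)"
      unfolding sumR by (intro sum.cong refl) (auto simp: removable_def blk)
    finally show "real (card (removable P r I)) = (\<Sum>A\<in>\<C>. c A) +
        (\<Sum>p\<in>addable P r I. h (blk p) p) - (\<Sum>p\<in>removable P r I. h (blk p) p)" .
  qed
qed

text \<open>The ideals of a chain are its initial segments. Each has exactly one addable element
  unless it is \<open>P\<close>, and exactly one removable element unless it is empty.\<close>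

lemma (in finite_order) toggle_cde_chain:
  assumes total: "\<And>x y. x \<in> P \<Longrightarrow> y \<in> P \<Longrightarrow> (x, y) \<in> r \<or> (y, x) \<in> r"
  shows "toggle_cde P r"
proof -
  define n where "n = card P"
  define h where "h p = card {q \<in> P. (q, p) \<in> r}" for p
  \<comment> \<open>\<open>h p\<close> is the rank of \<open>p\<close>, and consecutive ranks differ
    by 1, so an ideal other than \<open>{}\<close> and \<open>P\<close> gets the value
    \<open>n / (n + 1) + 1 / (n + 1) = 1\<close>. The shift by -1 cancels there and corrects the
    ends: 0 at the empty ideal, 1 at a nonempty \<open>P\<close>.\<close>
  define f where "f p = real (h p) / (real n + 1) - 1" for p
  have lower: "{q \<in> P. (q, p) \<in> r} = insert p I" if I: "I \<in> J" and p: "p \<in> addable P r I" for p I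
  proof -
    have p': "p \<in> P" "p \<notin> I" "\<And>y. y \<in> P - I \<Longrightarrow> (y, p) \<in> r \<Longrightarrow> y = p"
      using p addable_iff[OF I] by auto
    have "(q, p) \<in> r" if "q \<in> I" for q
      using total[of q p] idealD[OF I that] that p' ideal_subset[OF I] by blast
    then show ?thesis using p' refl_in ideal_subset[OF I] by blast
  qed
  have hadd: "h p = card I + 1" if "I \<in> J" "p \<in> addable P r I" for p I
    using lower[OF that] that finite_ideal[of I] by (simp add: h_def addable_def)
  have hrem: "h p = card I" if I: "I \<in> J" and p: "p \<in> removable P r I" for p I
    using hadd[OF remove_removable[OF p] addable_remove[OF I p]] card_Suc_Diff1[OF finite_ideal[OF I], of p] p
    by (simp add: removable_def)
  have at_most_add: "p = q" if "I \<in> J" "p \<in> addable P r I" "q \<in> addable P r I" for p q I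
    using that total[of p q] unfolding addable_iff[OF that(1)] by blast
  have at_most_rem: "p = q" if "I \<in> J" "p \<in> removable P r I" "q \<in> removable P r I" for p q I
    using that total[of p q] ideal_subset[OF that(1)] unfolding removable_iff[OF that(1)] by blast
  show ?thesis
    unfolding toggle_cde_def
  proof (intro exI[of _ "real n / (real n + 1)"] exI[of _ f] ballI)
    fix I assume I: "I \<in> J"
    have add: "(\<Sum>p\<in>addable P r I. f p) = (if I = P then 0 else (real (card I) + 1) / (real n + 1) - 1)"
    proof (cases "I = P")
      case True then show ?thesis by (simp add: addable_def)
    next
      case False
      then obtain p where p: "p \<in> addable P r I"
        using addable_between[OF full_ideal I] ideal_subset[OF I] by blast
      then have "addable P r I = {p}" using at_most_add[OF I] by blast
      then show ?thesis using False hadd[OF I p] by (simp add: f_def)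
    qed
    have rem: "(\<Sum>p\<in>removable P r I. f p) = (if I = {} then 0 else real (card I) / (real n + 1) - 1)"
      and crd: "card (removable P r I) = (if I = {} then 0 else 1)"
    proof -
      have "(\<Sum>p\<in>removable P r I. f p) = (if I = {} then 0 else real (card I) / (real n + 1) - 1) \<and>
        card (removable P r I) = (if I = {} then 0 else 1)"
      proof (cases "I = {}")
        case True then show ?thesis by (simp add: removable_def)
      next
        case False
        then obtain p where p: "p \<in> removable P r I"
          using removable_between[OF I empty_ideal] by blast
        then have "removable P r I = {p}" using at_most_rem[OF I] by blast
        then show ?thesis using False hrem[OF I p] by (simp add: f_def)
      qed
      then show "(\<Sum>p\<in>removable P r I. f p) = (if I = {} then 0 else real (card I) / (real n + 1) - 1)"
        "card (removable P r I) = (if I = {} then 0 else 1)" by auto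
    qed
    have "real n / (real n + 1) + 1 / (real n + 1) = 1"
      by (simp add: add_divide_distrib[symmetric])
    moreover have "card I = n" if "I = P" using that by (simp add: n_def)
    moreover have "n = 0" if "P = {}" using that by (simp add: n_def)
    ultimately show "real (card (removable P r I)) = real n / (real n + 1) +
        (\<Sum>p\<in>addable P r I. f p) - (\<Sum>p\<in>removable P r I. f p)"
      unfolding add rem crd by (cases "I = P"; cases "I = {}") (simp_all add: add_divide_distrib)
  qed
qed

section \<open>Bases of root systems\<close>

definition reflect :: "'v::euclidean_space \<Rightarrow> 'v \<Rightarrow> 'v" where
  "reflect \<gamma> v = v - (2 * (v \<bullet> \<gamma>) / (\<gamma> \<bullet> \<gamma>)) *\<^sub>R \<gamma>"

lemma linear_reflect: "linear (reflect \<gamma>)"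
  by (rule linearI) (auto simp: reflect_def algebra_simps add_divide_distrib)

lemma reflect_self: "\<gamma> \<noteq> 0 \<Longrightarrow> reflect \<gamma> \<gamma> = - \<gamma>"
  by (simp add: reflect_def scaleR_2)

lemma reflect_reflect: "\<gamma> \<noteq> 0 \<Longrightarrow> reflect \<gamma> (reflect \<gamma> v) = v"
  by (simp add: reflect_def inner_diff_left diff_divide_distrib algebra_simps scaleR_2)

lemma inner_reflect: "\<gamma> \<noteq> 0 \<Longrightarrow> reflect \<gamma> u \<bullet> reflect \<gamma> v = u \<bullet> v"
  by (simp add: reflect_def inner_diff_left inner_diff_right field_simps inner_commute)

lemma reflect_orthogonal: "v \<bullet> \<gamma> = 0 \<Longrightarrow> reflect \<gamma> v = v"
  by (simp add: reflect_def)

lemma inj_reflect: "\<gamma> \<noteq> 0 \<Longrightarrow> inj (reflect \<gamma>)"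
  by (metis injI reflect_reflect)

lemma representation_sum_scaleR:
  fixes D :: "'v::real_vector set"
  assumes "independent D" "finite D"
  shows "representation D (\<Sum>\<delta>\<in>D. f \<delta> *\<^sub>R \<delta>) = (\<lambda>\<delta>. if \<delta> \<in> D then f \<delta> else 0)"
proof (rule representation_eqI[OF assms(1)])
  show "(\<Sum>\<delta>\<in>D. f \<delta> *\<^sub>R \<delta>) \<in> span D" by (intro span_sum span_scale span_base)
  show "finite {b. (if b \<in> D then f b else 0) \<noteq> 0}"
    by (rule finite_subset[OF _ assms(2)]) (auto split: if_splits)
  show "(\<Sum>b | (if b \<in> D then f b else 0) \<noteq> 0. (if b \<in> D then f b else 0) *\<^sub>R b) = (\<Sum>\<delta>\<in>D. f \<delta> *\<^sub>R \<delta>)"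
    by (rule sum.mono_neutral_cong_left[OF assms(2)]) (auto split: if_splits)
qed (auto split: if_splits)

lemma nonneg_combinations_iff:
  assumes "independent D" "finite D"
  shows "v \<in> nonneg_combinations D \<longleftrightarrow> v \<in> span D \<and> (\<forall>\<delta>\<in>D. representation D v \<delta> \<in> \<nat>)"
proof
  assume "v \<in> nonneg_combinations D"
  then obtain c :: "_ \<Rightarrow> nat" where c: "v = (\<Sum>\<delta>\<in>D. real (c \<delta>) *\<^sub>R \<delta>)"
    by (auto simp: nonneg_combinations_def)
  show "v \<in> span D \<and> (\<forall>\<delta>\<in>D. representation D v \<delta> \<in> \<nat>)"
    unfolding c representation_sum_scaleR[OF assms]
    by (intro conjI ballI span_sum span_scale span_base) simp_all
next
  assume v: "v \<in> span D \<and> (\<forall>\<delta>\<in>D. representation D v \<delta> \<in> \<nat>)"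
  then have "\<forall>\<delta>\<in>D. \<exists>n. representation D v \<delta> = real n" by (auto simp: Nats_def)
  then obtain c where c: "\<And>\<delta>. \<delta> \<in> D \<Longrightarrow> representation D v \<delta> = real (c \<delta>)" by metis
  have "v = (\<Sum>\<delta>\<in>D. representation D v \<delta> *\<^sub>R \<delta>)"
    using sum_representation_eq[of D v D] assms v by simp
  also have "\<dots> = (\<Sum>\<delta>\<in>D. real (c \<delta>) *\<^sub>R \<delta>)" by (simp add: c)
  finally show "v \<in> nonneg_combinations D" unfolding nonneg_combinations_def by blast
qed

lemma nonneg_combinations_add:
  assumes "u \<in> nonneg_combinations D" "v \<in> nonneg_combinations D"
  shows "u + v \<in> nonneg_combinations D"
proof -
  obtain c d :: "_ \<Rightarrow> nat" where "u = (\<Sum>\<delta>\<in>D. real (c \<delta>) *\<^sub>R \<delta>)" "v = (\<Sum>\<delta>\<in>D. real (d \<delta>) *\<^sub>R \<delta>)"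
    using assms by (auto simp: nonneg_combinations_def)
  then have "u + v = (\<Sum>\<delta>\<in>D. real (c \<delta> + d \<delta>) *\<^sub>R \<delta>)"
    by (simp add: sum.distrib scaleR_add_left)
  then show ?thesis unfolding nonneg_combinations_def by (intro CollectI exI[of _ "\<lambda>\<delta>. c \<delta> + d \<delta>"])
qed

lemma nonneg_combinations_zero: "0 \<in> nonneg_combinations D"
  unfolding nonneg_combinations_def by (rule CollectI, rule exI[of _ "\<lambda>_. 0"]) simp

lemma nonneg_combinations_scale:
  assumes "v \<in> nonneg_combinations D"
  shows "real n *\<^sub>R v \<in> nonneg_combinations D"
  by (induction n)
     (simp_all add: nonneg_combinations_zero nonneg_combinations_add[OF assms] scaleR_add_left add.commute)

lemma nonneg_combinations_sum:
  assumes "\<And>x. x \<in> A \<Longrightarrow> f x \<in> nonneg_combinations D"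
  shows "sum f A \<in> nonneg_combinations D"
  using assms
  by (induction A rule: infinite_finite_induct) (auto simp: nonneg_combinations_zero nonneg_combinations_add)

section \<open>Cartan integers\<close>

locale root_system =
  fixes \<Phi> :: "'v::euclidean_space set"
  assumes crystallographic: "crystallographic_root_system \<Phi>"
begin

lemma finite_roots: "finite \<Phi>" and zero_not_root: "0 \<notin> \<Phi>"
  and root_line: "\<beta> \<in> \<Phi> \<Longrightarrow> \<Phi> \<inter> span {\<beta>} = {\<beta>, - \<beta>}"
  and reflect_root: "\<beta> \<in> \<Phi> \<Longrightarrow> \<gamma> \<in> \<Phi> \<Longrightarrow> reflect \<gamma> \<beta> \<in> \<Phi>"
  and pairing_int: "\<beta> \<in> \<Phi> \<Longrightarrow> \<gamma> \<in> \<Phi> \<Longrightarrow> 2 * (\<beta> \<bullet> \<gamma>) / (\<gamma> \<bullet> \<gamma>) \<in> \<int>"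
  using crystallographic by (simp_all add: crystallographic_root_system_def reflect_def)

lemma root_nonzero: "\<beta> \<in> \<Phi> \<Longrightarrow> \<beta> \<noteq> 0"
  using zero_not_root by auto

lemma root_norm_pos: "\<beta> \<in> \<Phi> \<Longrightarrow> \<beta> \<bullet> \<beta> > 0"
  using root_nonzero by simp

lemma root_uminus: "\<beta> \<in> \<Phi> \<Longrightarrow> - \<beta> \<in> \<Phi>"
  using root_line[of \<beta>] by blast

lemma root_scale:
  assumes "\<beta> \<in> \<Phi>" "c *\<^sub>R \<beta> \<in> \<Phi>"
  shows "c = 1 \<or> c = -1"
proof -
  have "c *\<^sub>R \<beta> \<in> span {\<beta>}" by (simp add: span_base span_scale)
  then have "c *\<^sub>R \<beta> = 1 *\<^sub>R \<beta> \<or> c *\<^sub>R \<beta> = (-1) *\<^sub>R \<beta>" using root_line[OF assms(1)] assms(2) by auto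
  then show ?thesis using root_nonzero[OF assms(1)] by (simp only: scaleR_cancel_right) simp
qed

text \<open>The component of \<beta> orthogonal to \<gamma> is nonzero, since the only roots on the
  line of \<gamma> are \<gamma> and its negative.\<close>

lemma strict_Cauchy_Schwarz:
  assumes "\<beta> \<in> \<Phi>" "\<gamma> \<in> \<Phi>" "\<beta> \<noteq> \<gamma>" "\<beta> \<noteq> - \<gamma>"
  shows "(\<beta> \<bullet> \<gamma>)\<^sup>2 < (\<beta> \<bullet> \<beta>) * (\<gamma> \<bullet> \<gamma>)"
proof -
  let ?c = "(\<beta> \<bullet> \<gamma>) / (\<gamma> \<bullet> \<gamma>)"
  let ?u = "\<beta> - ?c *\<^sub>R \<gamma>"
  have g: "\<gamma> \<bullet> \<gamma> > 0" using root_norm_pos assms by blast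
  have "?u \<noteq> 0"
  proof
    assume "?u = 0"
    then have eq: "\<beta> = ?c *\<^sub>R \<gamma>" by simp
    then have "?c = 1 \<or> ?c = -1" using root_scale[OF assms(2), of ?c] assms(1) by simp
    then show False
    proof
      assume "?c = 1" then have "\<beta> = 1 *\<^sub>R \<gamma>" using eq by metis
      then show False using assms by simp
    next
      assume "?c = -1" then have "\<beta> = (-1) *\<^sub>R \<gamma>" using eq by metis
      then show False using assms by simp
    qed
  qed
  then have "0 < ?u \<bullet> ?u" by simp
  also have "?u \<bullet> ?u = \<beta> \<bullet> \<beta> - (\<beta> \<bullet> \<gamma>)\<^sup>2 / (\<gamma> \<bullet> \<gamma>)"
    using g by (simp add: inner_diff_left inner_diff_right inner_commute power2_eq_square field_simps)
  finally show ?thesis using g by (simp add: field_simps)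
qed

text \<open>\<open>k\<close> and \<open>l\<close> are the two Cartan integers. Their product is four
  times the squared cosine of the angle, hence less than 4 by
  \<open>strict_Cauchy_Schwarz\<close>.\<close>

lemma pairing_positive:
  assumes "\<beta> \<in> \<Phi>" "\<gamma> \<in> \<Phi>" "\<beta> \<noteq> \<gamma>" "\<beta> \<bullet> \<gamma> > 0"
  obtains k l :: int where "2 * (\<beta> \<bullet> \<gamma>) = k * (\<gamma> \<bullet> \<gamma>)" "2 * (\<beta> \<bullet> \<gamma>) = l * (\<beta> \<bullet> \<beta>)"
    "k \<ge> 1" "l \<ge> 1" "k * l \<le> 3"
proof -
  have pos: "\<beta> \<bullet> \<beta> > 0" "\<gamma> \<bullet> \<gamma> > 0" using root_norm_pos assms by blast+
  obtain k :: int where "2 * (\<beta> \<bullet> \<gamma>) / (\<gamma> \<bullet> \<gamma>) = k" using pairing_int[OF assms(1,2)] by (auto elim: Ints_cases)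
  then have k: "2 * (\<beta> \<bullet> \<gamma>) = k * (\<gamma> \<bullet> \<gamma>)" using pos by (simp add: field_simps)
  obtain l :: int where "2 * (\<gamma> \<bullet> \<beta>) / (\<beta> \<bullet> \<beta>) = l" using pairing_int[OF assms(2,1)] by (auto elim: Ints_cases)
  then have l: "2 * (\<beta> \<bullet> \<gamma>) = l * (\<beta> \<bullet> \<beta>)" using pos by (simp add: field_simps inner_commute)
  have "0 < real_of_int k * (\<gamma> \<bullet> \<gamma>)" "0 < real_of_int l * (\<beta> \<bullet> \<beta>)" using k l assms(4) by simp_all
  then have kl1: "k \<ge> 1" "l \<ge> 1" using pos by (simp_all add: zero_less_mult_iff)
  have "\<beta> \<noteq> - \<gamma>" using assms(4) pos(2) by (metis inner_minus_left neg_0_less_iff_less not_less_iff_gr_or_eq)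
  then have cs: "(\<beta> \<bullet> \<gamma>)\<^sup>2 < (\<beta> \<bullet> \<beta>) * (\<gamma> \<bullet> \<gamma>)" using strict_Cauchy_Schwarz assms by blast
  have "real_of_int (k * l) * ((\<beta> \<bullet> \<beta>) * (\<gamma> \<bullet> \<gamma>)) = (2 * (\<beta> \<bullet> \<gamma>)) * (2 * (\<beta> \<bullet> \<gamma>))"
    by (subst k, subst l) simp
  also have "\<dots> < 4 * ((\<beta> \<bullet> \<beta>) * (\<gamma> \<bullet> \<gamma>))" using cs by (simp add: power2_eq_square)
  finally have "real_of_int (k * l) < 4" using pos by simp
  then have "k * l \<le> 3" by linarith
  then show ?thesis using that k l kl1 by blast
qed

text \<open>Positive Cartan integers with product at most 3 cannot both exceed 1, and reflecting in
  the root whose Cartan integer is 1 subtracts that root exactly once.\<close>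

lemma root_diff:
  assumes "\<beta> \<in> \<Phi>" "\<gamma> \<in> \<Phi>" "\<beta> \<noteq> \<gamma>" "\<beta> \<bullet> \<gamma> > 0"
  shows "\<beta> - \<gamma> \<in> \<Phi>"
proof -
  have pos: "\<beta> \<bullet> \<beta> > 0" "\<gamma> \<bullet> \<gamma> > 0" using root_norm_pos assms by blast+
  obtain k l :: int where kl: "2 * (\<beta> \<bullet> \<gamma>) = k * (\<gamma> \<bullet> \<gamma>)" "2 * (\<beta> \<bullet> \<gamma>) = l * (\<beta> \<bullet> \<beta>)"
    "k \<ge> 1" "l \<ge> 1" "k * l \<le> 3" using pairing_positive[OF assms] .
  have "k = 1 \<or> l = 1"
  proof (rule ccontr)
    assume "\<not> (k = 1 \<or> l = 1)"
    then have "2 * 2 \<le> k * l" using kl by (intro mult_mono) auto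
    then show False using kl(5) by simp
  qed
  then show ?thesis
  proof
    assume "k = 1"
    then have eq: "2 * (\<beta> \<bullet> \<gamma>) = \<gamma> \<bullet> \<gamma>" using kl(1) by simp
    have "reflect \<gamma> \<beta> = \<beta> - \<gamma>" unfolding reflect_def eq using pos by simp
    then show ?thesis using reflect_root[OF assms(1,2)] by simp
  next
    assume "l = 1"
    then have eq: "2 * (\<gamma> \<bullet> \<beta>) = \<beta> \<bullet> \<beta>" using kl(2) by (simp add: inner_commute)
    have "reflect \<beta> \<gamma> = \<gamma> - \<beta>" unfolding reflect_def eq using pos by simp
    then show ?thesis using root_uminus[OF reflect_root[OF assms(2,1)]] by simp
  qed
qed

lemma root_add:
  assumes "\<beta> \<in> \<Phi>" "\<gamma> \<in> \<Phi>" "\<beta> \<noteq> - \<gamma>" "\<beta> \<bullet> \<gamma> < 0"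
  shows "\<beta> + \<gamma> \<in> \<Phi>"
  using root_diff[of \<beta> "- \<gamma>"] assms root_uminus by simp

text \<open>Equal lengths force \<open>k = l\<close>, and then the bound on the product leaves only
  1.\<close>

lemma equal_norm_inner:
  assumes "\<beta> \<in> \<Phi>" "\<gamma> \<in> \<Phi>" "\<beta> \<noteq> \<gamma>" "\<beta> \<bullet> \<gamma> > 0" "\<beta> \<bullet> \<beta> = \<gamma> \<bullet> \<gamma>"
  shows "2 * (\<beta> \<bullet> \<gamma>) = \<gamma> \<bullet> \<gamma>"
proof -
  obtain k l :: int where kl: "2 * (\<beta> \<bullet> \<gamma>) = k * (\<gamma> \<bullet> \<gamma>)" "2 * (\<beta> \<bullet> \<gamma>) = l * (\<beta> \<bullet> \<beta>)"
    "k \<ge> 1" "l \<ge> 1" "k * l \<le> 3" using pairing_positive[OF assms(1-4)] .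
  have "real_of_int k = real_of_int l" using kl(1,2) assms(5) root_norm_pos[OF assms(2)] by simp
  then have "k * k \<le> 3" using kl by simp
  then have "\<not> k \<ge> 2" using mult_mono[of 2 k 2 k] by auto
  then have "k = 1" using kl by simp
  then show ?thesis using kl by simp
qed

section \<open>Bases and positive roots\<close>

lemma base_subset: "simple_roots \<Phi> D \<Longrightarrow> \<delta> \<in> D \<Longrightarrow> \<delta> \<in> \<Phi>"
  and base_independent: "simple_roots \<Phi> D \<Longrightarrow> independent D"
  and base_cases: "simple_roots \<Phi> D \<Longrightarrow> \<beta> \<in> \<Phi> \<Longrightarrow> \<beta> \<in> nonneg_combinations D \<or> - \<beta> \<in> nonneg_combinations D"
  by (auto simp: simple_roots_def)

lemma base_finite: "simple_roots \<Phi> D \<Longrightarrow> finite D"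
  using base_subset finite_roots by (meson finite_subset subsetI)

lemma base_nonneg_iff:
  assumes "simple_roots \<Phi> D"
  shows "v \<in> nonneg_combinations D \<longleftrightarrow> v \<in> span D \<and> (\<forall>\<delta>\<in>D. representation D v \<delta> \<in> \<nat>)"
  by (rule nonneg_combinations_iff[OF base_independent[OF assms] base_finite[OF assms]])

lemma root_in_span:
  assumes "simple_roots \<Phi> D" "\<beta> \<in> \<Phi>"
  shows "\<beta> \<in> span D"
  using base_cases[OF assms] base_nonneg_iff[OF assms(1)] span_neg[of "- \<beta>" D] by auto

lemma span_base_eq:
  assumes "simple_roots \<Phi> D"
  shows "span D = span \<Phi>"
proof
  show "span D \<subseteq> span \<Phi>" by (rule span_mono) (use base_subset[OF assms] in blast)
  show "span \<Phi> \<subseteq> span D" by (rule span_minimal) (auto simp: root_in_span[OF assms] subspace_span)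
qed

lemma base_sum:
  assumes "simple_roots \<Phi> D" "v \<in> span D"
  shows "(\<Sum>\<delta>\<in>D. representation D v \<delta> *\<^sub>R \<delta>) = v"
  by (rule sum_representation_eq) (use base_independent base_finite assms in auto)

lemma positiveD:
  assumes "simple_roots \<Phi> D" "\<beta> \<in> positive_roots \<Phi> D" "\<delta> \<in> D"
  shows "representation D \<beta> \<delta> \<ge> 0"
  using assms base_nonneg_iff[OF assms(1)] by (auto simp: positive_roots_def Nats_def)

text \<open>All coefficients of a root have the same sign, so one positive coefficient decides
  it.\<close>

lemma positiveI:
  assumes D: "simple_roots \<Phi> D" and b: "\<beta> \<in> \<Phi>" and d: "\<delta> \<in> D" and pos: "representation D \<beta> \<delta> > 0"
  shows "\<beta> \<in> positive_roots \<Phi> D"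
proof -
  have "- \<beta> \<notin> nonneg_combinations D"
  proof
    assume "- \<beta> \<in> nonneg_combinations D"
    then have "representation D (- \<beta>) \<delta> \<in> \<nat>" using base_nonneg_iff[OF D] d by blast
    moreover have "representation D (- \<beta>) \<delta> = - representation D \<beta> \<delta>"
      using representation_neg[OF base_independent[OF D] root_in_span[OF D b]] by simp
    ultimately show False using pos by (auto elim!: Nats_cases)
  qed
  then show ?thesis using base_cases[OF D b] b by (auto simp: positive_roots_def)
qed

lemma not_both_positive:
  assumes D: "simple_roots \<Phi> D" and b: "\<beta> \<in> positive_roots \<Phi> D"
  shows "- \<beta> \<notin> positive_roots \<Phi> D"
proof
  assume nb: "- \<beta> \<in> positive_roots \<Phi> D"
  have bR: "\<beta> \<in> \<Phi>" using b by (simp add: positive_roots_def)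
  have "representation D \<beta> \<delta> = 0" if "\<delta> \<in> D" for \<delta>
    using positiveD[OF D b that] positiveD[OF D nb that]
      representation_neg[OF base_independent[OF D] root_in_span[OF D bR]] by simp
  then have "(\<Sum>\<delta>\<in>D. representation D \<beta> \<delta> *\<^sub>R \<delta>) = 0" by simp
  then show False using base_sum[OF D root_in_span[OF D bR]] root_nonzero[OF bR] by simp
qed

lemma base_positive: "simple_roots \<Phi> D \<Longrightarrow> \<delta> \<in> D \<Longrightarrow> \<delta> \<in> positive_roots \<Phi> D"
  by (rule positiveI[of D \<delta> \<delta>]) (auto simp: base_subset base_independent representation_basis)

text \<open>Otherwise \<beta> would be a multiple of \<delta>, and the only positive root of that
  kind is \<delta> itself.\<close>

lemma other_coefficient:
  assumes D: "simple_roots \<Phi> D" and b: "\<beta> \<in> positive_roots \<Phi> D" "\<beta> \<noteq> \<delta>" and d: "\<delta> \<in> D"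
  shows "\<exists>\<delta>'\<in>D. \<delta>' \<noteq> \<delta> \<and> representation D \<beta> \<delta>' > 0"
proof (rule ccontr)
  assume no: "\<not> ?thesis"
  have bR: "\<beta> \<in> \<Phi>" using b by (simp add: positive_roots_def)
  have zero: "representation D \<beta> x = 0" if "x \<in> D" "x \<noteq> \<delta>" for x
    using positiveD[OF D b(1) that(1)] no that by force
  have "\<beta> = (\<Sum>x\<in>D. representation D \<beta> x *\<^sub>R x)" using base_sum[OF D root_in_span[OF D bR]] by simp
  also have "\<dots> = representation D \<beta> \<delta> *\<^sub>R \<delta> + (\<Sum>x\<in>D - {\<delta>}. representation D \<beta> x *\<^sub>R x)"
    by (rule sum.remove[OF base_finite[OF D] d])
  also have "(\<Sum>x\<in>D - {\<delta>}. representation D \<beta> x *\<^sub>R x) = 0" using zero by (intro sum.neutral) simp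
  finally have eq: "\<beta> = representation D \<beta> \<delta> *\<^sub>R \<delta>" by simp
  then have "representation D \<beta> \<delta> *\<^sub>R \<delta> \<in> \<Phi>" using bR by simp
  then have "representation D \<beta> \<delta> = 1" using root_scale[OF base_subset[OF D d]] positiveD[OF D b(1) d] by fastforce
  then have "\<beta> = 1 *\<^sub>R \<delta>" using eq by metis
  then show False using b(2) by simp
qed

text \<open>The reflection changes only the coefficient at \<delta>, so a positive coefficient at
  another simple root survives.\<close>

lemma reflect_positive:
  assumes D: "simple_roots \<Phi> D" and d: "\<delta> \<in> D" and b: "\<beta> \<in> positive_roots \<Phi> D" "\<beta> \<noteq> \<delta>"
  shows "reflect \<delta> \<beta> \<in> positive_roots \<Phi> D"
proof -
  have R: "\<beta> \<in> \<Phi>" "\<delta> \<in> \<Phi>" using b base_subset[OF D d] by (auto simp: positive_roots_def)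
  obtain x where x: "x \<in> D" "x \<noteq> \<delta>" "representation D \<beta> x > 0" using other_coefficient[OF D b d] by blast
  note ind = base_independent[OF D]
  have "representation D (reflect \<delta> \<beta>) x = representation D \<beta> x"
    unfolding reflect_def using root_in_span[OF D R(1)] root_in_span[OF D R(2)] x(2)
    by (simp add: representation_diff[OF ind] representation_scale[OF ind] representation_basis[OF ind d] span_scale)
  then show ?thesis using positiveI[OF D reflect_root[OF R] x(1)] x(3) by simp
qed

text \<open>Expanding one factor of \<open>\<beta> \<bullet> \<beta> > 0\<close> in \<open>D\<close>
  gives a simple \<delta> with \<open>\<delta> \<bullet> \<beta> > 0\<close>. Then
  \<open>\<beta> - \<delta>\<close> is a root, positive because it keeps a positive coefficient
  elsewhere.\<close>

lemma positive_decomposition: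
  assumes D: "simple_roots \<Phi> D" and b: "\<beta> \<in> positive_roots \<Phi> D" "\<beta> \<notin> D"
  shows "\<exists>\<beta>1\<in>positive_roots \<Phi> D. \<exists>\<beta>2\<in>positive_roots \<Phi> D. \<beta> = \<beta>1 + \<beta>2"
proof -
  have bR: "\<beta> \<in> \<Phi>" using b by (simp add: positive_roots_def)
  have "\<beta> \<bullet> \<beta> = (\<Sum>\<delta>\<in>D. representation D \<beta> \<delta> *\<^sub>R \<delta>) \<bullet> \<beta>"
    using base_sum[OF D root_in_span[OF D bR]] by simp
  also have "\<dots> = (\<Sum>\<delta>\<in>D. representation D \<beta> \<delta> * (\<delta> \<bullet> \<beta>))" by (simp add: inner_sum_left)
  finally have "0 < (\<Sum>\<delta>\<in>D. representation D \<beta> \<delta> * (\<delta> \<bullet> \<beta>))" using root_norm_pos[OF bR] by simp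
  then obtain \<delta> where d: "\<delta> \<in> D" "representation D \<beta> \<delta> * (\<delta> \<bullet> \<beta>) > 0"
    by (meson not_le sum_nonpos)
  then have ip: "\<delta> \<bullet> \<beta> > 0" using positiveD[OF D b(1) d(1)] by (simp add: zero_less_mult_iff)
  have ne: "\<beta> \<noteq> \<delta>" using b(2) d(1) by blast
  have dR: "\<delta> \<in> \<Phi>" using base_subset[OF D d(1)] .
  have R: "\<beta> - \<delta> \<in> \<Phi>" using root_diff[OF bR dR ne] ip by (simp add: inner_commute)
  obtain x where x: "x \<in> D" "x \<noteq> \<delta>" "representation D \<beta> x > 0" using other_coefficient[OF D b(1) ne d(1)] by blast
  note ind = base_independent[OF D]
  have "representation D (\<beta> - \<delta>) x = representation D \<beta> x"
    using root_in_span[OF D bR] root_in_span[OF D dR] x(2)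
    by (simp add: representation_diff[OF ind] representation_basis[OF ind d(1)])
  then have "\<beta> - \<delta> \<in> positive_roots \<Phi> D" using positiveI[OF D R x(1)] x(3) by simp
  then show ?thesis using base_positive[OF D d(1)] by (intro bexI[of _ "\<beta> - \<delta>"] bexI[of _ \<delta>]) simp_all
qed

text \<open>The coefficients of \<open>u\<close> and \<open>v\<close> are natural numbers that add
  up to 1 at \<delta> and to 0 elsewhere, so one of the two vectors has no nonzero
  coefficient.\<close>

lemma base_indecomposable:
  assumes D: "simple_roots \<Phi> D" and d: "\<delta> \<in> D"
    and uv: "u \<in> nonneg_combinations D" "v \<in> nonneg_combinations D" "\<delta> = u + v"
  shows "u = 0 \<or> v = 0"
proof -
  note ind = base_independent[OF D]
  have sp: "u \<in> span D" "v \<in> span D" using uv base_nonneg_iff[OF D] by auto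
  have nat: "representation D u x \<in> \<nat>" "representation D v x \<in> \<nat>" if "x \<in> D" for x
    using uv base_nonneg_iff[OF D] that by auto
  have eq: "representation D u x + representation D v x = (if x = \<delta> then 1 else 0)" for x
    using fun_cong[OF representation_add[OF ind sp(2,1)], of x] fun_cong[OF representation_basis[OF ind d], of x]
    unfolding uv(3)[symmetric] by argo
  have zero: "representation D u x = 0 \<and> representation D v x = 0" if "x \<in> D" "x \<noteq> \<delta>" for x
    using eq[of x] nat[OF that(1)] that by (auto elim!: Nats_cases)
  have "representation D u \<delta> = 0 \<or> representation D v \<delta> = 0"
  proof -
    obtain m n where "representation D u \<delta> = real m" "representation D v \<delta> = real n"
      using nat[OF d] by (auto elim!: Nats_cases)
    then have "m + n = 1" using eq[of \<delta>] by (simp flip: of_nat_add)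
    then have "m = 0 \<or> n = 0" by auto
    then show ?thesis using \<open>representation D u \<delta> = real m\<close> \<open>representation D v \<delta> = real n\<close> by auto
  qed
  then show ?thesis
  proof
    assume "representation D u \<delta> = 0"
    then have "(\<Sum>x\<in>D. representation D u x *\<^sub>R x) = 0" using zero by (intro sum.neutral) auto
    then show ?thesis using base_sum[OF D sp(1)] by simp
  next
    assume "representation D v \<delta> = 0"
    then have "(\<Sum>x\<in>D. representation D v x *\<^sub>R x) = 0" using zero by (intro sum.neutral) auto
    then show ?thesis using base_sum[OF D sp(2)] by simp
  qed
qed

lemma positive_nonneg: "\<beta> \<in> positive_roots \<Phi> D \<Longrightarrow> \<beta> \<in> nonneg_combinations D \<and> \<beta> \<in> \<Phi>"
  by (simp add: positive_roots_def)

text \<open>A base consists of the indecomposable positive roots, so the positive roots determine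
  it.\<close>

lemma base_unique_subset:
  assumes D: "simple_roots \<Phi> D" and D': "simple_roots \<Phi> D'" and eq: "positive_roots \<Phi> D = positive_roots \<Phi> D'"
  shows "D \<subseteq> D'"
proof
  fix \<delta> assume d: "\<delta> \<in> D"
  show "\<delta> \<in> D'"
  proof (rule ccontr)
    assume "\<delta> \<notin> D'"
    then obtain \<beta>1 \<beta>2 where b: "\<beta>1 \<in> positive_roots \<Phi> D" "\<beta>2 \<in> positive_roots \<Phi> D" "\<delta> = \<beta>1 + \<beta>2"
      using positive_decomposition[OF D', of \<delta>] base_positive[OF D d] eq by blast
    then have "\<beta>1 = 0 \<or> \<beta>2 = 0" using base_indecomposable[OF D d] positive_nonneg by blast
    then show False using b positive_nonneg root_nonzero by blast
  qed
qed

lemma base_unique: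
  assumes "simple_roots \<Phi> D" "simple_roots \<Phi> D'" "positive_roots \<Phi> D = positive_roots \<Phi> D'"
  shows "D = D'"
  using base_unique_subset assms by (metis subset_antisym)

text \<open>Otherwise \<open>\<delta> - \<delta>'\<close> would be a root with coefficients of both
  signs.\<close>

lemma base_obtuse:
  assumes D: "simple_roots \<Phi> D" and d: "\<delta> \<in> D" "\<delta>' \<in> D" "\<delta> \<noteq> \<delta>'"
  shows "\<delta> \<bullet> \<delta>' \<le> 0"
proof (rule ccontr)
  assume "\<not> ?thesis"
  then have R: "\<delta> - \<delta>' \<in> \<Phi>" using root_diff base_subset[OF D] d by auto
  note ind = base_independent[OF D]
  have rep: "representation D (\<delta> - \<delta>') x = (if x = \<delta> then 1 else 0) - (if x = \<delta>' then 1 else 0)" for x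
    using d by (simp add: representation_diff[OF ind] representation_basis[OF ind] span_base)
  have "\<delta> - \<delta>' \<in> positive_roots \<Phi> D" using positiveI[OF D R d(1)] rep[of \<delta>] d(3) by simp
  then show False using positiveD[OF D _ d(2)] rep[of \<delta>'] d(3) by fastforce
qed

section \<open>Reflecting a base\<close>

lemma nonneg_reflect:
  assumes "\<gamma> \<noteq> 0" "v \<in> nonneg_combinations D"
  shows "reflect \<gamma> v \<in> nonneg_combinations (reflect \<gamma> ` D)"
proof -
  obtain c :: "_ \<Rightarrow> nat" where c: "v = (\<Sum>\<delta>\<in>D. real (c \<delta>) *\<^sub>R \<delta>)"
    using assms(2) by (auto simp: nonneg_combinations_def)
  have "reflect \<gamma> v = (\<Sum>\<delta>\<in>D. real (c \<delta>) *\<^sub>R reflect \<gamma> \<delta>)"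
    unfolding c by (simp add: linear_sum[OF linear_reflect] linear_scale[OF linear_reflect])
  also have "\<dots> = (\<Sum>x\<in>reflect \<gamma> ` D. real (c (reflect \<gamma> x)) *\<^sub>R x)"
    using inj_reflect[OF assms(1)]
    by (subst sum.reindex) (auto simp: reflect_reflect[OF assms(1)] intro: inj_on_subset)
  finally show ?thesis unfolding nonneg_combinations_def by (intro CollectI exI[of _ "\<lambda>x. c (reflect \<gamma> x)"])
qed

lemma image_reflect_reflect: "\<gamma> \<noteq> 0 \<Longrightarrow> reflect \<gamma> ` reflect \<gamma> ` D = D"
  by (simp add: image_image reflect_reflect)

lemma reflect_base:
  assumes D: "simple_roots \<Phi> D" and g: "\<gamma> \<in> \<Phi>"
  shows "simple_roots \<Phi> (reflect \<gamma> ` D)"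
proof -
  have g0: "\<gamma> \<noteq> 0" using root_nonzero[OF g] .
  have "reflect \<gamma> ` D \<subseteq> \<Phi>" using reflect_root[OF base_subset[OF D] g] by blast
  moreover have "independent (reflect \<gamma> ` D)"
    by (rule linear_independent_injective_image[OF linear_reflect base_independent[OF D]])
       (rule inj_on_subset[OF inj_reflect[OF g0]], simp)
  moreover have "\<beta> \<in> nonneg_combinations (reflect \<gamma> ` D) \<or> - \<beta> \<in> nonneg_combinations (reflect \<gamma> ` D)"
    if b: "\<beta> \<in> \<Phi>" for \<beta>
    using base_cases[OF D reflect_root[OF b g]]
  proof
    assume "reflect \<gamma> \<beta> \<in> nonneg_combinations D"
    then show ?thesis using nonneg_reflect[OF g0] reflect_reflect[OF g0] by metis
  next
    assume "- reflect \<gamma> \<beta> \<in> nonneg_combinations D"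
    then have "reflect \<gamma> (- reflect \<gamma> \<beta>) \<in> nonneg_combinations (reflect \<gamma> ` D)"
      by (rule nonneg_reflect[OF g0])
    then show ?thesis by (simp add: linear_neg[OF linear_reflect] reflect_reflect[OF g0])
  qed
  ultimately show ?thesis by (simp add: simple_roots_def)
qed

lemma positive_reflect_base:
  assumes D: "simple_roots \<Phi> D" and g: "\<gamma> \<in> \<Phi>"
  shows "positive_roots \<Phi> (reflect \<gamma> ` D) = reflect \<gamma> ` positive_roots \<Phi> D"
proof -
  have g0: "\<gamma> \<noteq> 0" using root_nonzero[OF g] .
  have sub: "reflect \<gamma> ` positive_roots \<Phi> E \<subseteq> positive_roots \<Phi> (reflect \<gamma> ` E)" for E
    using nonneg_reflect[OF g0] reflect_root[OF _ g] by (auto simp: positive_roots_def)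
  have "reflect \<gamma> ` positive_roots \<Phi> (reflect \<gamma> ` D) \<subseteq> positive_roots \<Phi> D"
    using sub[of "reflect \<gamma> ` D"] by (simp only: image_reflect_reflect[OF g0])
  then have "reflect \<gamma> ` reflect \<gamma> ` positive_roots \<Phi> (reflect \<gamma> ` D) \<subseteq> reflect \<gamma> ` positive_roots \<Phi> D"
    by (rule image_mono)
  then have "positive_roots \<Phi> (reflect \<gamma> ` D) \<subseteq> reflect \<gamma> ` positive_roots \<Phi> D"
    by (simp only: image_reflect_reflect[OF g0])
  then show ?thesis using sub[of D] by (rule subset_antisym)
qed

lemma representation_reflect:
  assumes D: "simple_roots \<Phi> D" and g: "\<gamma> \<in> \<Phi>" and v: "v \<in> span D" and d: "\<delta> \<in> D"
  shows "representation (reflect \<gamma> ` D) (reflect \<gamma> v) (reflect \<gamma> \<delta>) = representation D v \<delta>"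
proof -
  have g0: "\<gamma> \<noteq> 0" using root_nonzero[OF g] .
  have "reflect \<gamma> v = reflect \<gamma> (\<Sum>\<delta>\<in>D. representation D v \<delta> *\<^sub>R \<delta>)" using base_sum[OF D v] by simp
  also have "\<dots> = (\<Sum>\<delta>\<in>D. representation D v \<delta> *\<^sub>R reflect \<gamma> \<delta>)"
    by (simp add: linear_sum[OF linear_reflect] linear_scale[OF linear_reflect])
  also have "\<dots> = (\<Sum>x\<in>reflect \<gamma> ` D. representation D v (reflect \<gamma> x) *\<^sub>R x)"
    using inj_reflect[OF g0]
    by (subst sum.reindex) (auto simp: reflect_reflect[OF g0] intro: inj_on_subset)
  finally have "representation (reflect \<gamma> ` D) (reflect \<gamma> v) =
      (\<lambda>x. if x \<in> reflect \<gamma> ` D then representation D v (reflect \<gamma> x) else 0)"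
    using representation_sum_scaleR[OF base_independent base_finite, OF reflect_base reflect_base, OF D g D g]
    by simp
  then show ?thesis using d by (simp add: reflect_reflect[OF g0])
qed

text \<open>By \<open>reflect_positive\<close>, the reflection in \<delta> permutes the positive
  roots other than \<delta>, while \<delta> goes to its negative.\<close>

lemma image_reflect_positive:
  assumes D: "simple_roots \<Phi> D" and d: "\<delta> \<in> D"
  shows "reflect \<delta> ` positive_roots \<Phi> D = insert (- \<delta>) (positive_roots \<Phi> D - {\<delta>})"
proof
  have d0: "\<delta> \<noteq> 0" using root_nonzero[OF base_subset[OF D d]] .
  have self: "reflect \<delta> \<beta> = \<delta> \<longleftrightarrow> \<beta> = - \<delta>" for \<beta>
    using reflect_self[OF d0] reflect_reflect[OF d0] linear_neg[OF linear_reflect] by (metis minus_minus)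
  show "reflect \<delta> ` positive_roots \<Phi> D \<subseteq> insert (- \<delta>) (positive_roots \<Phi> D - {\<delta>})"
  proof
    fix x assume "x \<in> reflect \<delta> ` positive_roots \<Phi> D"
    then obtain \<beta> where b: "\<beta> \<in> positive_roots \<Phi> D" "x = reflect \<delta> \<beta>" by blast
    show "x \<in> insert (- \<delta>) (positive_roots \<Phi> D - {\<delta>})"
    proof (cases "\<beta> = \<delta>")
      case True then show ?thesis using b reflect_self[OF d0] by simp
    next
      case False
      then have "x \<in> positive_roots \<Phi> D" using reflect_positive[OF D d b(1)] b by simp
      moreover have "x \<noteq> \<delta>" using self b not_both_positive[OF D base_positive[OF D d]] by auto
      ultimately show ?thesis by simp
    qed
  qed
  show "insert (- \<delta>) (positive_roots \<Phi> D - {\<delta>}) \<subseteq> reflect \<delta> ` positive_roots \<Phi> D"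
  proof
    fix x assume "x \<in> insert (- \<delta>) (positive_roots \<Phi> D - {\<delta>})"
    then consider "x = - \<delta>" | "x \<in> positive_roots \<Phi> D" "x \<noteq> \<delta>" by blast
    then show "x \<in> reflect \<delta> ` positive_roots \<Phi> D"
    proof cases
      case 1 then show ?thesis using base_positive[OF D d] reflect_self[OF d0] by force
    next
      case 2 then show ?thesis
        using reflect_positive[OF D d 2] reflect_reflect[OF d0, of x] by (metis image_eqI)
    qed
  qed
qed

end

section \<open>Bases attached to order ideals\<close>

text \<open>\<open>coefficient_le\<close> is what a minuscule \<alpha> contributes: the highest root
  dominates all positive roots and has coefficient 1 at \<alpha>.\<close>

locale minuscule_setup = root_system \<Phi> for \<Phi> :: "'v::euclidean_space set" +
  fixes \<Delta> :: "'v set" and \<alpha> :: 'v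
  assumes base: "simple_roots \<Phi> \<Delta>" and alpha: "\<alpha> \<in> \<Delta>"
    and coefficient_le: "\<And>\<beta>. \<beta> \<in> positive_roots \<Phi> \<Delta> \<Longrightarrow> representation \<Delta> \<beta> \<alpha> \<le> 1"
begin

section \<open>The fundamental coweight and its grading\<close>

text \<open>The component \<open>z\<close> of \<alpha> orthogonal to the other simple roots is
  nonzero by independence. Divided by \<open>z \<bullet> z\<close>, it takes the value 1 at \<alpha>
  and 0 at the other simple roots.\<close>

lemma coweight_exists: "\<exists>l\<in>span \<Delta>. \<forall>v\<in>span \<Delta>. l \<bullet> v = representation \<Delta> v \<alpha>"
proof -
  note ind = base_independent[OF base]
  obtain y z where yz: "y \<in> span (\<Delta> - {\<alpha>})" "\<And>w. w \<in> span (\<Delta> - {\<alpha>}) \<Longrightarrow> orthogonal z w" "\<alpha> = y + z"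
    using orthogonal_subspace_decomp_exists[of "\<Delta> - {\<alpha>}" \<alpha>] by blast
  have "\<alpha> \<notin> span (\<Delta> - {\<alpha>})" using ind alpha unfolding dependent_def by blast
  then have z0: "z \<noteq> 0" using yz by auto
  have "y \<in> span \<Delta>" using yz(1) span_mono[of "\<Delta> - {\<alpha>}" \<Delta>] by blast
  moreover have "z = \<alpha> - y" using yz(3) by simp
  ultimately have zs: "z \<in> span \<Delta>" using span_base[OF alpha] span_diff by metis
  have za: "z \<bullet> \<alpha> = z \<bullet> z" using yz(2)[OF yz(1)] by (simp add: yz(3) inner_add_right orthogonal_def)
  define l where "l = (1 / (z \<bullet> z)) *\<^sub>R z"
  have l: "l \<bullet> \<delta> = (if \<delta> = \<alpha> then 1 else 0)" if "\<delta> \<in> \<Delta>" for \<delta>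
    using za z0 yz(2)[of \<delta>] that by (auto simp: l_def orthogonal_def span_base)
  have "l \<bullet> v = representation \<Delta> v \<alpha>" if v: "v \<in> span \<Delta>" for v
  proof -
    have "l \<bullet> v = l \<bullet> (\<Sum>\<delta>\<in>\<Delta>. representation \<Delta> v \<delta> *\<^sub>R \<delta>)" using base_sum[OF base v] by simp
    also have "\<dots> = (\<Sum>\<delta>\<in>\<Delta>. if \<delta> = \<alpha> then representation \<Delta> v \<alpha> else 0)"
      unfolding inner_sum_right by (intro sum.cong refl) (auto simp: l)
    finally show ?thesis using alpha base_finite[OF base] by simp
  qed
  moreover have "l \<in> span \<Delta>" unfolding l_def using zs by (rule span_scale)
  ultimately show ?thesis by blast
qed

text \<open>The fundamental coweight of \<alpha>. Lying in the span of the roots makes it unique and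
  lets it be expanded in every base.\<close>

definition coweight :: 'v where
  "coweight = (SOME l. l \<in> span \<Delta> \<and> (\<forall>v\<in>span \<Delta>. l \<bullet> v = representation \<Delta> v \<alpha>))"

abbreviation grade :: "'v \<Rightarrow> real" where "grade v \<equiv> coweight \<bullet> v"

lemma coweight_in_span: "coweight \<in> span \<Delta>"
  and grade_eq: "v \<in> span \<Delta> \<Longrightarrow> grade v = representation \<Delta> v \<alpha>"
proof -
  have "coweight \<in> span \<Delta> \<and> (\<forall>v\<in>span \<Delta>. coweight \<bullet> v = representation \<Delta> v \<alpha>)"
    unfolding coweight_def by (rule someI_ex) (use coweight_exists in blast)
  then show "coweight \<in> span \<Delta>" "v \<in> span \<Delta> \<Longrightarrow> grade v = representation \<Delta> v \<alpha>" by auto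
qed

lemma grade_root: "\<beta> \<in> \<Phi> \<Longrightarrow> grade \<beta> = representation \<Delta> \<beta> \<alpha>"
  by (rule grade_eq[OF root_in_span[OF base]])

lemma grade_simple: "\<delta> \<in> \<Delta> \<Longrightarrow> grade \<delta> = (if \<delta> = \<alpha> then 1 else 0)"
  using grade_eq[OF span_base] representation_basis[OF base_independent[OF base], of \<delta>] by auto

lemma nonneg_nat:
  assumes "v \<in> nonneg_combinations \<Delta>" "\<delta> \<in> \<Delta>"
  shows "\<exists>n. representation \<Delta> v \<delta> = real n"
  using assms base_nonneg_iff[OF base] by (auto simp: Nats_def)

lemma grade_positive:
  assumes "\<beta> \<in> positive_roots \<Phi> \<Delta>"
  shows "grade \<beta> = 0 \<or> grade \<beta> = 1"
proof -
  have b: "\<beta> \<in> nonneg_combinations \<Delta>" "\<beta> \<in> \<Phi>" using assms by (simp_all add: positive_nonneg)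
  obtain n where n: "grade \<beta> = real n" using nonneg_nat[OF b(1) alpha] grade_root[OF b(2)] by auto
  then have "real n \<le> 1" using coefficient_le[OF assms] grade_root[OF b(2)] by simp
  then have "n = 0 \<or> n = 1" by auto
  then show ?thesis using n by auto
qed

lemma positive_cases:
  assumes "\<beta> \<in> \<Phi>"
  shows "\<beta> \<in> positive_roots \<Phi> \<Delta> \<or> - \<beta> \<in> positive_roots \<Phi> \<Delta>"
  using base_cases[OF base assms] assms root_uminus by (auto simp: positive_roots_def)

lemma grade_cases: "\<beta> \<in> \<Phi> \<Longrightarrow> grade \<beta> = 0 \<or> grade \<beta> = 1 \<or> grade \<beta> = -1"
  using positive_cases[of \<beta>] grade_positive[of \<beta>] grade_positive[of "- \<beta>"] by auto

lemma grade_one_positive: "\<beta> \<in> \<Phi> \<Longrightarrow> grade \<beta> = 1 \<Longrightarrow> \<beta> \<in> positive_roots \<Phi> \<Delta>"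
  using positiveI[OF base _ alpha] grade_root by simp

section \<open>The poset as the set of roots of grade one\<close>

abbreviation "P \<equiv> roots_above \<Phi> \<Delta> \<alpha>"

lemma nonneg_grade: "v \<in> nonneg_combinations \<Delta> \<Longrightarrow> grade v \<ge> 0"
  using nonneg_nat[OF _ alpha, of v] base_nonneg_iff[OF base, of v] grade_eq[of v] by auto

text \<open>The grade is the coefficient at \<alpha>, at most 1 on positive roots. Being above
  \<alpha> makes it at least 1, and conversely a coefficient 1 leaves room for subtracting
  \<alpha>.\<close>

lemma roots_above_iff: "\<beta> \<in> P \<longleftrightarrow> \<beta> \<in> \<Phi> \<and> grade \<beta> = 1"
proof
  assume b: "\<beta> \<in> P"
  then have p: "\<beta> \<in> positive_roots \<Phi> \<Delta>" and "\<beta> - \<alpha> \<in> nonneg_combinations \<Delta>"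
    by (auto simp: roots_above_def root_le_def)
  then have "grade (\<beta> - \<alpha>) \<ge> 0" using nonneg_grade by blast
  then have "grade \<beta> \<ge> 1" using grade_simple[OF alpha] by (simp add: inner_diff_right)
  then show "\<beta> \<in> \<Phi> \<and> grade \<beta> = 1" using grade_positive[OF p] positive_nonneg[OF p] by auto
next
  assume b: "\<beta> \<in> \<Phi> \<and> grade \<beta> = 1"
  then have p: "\<beta> \<in> positive_roots \<Phi> \<Delta>" using grade_one_positive by blast
  note ind = base_independent[OF base]
  have sp: "\<beta> \<in> span \<Delta>" "\<alpha> \<in> span \<Delta>" using root_in_span[OF base] b span_base[OF alpha] by auto
  have rep: "representation \<Delta> (\<beta> - \<alpha>) x = representation \<Delta> \<beta> x - (if x = \<alpha> then 1 else 0)" for x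
    using fun_cong[OF representation_diff[OF ind sp(2,1)], of x] fun_cong[OF representation_basis[OF ind alpha], of x] by simp
  have "representation \<Delta> (\<beta> - \<alpha>) x \<in> \<nat>" if "x \<in> \<Delta>" for x
    using rep[of x] b grade_root[of \<beta>] positive_nonneg[OF p] base_nonneg_iff[OF base] that by auto
  then have "\<beta> - \<alpha> \<in> nonneg_combinations \<Delta>" using base_nonneg_iff[OF base] span_diff[OF sp] by blast
  then show "\<beta> \<in> P" using p by (simp add: roots_above_def root_le_def)
qed

abbreviation "R \<equiv> relation_of (root_le \<Delta>) P"

lemma R_iff: "(\<beta>, \<gamma>) \<in> R \<longleftrightarrow> \<beta> \<in> P \<and> \<gamma> \<in> P \<and> \<gamma> - \<beta> \<in> nonneg_combinations \<Delta>"
  by (auto simp: relation_of_def root_le_def)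

lemma nonneg_antisym:
  assumes "v \<in> nonneg_combinations \<Delta>" "- v \<in> nonneg_combinations \<Delta>"
  shows "v = 0"
proof -
  have sp: "v \<in> span \<Delta>" using assms(1) base_nonneg_iff[OF base] by blast
  have "representation \<Delta> v x = 0" if "x \<in> \<Delta>" for x
  proof -
    have "representation \<Delta> (- v) x = - representation \<Delta> v x"
      using representation_neg[OF base_independent[OF base] sp] by simp
    then show ?thesis using nonneg_nat[OF assms(1) that] nonneg_nat[OF assms(2) that] by auto
  qed
  then have "(\<Sum>x\<in>\<Delta>. representation \<Delta> v x *\<^sub>R x) = 0" by (intro sum.neutral) simp
  then show ?thesis using base_sum[OF base sp] by simp
qed

sublocale finite_order P R
proof
  show "finite P" by (rule finite_subset[OF _ finite_roots]) (use roots_above_iff in blast)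
  have "refl_on P R" by (auto simp: refl_on_def R_iff nonneg_combinations_zero)
  moreover have "trans R"
  proof (rule transI)
    fix x y z assume "(x, y) \<in> R" "(y, z) \<in> R"
    then show "(x, z) \<in> R" using nonneg_combinations_add[of "z - y" \<Delta> "y - x"] by (simp add: R_iff)
  qed
  moreover have "antisym R"
  proof (rule antisymI)
    fix x y assume "(x, y) \<in> R" "(y, x) \<in> R"
    then have "y - x = 0" using nonneg_antisym[of "y - x"] by (simp add: R_iff)
    then show "x = y" by simp
  qed
  moreover have "R \<subseteq> P \<times> P" by (auto simp: relation_of_def)
  ultimately show "partial_order_on P R" by (simp add: partial_order_on_def preorder_on_def)
qed

section \<open>Bases adapted to ideals\<close>

text \<open>\<open>adapted I D\<close> says that \<open>D\<close> is the base \<open>w\<^sup>-\<^sup>1 \<Delta>\<close>, where \<open>w\<close> is the Weyl group element with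
  inversion set \<open>I\<close>; no Weyl group elements are needed to describe it.\<close>

definition adapted :: "'v set \<Rightarrow> 'v set \<Rightarrow> bool" where
  "adapted I D \<longleftrightarrow> simple_roots \<Phi> D \<and>
     positive_roots \<Phi> D = {\<beta> \<in> \<Phi>. grade \<beta> = 0 \<and> \<beta> \<in> positive_roots \<Phi> \<Delta> \<or>
       grade \<beta> = 1 \<and> \<beta> \<notin> I \<or> grade \<beta> = -1 \<and> - \<beta> \<in> I}"

lemma adaptedD:
  assumes "adapted I D"
  shows "simple_roots \<Phi> D"
    and "\<beta> \<in> positive_roots \<Phi> D \<longleftrightarrow> \<beta> \<in> \<Phi> \<and> (grade \<beta> = 0 \<and> \<beta> \<in> positive_roots \<Phi> \<Delta> \<or>
       grade \<beta> = 1 \<and> \<beta> \<notin> I \<or> grade \<beta> = -1 \<and> - \<beta> \<in> I)"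
  using assms by (auto simp: adapted_def)

lemma adapted_empty: "adapted {} \<Delta>"
proof -
  have "\<beta> \<in> positive_roots \<Phi> \<Delta> \<longleftrightarrow> \<beta> \<in> \<Phi> \<and> (grade \<beta> = 0 \<and> \<beta> \<in> positive_roots \<Phi> \<Delta> \<or> grade \<beta> = 1)" for \<beta>
    using grade_positive[of \<beta>] positive_nonneg[of \<beta> \<Delta>] grade_one_positive[of \<beta>] by blast
  then show ?thesis using base by (auto simp: adapted_def)
qed

lemma adapted_unique: "adapted I D \<Longrightarrow> adapted I D' \<Longrightarrow> D = D'"
  using base_unique by (simp add: adapted_def)

text \<open>If \<beta> were a sum of two positive roots of \<open>D\<close>, their grades would be 0
  and 1. The summand of grade 1 would lie in \<open>P - I\<close> strictly below \<beta>, against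
  minimality.\<close>

lemma addable_simple:
  assumes D: "adapted I D" and I: "I \<in> J" and b: "\<beta> \<in> addable P R I"
  shows "\<beta> \<in> D"
proof (rule ccontr)
  assume nD: "\<beta> \<notin> D"
  have bP: "\<beta> \<in> P" "\<beta> \<notin> I" and bmin: "\<And>y. y \<in> P - I \<Longrightarrow> (y, \<beta>) \<in> R \<Longrightarrow> y = \<beta>"
    using b addable_iff[OF I] by auto
  then have g: "\<beta> \<in> \<Phi>" "grade \<beta> = 1" by (simp_all add: roots_above_iff)
  have "\<beta> \<in> positive_roots \<Phi> D" using adaptedD(2)[OF D, of \<beta>] g bP by simp
  then obtain \<beta>1 \<beta>2 where b12: "\<beta>1 \<in> positive_roots \<Phi> D" "\<beta>2 \<in> positive_roots \<Phi> D" "\<beta> = \<beta>1 + \<beta>2"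
    using positive_decomposition[OF adaptedD(1)[OF D] _ nD] by blast
  have key: False if "x \<in> positive_roots \<Phi> D" "y \<in> positive_roots \<Phi> D" "\<beta> = x + y" "grade x = 0" "grade y = 1" for x y
  proof -
    have x: "x \<in> positive_roots \<Phi> \<Delta>" "x \<in> \<Phi>" using adaptedD(2)[OF D, of x] that by auto
    have y: "y \<in> \<Phi>" "y \<notin> I" using adaptedD(2)[OF D, of y] that by auto
    have yP: "y \<in> P" using y that by (simp add: roots_above_iff)
    have "\<beta> - y = x" using that by simp
    then have "(y, \<beta>) \<in> R" using yP bP x positive_nonneg[of x \<Delta>] by (simp add: R_iff)
    then have "y = \<beta>" using bmin yP y by blast
    then show False using that(3) root_nonzero[OF x(2)] by simp
  qed
  have R12: "\<beta>1 \<in> \<Phi>" "\<beta>2 \<in> \<Phi>" using b12 positive_nonneg by blast+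
  have "grade \<beta>1 + grade \<beta>2 = 1" using g b12(3) by (simp add: inner_add_right)
  then have "grade \<beta>1 = 0 \<and> grade \<beta>2 = 1 \<or> grade \<beta>1 = 1 \<and> grade \<beta>2 = 0"
    using grade_cases[OF R12(1)] grade_cases[OF R12(2)] by auto
  then show False using key[OF b12] key[OF b12(2,1)] b12(3) by (auto simp: add.commute)
qed

text \<open>Reflecting in the simple root \<beta> of \<open>D\<close> replaces \<beta> by
  \<open>- \<beta>\<close> in the set of positive roots and changes nothing else there, which is the
  effect of adding \<beta> to \<open>I\<close>.\<close>

lemma adapted_insert:
  assumes D: "adapted I D" and I: "I \<in> J" and b: "\<beta> \<in> addable P R I"
  shows "adapted (insert \<beta> I) (reflect \<beta> ` D)"
proof -
  have bP: "\<beta> \<in> P" "\<beta> \<notin> I" using b addable_iff[OF I] by auto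
  then have g: "\<beta> \<in> \<Phi>" "grade \<beta> = 1" by (simp_all add: roots_above_iff)
  have bD: "\<beta> \<in> D" using addable_simple[OF D I b] .
  note DD = adaptedD(1)[OF D]
  have "positive_roots \<Phi> (reflect \<beta> ` D) = insert (- \<beta>) (positive_roots \<Phi> D - {\<beta>})"
    using positive_reflect_base[OF DD g(1)] image_reflect_positive[OF DD bD] by simp
  also have "\<dots> = {\<gamma> \<in> \<Phi>. grade \<gamma> = 0 \<and> \<gamma> \<in> positive_roots \<Phi> \<Delta> \<or>
       grade \<gamma> = 1 \<and> \<gamma> \<notin> insert \<beta> I \<or> grade \<gamma> = -1 \<and> - \<gamma> \<in> insert \<beta> I}" (is "?A = ?B")
  proof (rule set_eqI)
    fix \<gamma>
    have neg: "- \<gamma> = \<beta> \<longleftrightarrow> \<gamma> = - \<beta>" by auto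
    consider "\<gamma> = \<beta>" | "\<gamma> = - \<beta>" | "\<gamma> \<noteq> \<beta>" "\<gamma> \<noteq> - \<beta>" by blast
    then show "\<gamma> \<in> ?A \<longleftrightarrow> \<gamma> \<in> ?B"
    proof cases
      case 1
      have "\<beta> \<noteq> - \<beta>" using g(2) by (metis inner_minus_right one_neq_neg_one)
      then show ?thesis using 1 g by simp
    next
      case 2
      then show ?thesis using g root_uminus[OF g(1)] by simp
    next
      case 3
      then have "\<gamma> \<in> ?A \<longleftrightarrow> \<gamma> \<in> positive_roots \<Phi> D" "\<gamma> \<in> insert \<beta> I \<longleftrightarrow> \<gamma> \<in> I" "- \<gamma> \<in> insert \<beta> I \<longleftrightarrow> - \<gamma> \<in> I"
        using neg by auto
      then show ?thesis unfolding mem_Collect_eq by (simp only: adaptedD(2)[OF D, of \<gamma>])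
    qed
  qed
  finally show ?thesis using reflect_base[OF DD g(1)] by (simp add: adapted_def)
qed

text \<open>This transfers the order of \<open>P\<close>, defined by \<Delta>, to \<open>D\<close>.
  A combination of grade 0 involves only simple roots other than \<alpha>; these have grade 0
  themselves, so they are positive for \<open>D\<close> too.\<close>

lemma nonneg_adapted:
  assumes D: "adapted I D" and v: "v \<in> nonneg_combinations \<Delta>" "grade v = 0"
  shows "v \<in> nonneg_combinations D"
proof -
  have sp: "v \<in> span \<Delta>" using v(1) base_nonneg_iff[OF base] by blast
  have "representation \<Delta> v \<delta> *\<^sub>R \<delta> \<in> nonneg_combinations D" if d: "\<delta> \<in> \<Delta>" for \<delta>
  proof (cases "\<delta> = \<alpha>")
    case True
    then show ?thesis using v(2) grade_eq[OF sp] by (simp add: nonneg_combinations_zero)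
  next
    case False
    then have "\<delta> \<in> positive_roots \<Phi> D"
      using adaptedD(2)[OF D, of \<delta>] base_positive[OF base d] grade_simple[OF d] base_subset[OF base d] by simp
    then show ?thesis using nonneg_nat[OF v(1) d] positive_nonneg[of \<delta> D] nonneg_combinations_scale by metis
  qed
  then have "(\<Sum>\<delta>\<in>\<Delta>. representation \<Delta> v \<delta> *\<^sub>R \<delta>) \<in> nonneg_combinations D"
    by (rule nonneg_combinations_sum)
  then show ?thesis using base_sum[OF base sp] by simp
qed

text \<open>For an element \<open>y\<close> of \<open>P - I\<close> below \<delta>, both
  \<open>y\<close> and \<open>\<delta> - y\<close> are nonnegative combinations of \<open>D\<close>,
  so \<open>base_indecomposable\<close> forces \<open>y = \<delta>\<close>.\<close>

lemma simple_grade_one: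
  assumes D: "adapted I D" and I: "I \<in> J" and d: "\<delta> \<in> D" "grade \<delta> = 1"
  shows "\<delta> \<in> addable P R I"
proof -
  note DD = adaptedD(1)[OF D]
  have dR: "\<delta> \<in> \<Phi>" "\<delta> \<notin> I" using base_positive[OF DD d(1)] adaptedD(2)[OF D, of \<delta>] d(2) by auto
  then have dP: "\<delta> \<in> P" using d(2) by (simp add: roots_above_iff)
  have "y = \<delta>" if y: "y \<in> P - I" "(y, \<delta>) \<in> R" for y
  proof -
    have yR: "y \<in> \<Phi>" "grade y = 1" using y(1) by (auto simp: roots_above_iff)
    then have "y \<in> positive_roots \<Phi> D" using adaptedD(2)[OF D, of y] y(1) by simp
    then have yn: "y \<in> nonneg_combinations D" using positive_nonneg by blast
    have "\<delta> - y \<in> nonneg_combinations D"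
      using nonneg_adapted[OF D, of "\<delta> - y"] y(2) yR d(2) by (simp add: R_iff inner_diff_right)
    then have "y = 0 \<or> \<delta> - y = 0" using base_indecomposable[OF DD d(1) yn, of "\<delta> - y"] by simp
    then show ?thesis using root_nonzero[OF yR(1)] by simp
  qed
  then show ?thesis using addable_iff[OF I] dP dR by blast
qed

text \<open>As for grade 1, now with \<delta> written as \<open>- y\<close> plus
  \<open>y + \<delta>\<close> for an element \<open>y\<close> of \<open>I\<close> above
  \<open>- \<delta>\<close>.\<close>

lemma simple_grade_minus_one:
  assumes D: "adapted I D" and I: "I \<in> J" and d: "\<delta> \<in> D" "grade \<delta> = -1"
  shows "- \<delta> \<in> removable P R I"
proof -
  note DD = adaptedD(1)[OF D]
  have dI: "- \<delta> \<in> I" using base_positive[OF DD d(1)] adaptedD(2)[OF D, of \<delta>] d(2) by auto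
  have "y = - \<delta>" if y: "y \<in> I" "(- \<delta>, y) \<in> R" for y
  proof -
    have yR: "y \<in> \<Phi>" "grade y = 1" using y(1) ideal_subset[OF I] by (auto simp: roots_above_iff)
    then have "- y \<in> positive_roots \<Phi> D" using adaptedD(2)[OF D, of "- y"] y(1) root_uminus by simp
    then have yn: "- y \<in> nonneg_combinations D" using positive_nonneg by blast
    have "y + \<delta> \<in> nonneg_combinations D"
      using nonneg_adapted[OF D, of "y + \<delta>"] y(2) yR d(2) by (simp add: R_iff inner_add_right)
    then have "- y = 0 \<or> y + \<delta> = 0" using base_indecomposable[OF DD d(1) yn] by simp
    then show ?thesis using root_nonzero[OF yR(1)] by (auto simp: eq_neg_iff_add_eq_0)
  qed
  then show ?thesis using removable_iff[OF I] dI by blast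
qed

lemma card_norm_reflect:
  assumes "\<gamma> \<noteq> 0"
  shows "card {\<delta> \<in> reflect \<gamma> ` D. \<delta> \<bullet> \<delta> = \<nu>} = card {\<delta> \<in> D. \<delta> \<bullet> \<delta> = \<nu>}"
proof -
  have "{\<delta> \<in> reflect \<gamma> ` D. \<delta> \<bullet> \<delta> = \<nu>} = reflect \<gamma> ` {\<delta> \<in> D. \<delta> \<bullet> \<delta> = \<nu>}"
    using inner_reflect[OF assms] by auto
  then show ?thesis using card_image[OF inj_on_subset[OF inj_reflect[OF assms]]] by simp
qed

text \<open>\<open>I\<close> is built up by adding single elements, each of which reflects the base.
  Reflections are isometries, so the number of simple roots of each length stays that of
  \<Delta>.\<close>

lemma adapted_exists:
  assumes "I \<in> J"
  shows "\<exists>D. adapted I D \<and> (\<forall>\<nu>. card {\<delta> \<in> D. \<delta> \<bullet> \<delta> = \<nu>} = card {\<delta> \<in> \<Delta>. \<delta> \<bullet> \<delta> = \<nu>})"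
  using assms
proof (induction "card I" arbitrary: I rule: less_induct)
  case less
  show ?case
  proof (cases "I = {}")
    case True then show ?thesis using adapted_empty by blast
  next
    case False
    then obtain p where p: "p \<in> removable P R I" using removable_between[OF less.prems empty_ideal] by blast
    have pI: "p \<in> I" using p by (simp add: removable_def)
    have I': "I - {p} \<in> J" using remove_removable[OF p] .
    have "card (I - {p}) < card I" using card_Diff1_less[OF finite_ideal[OF less.prems] pI] .
    then obtain D where D: "adapted (I - {p}) D" "\<And>\<nu>. card {\<delta> \<in> D. \<delta> \<bullet> \<delta> = \<nu>} = card {\<delta> \<in> \<Delta>. \<delta> \<bullet> \<delta> = \<nu>}"
      using less.hyps[OF _ I'] by blast
    have "insert p (I - {p}) = I" using pI by blast
    then have "adapted I (reflect p ` D)" using adapted_insert[OF D(1) I' addable_remove[OF less.prems p]] by simp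
    moreover have "p \<noteq> 0" using pI ideal_subset[OF less.prems] roots_above_iff root_nonzero by blast
    ultimately show ?thesis using D(2) card_norm_reflect[of p D] by (intro exI[of _ "reflect p ` D"]) simp
  qed
qed

definition ideal_base :: "'v set \<Rightarrow> 'v set" where
  "ideal_base I = (THE D. adapted I D)"

lemma ideal_base_eq:
  assumes D: "adapted I D"
  shows "ideal_base I = D"
  unfolding ideal_base_def
proof (rule the_equality[of "adapted I", OF D])
  fix D' assume "adapted I D'"
  then show "D' = D" using D by (rule adapted_unique)
qed

lemma adapted_ideal_base: "I \<in> J \<Longrightarrow> adapted I (ideal_base I)"
  using adapted_exists[of I] ideal_base_eq[of I] by auto

lemma card_ideal_base: "I \<in> J \<Longrightarrow> card {\<delta> \<in> ideal_base I. \<delta> \<bullet> \<delta> = \<nu>} = card {\<delta> \<in> \<Delta>. \<delta> \<bullet> \<delta> = \<nu>}"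
  using adapted_exists[of I] ideal_base_eq[of I] by auto

lemma ideal_base_insert: "I \<in> J \<Longrightarrow> \<beta> \<in> addable P R I \<Longrightarrow> ideal_base (insert \<beta> I) = reflect \<beta> ` ideal_base I"
  by (rule ideal_base_eq[OF adapted_insert[OF adapted_ideal_base]])

lemma simple_ideal_base: "I \<in> J \<Longrightarrow> simple_roots \<Phi> (ideal_base I)"
  by (rule adaptedD(1)[OF adapted_ideal_base])

lemma addable_root: "\<beta> \<in> addable P R I \<Longrightarrow> \<beta> \<in> \<Phi> \<and> grade \<beta> = 1"
  by (simp add: addable_def roots_above_iff)

lemma ideal_base_grade_one:
  assumes I: "I \<in> J"
  shows "{\<delta> \<in> ideal_base I. grade \<delta> = 1} = addable P R I"
proof (intro set_eqI iffI)
  fix x assume "x \<in> {\<delta> \<in> ideal_base I. grade \<delta> = 1}"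
  then show "x \<in> addable P R I" using simple_grade_one[OF adapted_ideal_base[OF I] I] by simp
next
  fix x assume x: "x \<in> addable P R I"
  show "x \<in> {\<delta> \<in> ideal_base I. grade \<delta> = 1}"
    using addable_simple[OF adapted_ideal_base[OF I] I x] addable_root[OF x] by simp
qed

text \<open>For the converse inclusion, a removable \<gamma> is simple for
  \<open>I - {\<gamma>}\<close>, and the reflection that adds it back turns it into
  \<open>- \<gamma>\<close>.\<close>

lemma ideal_base_grade_minus_one:
  assumes I: "I \<in> J"
  shows "{\<delta> \<in> ideal_base I. grade \<delta> = -1} = uminus ` removable P R I"
proof (intro set_eqI iffI)
  fix x assume "x \<in> {\<delta> \<in> ideal_base I. grade \<delta> = -1}"
  then have "- x \<in> removable P R I" using simple_grade_minus_one[OF adapted_ideal_base[OF I] I] by blast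
  then show "x \<in> uminus ` removable P R I" by force
next
  fix x assume "x \<in> uminus ` removable P R I"
  then obtain \<gamma> where x: "x = - \<gamma>" and g: "\<gamma> \<in> removable P R I" by blast
  have add: "\<gamma> \<in> addable P R (I - {\<gamma>})" using addable_remove[OF I g] .
  have I': "I - {\<gamma>} \<in> J" using remove_removable[OF g] .
  have "insert \<gamma> (I - {\<gamma>}) = I" using g by (auto simp: removable_def)
  then have eq: "ideal_base I = reflect \<gamma> ` ideal_base (I - {\<gamma>})" using ideal_base_insert[OF I' add] by simp
  have "\<gamma> \<in> ideal_base (I - {\<gamma>})" using addable_simple[OF adapted_ideal_base[OF I'] I' add] .
  moreover have "reflect \<gamma> \<gamma> = x" using x addable_root[OF add] root_nonzero by (simp add: reflect_self)
  ultimately have "x \<in> ideal_base I" using eq by blast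
  then show "x \<in> {\<delta> \<in> ideal_base I. grade \<delta> = -1}" using x addable_root[OF add] by simp
qed

section \<open>Coefficients of the coweight in the adapted bases\<close>

text \<open>If the inner product were negative, the sum would be a root of grade 2.\<close>

lemma inner_grade_one:
  assumes "\<beta> \<in> \<Phi>" "\<gamma> \<in> \<Phi>" "grade \<beta> = 1" "grade \<gamma> = 1"
  shows "\<beta> \<bullet> \<gamma> \<ge> 0"
proof (rule ccontr)
  assume "\<not> ?thesis"
  moreover have "\<beta> \<noteq> - \<gamma>" using assms by auto
  ultimately have "\<beta> + \<gamma> \<in> \<Phi>" using root_add assms by auto
  then show False using grade_cases[of "\<beta> + \<gamma>"] assms by (simp add: inner_add_right)
qed

text \<open>Both are simple in the same base, so their inner product is at most 0; both have grade
  1, so it is at least 0.\<close>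

lemma addable_orthogonal:
  assumes I: "I \<in> J" and "\<beta> \<in> addable P R I" "\<gamma> \<in> addable P R I" "\<beta> \<noteq> \<gamma>"
  shows "\<beta> \<bullet> \<gamma> = 0"
proof -
  have "\<beta> \<bullet> \<gamma> \<le> 0"
    using base_obtuse[OF simple_ideal_base[OF I]] addable_simple[OF adapted_ideal_base[OF I] I] assms by blast
  then show ?thesis using inner_grade_one[of \<beta> \<gamma>] addable_root assms by force
qed

definition coef :: "'v set \<Rightarrow> 'v \<Rightarrow> real" where
  "coef I \<delta> = representation (ideal_base I) coweight \<delta>"

lemma coweight_span_ideal_base: "I \<in> J \<Longrightarrow> coweight \<in> span (ideal_base I)"
  using coweight_in_span span_base_eq[OF base] span_base_eq[OF simple_ideal_base] by simp

lemma coef_insert: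
  assumes I: "I \<in> J" and g: "\<gamma> \<in> addable P R I" and d: "\<delta> \<in> ideal_base I"
  shows "coef (insert \<gamma> I) (reflect \<gamma> \<delta>) = coef I \<delta> - (if \<delta> = \<gamma> then 2 / (\<gamma> \<bullet> \<gamma>) else 0)"
proof -
  let ?D = "ideal_base I"
  have gR: "\<gamma> \<in> \<Phi>" "grade \<gamma> = 1" using addable_root[OF g] by auto
  have g0: "\<gamma> \<noteq> 0" using root_nonzero[OF gR(1)] .
  note DD = simple_ideal_base[OF I]
  have gD: "\<gamma> \<in> ?D" using addable_simple[OF adapted_ideal_base[OF I] I g] .
  have eq: "ideal_base (insert \<gamma> I) = reflect \<gamma> ` ?D" using ideal_base_insert[OF I g] .
  note D' = reflect_base[OF DD gR(1)]
  note ind = base_independent[OF D']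
  let ?c = "2 / (\<gamma> \<bullet> \<gamma>)"
  \<comment> \<open>As \<gamma> has grade 1, the reflection moves the coweight by \<open>?c\<close>
    times \<gamma>. The reflected coweight has the old coefficients in the reflected base, and the
    correction is written with \<open>- \<gamma>\<close> because that is a member of this
    base.\<close>
  have lam: "coweight = reflect \<gamma> coweight - ?c *\<^sub>R (- \<gamma>)"
    by (simp add: reflect_def gR(2))
  have mg: "- \<gamma> \<in> reflect \<gamma> ` ?D" using gD reflect_self[OF g0] by force
  have rl: "reflect \<gamma> coweight \<in> span (reflect \<gamma> ` ?D)"
    using coweight_span_ideal_base[OF I] linear_span_image[OF linear_reflect] by blast
  have "representation (reflect \<gamma> ` ?D) coweight (reflect \<gamma> \<delta>) =
      representation (reflect \<gamma> ` ?D) (reflect \<gamma> coweight) (reflect \<gamma> \<delta>) -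
      ?c * representation (reflect \<gamma> ` ?D) (- \<gamma>) (reflect \<gamma> \<delta>)"
    by (subst (1) lam)
       (simp only: representation_diff[OF ind span_scale[OF span_base[OF mg]] rl]
          representation_scale[OF ind span_base[OF mg]])
  also have "representation (reflect \<gamma> ` ?D) (reflect \<gamma> coweight) (reflect \<gamma> \<delta>) = coef I \<delta>"
    unfolding coef_def by (rule representation_reflect[OF DD gR(1) coweight_span_ideal_base[OF I] d])
  also have "representation (reflect \<gamma> ` ?D) (- \<gamma>) (reflect \<gamma> \<delta>) = (if \<delta> = \<gamma> then 1 else 0)"
    unfolding representation_basis[OF ind mg] using reflect_self[OF g0] reflect_reflect[OF g0] by metis
  finally show ?thesis by (simp add: coef_def eq)
qed

lemma coef_insert_self:
  assumes I: "I \<in> J" and g: "\<gamma> \<in> addable P R I"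
  shows "coef (insert \<gamma> I) (- \<gamma>) = coef I \<gamma> - 2 / (\<gamma> \<bullet> \<gamma>)"
  using coef_insert[OF I g addable_simple[OF adapted_ideal_base[OF I] I g]]
    reflect_self[of \<gamma>] root_nonzero addable_root[OF g] by simp

lemma coef_insert_other:
  assumes I: "I \<in> J" and "\<gamma> \<in> addable P R I" "\<beta> \<in> addable P R I" "\<beta> \<noteq> \<gamma>"
  shows "coef (insert \<gamma> I) \<beta> = coef I \<beta>"
  using coef_insert[OF I assms(2) addable_simple[OF adapted_ideal_base[OF I] I assms(3)]]
    reflect_orthogonal[OF addable_orthogonal[OF I assms(3,2,4)]] assms(4) by simp

text \<open>For \<beta> in \<open>P\<close>, the smallest ideal to which \<beta> can be added; it
  serves as the reference point for the coefficient at \<beta>.\<close>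

definition below :: "'v \<Rightarrow> 'v set" where "below \<beta> = {\<gamma> \<in> P. (\<gamma>, \<beta>) \<in> R \<and> \<gamma> \<noteq> \<beta>}"

lemma below_ideal: "below \<beta> \<in> J"
  unfolding below_def order_ideals_def using rel_trans rel_antisym by blast

text \<open>As long as \<open>I\<close> exceeds \<open>below \<beta>\<close>, it has a removable
  \<gamma> that is not below \<beta>. Without \<gamma>, the root \<beta> is still addable and is
  orthogonal to \<gamma>, so its coefficient is unchanged; this descends to
  \<open>below \<beta>\<close>.\<close>

lemma coef_independent:
  assumes "I \<in> J" "\<beta> \<in> addable P R I"
  shows "coef I \<beta> = coef (below \<beta>) \<beta>"
  using assms
proof (induction "card I" arbitrary: I rule: less_induct)
  case less
  note I = less.prems(1)
  have b: "\<beta> \<in> P" "\<beta> \<notin> I" "\<And>y. y \<in> P - I \<Longrightarrow> (y, \<beta>) \<in> R \<Longrightarrow> y = \<beta>"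
    using less.prems(2) addable_iff[OF I] by auto
  have sub: "below \<beta> \<subseteq> I" using b(3) by (auto simp: below_def)
  show ?case
  proof (cases "I = below \<beta>")
    case False
    then obtain \<gamma> where g: "\<gamma> \<in> I - below \<beta>" "\<gamma> \<in> removable P R I"
      using removable_between[OF I below_ideal, of \<beta>] sub by blast
    have I': "I - {\<gamma>} \<in> J" using remove_removable[OF g(2)] .
    have gadd: "\<gamma> \<in> addable P R (I - {\<gamma>})" using addable_remove[OF I g(2)] .
    have ne: "\<beta> \<noteq> \<gamma>" using g b by blast
    have "(\<gamma>, \<beta>) \<notin> R" using g(1) ne ideal_subset[OF I] by (auto simp: below_def)
    then have badd: "\<beta> \<in> addable P R (I - {\<gamma>})" using b addable_iff[OF I'] by blast
    have "card (I - {\<gamma>}) < card I" using card_Diff1_less[OF finite_ideal[OF I], of \<gamma>] g by blast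
    then have "coef (I - {\<gamma>}) \<beta> = coef (below \<beta>) \<beta>" using less.hyps I' badd by blast
    moreover have "insert \<gamma> (I - {\<gamma>}) = I" using g by blast
    ultimately show ?thesis using coef_insert_other[OF I' gadd badd ne] by simp
  qed simp
qed

text \<open>Pair the coweight with its own expansion in \<open>ideal_base I\<close>. Terms of grade
  0 vanish, those of grade 1 come from addable roots and those of grade -1 from removable
  ones.\<close>

lemma weighted_identity:
  assumes I: "I \<in> J"
  shows "(\<Sum>\<gamma>\<in>removable P R I. 2 / (\<gamma> \<bullet> \<gamma>)) = coweight \<bullet> coweight
    - (\<Sum>\<beta>\<in>addable P R I. coef (below \<beta>) \<beta>) + (\<Sum>\<gamma>\<in>removable P R I. coef (below \<gamma>) \<gamma>)"
proof -
  let ?D = "ideal_base I"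
  have finD: "finite ?D" using base_finite[OF simple_ideal_base[OF I]] .
  have DR: "\<delta> \<in> \<Phi>" if "\<delta> \<in> ?D" for \<delta> using base_subset[OF simple_ideal_base[OF I] that] .
  \<comment> \<open>The coefficient of a removable root is traced back to the moment before it was
    added, where \<open>coef_independent\<close> applies.\<close>
  have rem: "coef I (- \<gamma>) = coef (below \<gamma>) \<gamma> - 2 / (\<gamma> \<bullet> \<gamma>)" if g: "\<gamma> \<in> removable P R I" for \<gamma>
  proof -
    have I': "I - {\<gamma>} \<in> J" using remove_removable[OF g] .
    have gadd: "\<gamma> \<in> addable P R (I - {\<gamma>})" using addable_remove[OF I g] .
    have "insert \<gamma> (I - {\<gamma>}) = I" using g by (auto simp: removable_def)
    then show ?thesis using coef_insert_self[OF I' gadd] coef_independent[OF I' gadd] by simp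
  qed
  have "coweight \<bullet> coweight = coweight \<bullet> (\<Sum>\<delta>\<in>?D. coef I \<delta> *\<^sub>R \<delta>)"
    unfolding coef_def using base_sum[OF simple_ideal_base[OF I] coweight_span_ideal_base[OF I]] by simp
  also have "\<dots> = (\<Sum>\<delta>\<in>?D. coef I \<delta> * grade \<delta>)" by (simp add: inner_sum_right)
  also have "\<dots> = (\<Sum>\<delta>\<in>{\<delta> \<in> ?D. grade \<delta> = 1} \<union> {\<delta> \<in> ?D. grade \<delta> = -1}. coef I \<delta> * grade \<delta>)"
    by (rule sum.mono_neutral_right) (use finD grade_cases[OF DR] in auto)
  also have "\<dots> = (\<Sum>\<delta>\<in>{\<delta> \<in> ?D. grade \<delta> = 1}. coef I \<delta> * grade \<delta>)
      + (\<Sum>\<delta>\<in>{\<delta> \<in> ?D. grade \<delta> = -1}. coef I \<delta> * grade \<delta>)"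
    by (rule sum.union_disjoint) (use finD in auto)
  also have "(\<Sum>\<delta>\<in>{\<delta> \<in> ?D. grade \<delta> = 1}. coef I \<delta> * grade \<delta>) = (\<Sum>\<beta>\<in>addable P R I. coef (below \<beta>) \<beta>)"
    unfolding ideal_base_grade_one[OF I]
    by (intro sum.cong refl) (simp add: addable_root coef_independent[OF I])
  also have "(\<Sum>\<delta>\<in>{\<delta> \<in> ?D. grade \<delta> = -1}. coef I \<delta> * grade \<delta>) =
      (\<Sum>\<delta>\<in>{\<delta> \<in> ?D. grade \<delta> = -1}. - coef I \<delta>)"
    by (intro sum.cong refl) simp
  also have "\<dots> = (\<Sum>\<gamma>\<in>removable P R I. 2 / (\<gamma> \<bullet> \<gamma>) - coef (below \<gamma>) \<gamma>)"
    unfolding ideal_base_grade_minus_one[OF I]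
    by (subst sum.reindex) (auto simp: rem intro: sum.cong)
  finally show ?thesis by (simp add: sum_subtractf)
qed

end

section \<open>Root lengths\<close>

locale irreducible_minuscule = minuscule_setup +
  assumes irreducible: "irreducible_root_system \<Phi>"
begin

section \<open>Irreducibility and the two root lengths\<close>

lemma irreducible_split:
  assumes "A \<subseteq> \<Phi>" "B \<subseteq> \<Phi>" "A \<union> B = \<Phi>" "A \<inter> B = {}" "B \<noteq> {}"
    and "\<And>a b. a \<in> A \<Longrightarrow> b \<in> B \<Longrightarrow> a \<bullet> b = 0"
  shows "A = {}"
proof (rule ccontr)
  assume "A \<noteq> {}"
  then have "\<exists>A B. A \<noteq> {} \<and> B \<noteq> {} \<and> A \<inter> B = {} \<and> A \<union> B = \<Phi> \<and> (\<forall>a\<in>A. \<forall>b\<in>B. a \<bullet> b = 0)"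
    using assms by (intro exI[of _ A] exI[of _ B]) simp
  then show False using irreducible by (simp add: irreducible_root_system_def)
qed

text \<open>Split \<Phi> into the roots orthogonal to \<open>S\<close> and the others. If \<psi> is
  not orthogonal to some \<sigma> in \<open>S\<close>, then \<sigma> and its reflection in \<psi>
  differ by a nonzero multiple of \<psi>, so a root orthogonal to \<open>S\<close> is orthogonal to
  \<psi>. By irreducibility the first part is empty.\<close>

lemma not_orthogonal_to_stable_set:
  assumes O: "S \<subseteq> \<Phi>" "S \<noteq> {}"
    and stable: "\<And>\<psi> \<sigma>. \<psi> \<in> \<Phi> \<Longrightarrow> \<psi> \<notin> S \<Longrightarrow> - \<psi> \<notin> S \<Longrightarrow> \<sigma> \<in> S \<Longrightarrow> reflect \<psi> \<sigma> \<in> S"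
    and p: "\<phi> \<in> \<Phi>"
  shows "\<exists>\<sigma>\<in>S. \<phi> \<bullet> \<sigma> \<noteq> 0"
proof -
  let ?A = "{\<phi> \<in> \<Phi>. \<forall>\<sigma>\<in>S. \<phi> \<bullet> \<sigma> = 0}"
  let ?B = "{\<phi> \<in> \<Phi>. \<exists>\<sigma>\<in>S. \<phi> \<bullet> \<sigma> \<noteq> 0}"
  have orth: "a \<bullet> \<psi> = 0" if a: "a \<in> ?A" and \<psi>: "\<psi> \<in> ?B" for a \<psi>
  proof -
    obtain \<sigma> where \<sigma>: "\<sigma> \<in> S" "\<psi> \<bullet> \<sigma> \<noteq> 0" using \<psi> by blast
    have a0: "a \<bullet> x = 0" if "x \<in> S" for x using a that by blast
    consider "\<psi> \<in> S" | "- \<psi> \<in> S" | "\<psi> \<notin> S" "- \<psi> \<notin> S" by blast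
    then show ?thesis
    proof cases
      case 1 then show ?thesis using a0 by blast
    next
      case 2 then show ?thesis using a0[of "- \<psi>"] by simp
    next
      case 3
      have pR: "\<psi> \<in> \<Phi>" using \<psi> by blast
      then have "reflect \<psi> \<sigma> \<in> S" using stable 3 \<sigma> by blast
      then have "a \<bullet> reflect \<psi> \<sigma> = 0" "a \<bullet> \<sigma> = 0" using a0 \<sigma> by blast+
      then have "2 * (\<sigma> \<bullet> \<psi>) / (\<psi> \<bullet> \<psi>) * (a \<bullet> \<psi>) = 0" by (simp add: reflect_def inner_diff_right)
      moreover have "2 * (\<sigma> \<bullet> \<psi>) / (\<psi> \<bullet> \<psi>) \<noteq> 0"
        using \<sigma>(2) root_norm_pos[OF pR] by (simp add: inner_commute)
      ultimately show ?thesis by (simp only: mult_eq_0_iff) simp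
    qed
  qed
  obtain \<sigma> where "\<sigma> \<in> S" using O by blast
  then have "\<sigma> \<in> ?B" using O root_nonzero by force
  then have "?A = {}" by (intro irreducible_split[of ?A ?B]) (use orth in blast)+
  then show ?thesis using p by blast
qed

lemma norm_reflect: "\<gamma> \<in> \<Phi> \<Longrightarrow> reflect \<gamma> v \<bullet> reflect \<gamma> v = v \<bullet> v"
  using inner_reflect root_nonzero by blast

lemma not_orthogonal_to_norm:
  assumes "\<phi> \<in> \<Phi>" "\<beta> \<in> \<Phi>"
  shows "\<exists>\<sigma>\<in>\<Phi>. \<sigma> \<bullet> \<sigma> = \<beta> \<bullet> \<beta> \<and> \<phi> \<bullet> \<sigma> \<noteq> 0"
  using not_orthogonal_to_stable_set[of "{\<sigma> \<in> \<Phi>. \<sigma> \<bullet> \<sigma> = \<beta> \<bullet> \<beta>}" \<phi>] assms reflect_root norm_reflect by auto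

text \<open>Some root of the length of \<gamma> is not orthogonal to \<beta>; up to sign its inner
  product with \<beta> is positive. The Cartan integers then satisfy \<open>k < l\<close> and
  \<open>k * l \<le> 3\<close>, and their quotient is the ratio of the squared lengths.\<close>

lemma norm_ratio:
  assumes "\<beta> \<in> \<Phi>" "\<gamma> \<in> \<Phi>" "\<beta> \<bullet> \<beta> < \<gamma> \<bullet> \<gamma>"
  shows "\<gamma> \<bullet> \<gamma> = 2 * (\<beta> \<bullet> \<beta>) \<or> \<gamma> \<bullet> \<gamma> = 3 * (\<beta> \<bullet> \<beta>)"
proof -
  obtain \<sigma>' where s': "\<sigma>' \<in> \<Phi>" "\<sigma>' \<bullet> \<sigma>' = \<gamma> \<bullet> \<gamma>" "\<beta> \<bullet> \<sigma>' \<noteq> 0"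
    using not_orthogonal_to_norm[OF assms(1,2)] by blast
  define \<sigma> where "\<sigma> = (if \<beta> \<bullet> \<sigma>' > 0 then \<sigma>' else - \<sigma>')"
  have s: "\<sigma> \<in> \<Phi>" "\<sigma> \<bullet> \<sigma> = \<gamma> \<bullet> \<gamma>" "\<beta> \<bullet> \<sigma> > 0"
    using s' root_uminus by (auto simp: \<sigma>_def)
  have ne: "\<beta> \<noteq> \<sigma>" using s assms(3) by auto
  obtain k l :: int where kl: "2 * (\<beta> \<bullet> \<sigma>) = k * (\<sigma> \<bullet> \<sigma>)" "2 * (\<beta> \<bullet> \<sigma>) = l * (\<beta> \<bullet> \<beta>)"
    "k \<ge> 1" "l \<ge> 1" "k * l \<le> 3" using pairing_positive[OF assms(1) s(1) ne s(3)] .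
  have pos: "\<beta> \<bullet> \<beta> > 0" using root_norm_pos assms by blast
  have eq: "real_of_int k * (\<gamma> \<bullet> \<gamma>) = real_of_int l * (\<beta> \<bullet> \<beta>)" using kl(1,2) s(2) by simp
  have lt: "real_of_int k * (\<beta> \<bullet> \<beta>) < real_of_int l * (\<beta> \<bullet> \<beta>)"
    using assms(3) kl(3) eq by (metis mult_strict_left_mono of_int_0_less_iff zero_less_one_class.zero_less_one order_less_le_trans)
  then have "k < l" using pos by simp
  then have "k = 1"
  proof -
    have "\<not> k \<ge> 2"
    proof
      assume "k \<ge> 2"
      then have "2 * 3 \<le> k * l" using \<open>k < l\<close> by (intro mult_mono) auto
      then show False using kl(5) by simp
    qed
    then show ?thesis using kl(3) by simp
  qed
  then have "l = 2 \<or> l = 3" using kl(5) \<open>k < l\<close> by auto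
  then show ?thesis using eq \<open>k = 1\<close> by auto
qed

text \<open>With three lengths, the ratio of the largest to the smallest squared length would be 4,
  6 or 9, which \<open>norm_ratio\<close> excludes.\<close>

lemma two_norms:
  assumes "\<beta> \<in> \<Phi>" "\<gamma> \<in> \<Phi>" "\<beta> \<bullet> \<beta> < \<gamma> \<bullet> \<gamma>" "\<phi> \<in> \<Phi>"
  shows "\<phi> \<bullet> \<phi> = \<beta> \<bullet> \<beta> \<or> \<phi> \<bullet> \<phi> = \<gamma> \<bullet> \<gamma>"
proof (rule ccontr)
  assume no: "\<not> ?thesis"
  have pos: "\<beta> \<bullet> \<beta> > 0" "\<gamma> \<bullet> \<gamma> > 0" "\<phi> \<bullet> \<phi> > 0" using root_norm_pos assms by blast+
  consider "\<phi> \<bullet> \<phi> < \<beta> \<bullet> \<beta>" | "\<beta> \<bullet> \<beta> < \<phi> \<bullet> \<phi>" "\<phi> \<bullet> \<phi> < \<gamma> \<bullet> \<gamma>" | "\<gamma> \<bullet> \<gamma> < \<phi> \<bullet> \<phi>"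
    using no by linarith
  then show False
  proof cases
    case 1
    then have "\<phi> \<bullet> \<phi> < \<gamma> \<bullet> \<gamma>" using assms(3) by simp
    then show False
      using norm_ratio[OF assms(4,1) 1] norm_ratio[OF assms(1-3)] norm_ratio[OF assms(4,2)] pos by auto
  next
    case 2
    then show False
      using norm_ratio[OF assms(1,4) 2(1)] norm_ratio[OF assms(1-3)] norm_ratio[OF assms(4,2) 2(2)] pos by auto
  next
    case 3
    then have "\<beta> \<bullet> \<beta> < \<phi> \<bullet> \<phi>" using assms(3) by simp
    then show False
      using norm_ratio[OF assms(2,4) 3] norm_ratio[OF assms(1-3)] norm_ratio[OF assms(1,4)] pos by auto
  qed
qed

text \<open>\<open>P\<close> is a stable set: roots outside \<open>P\<close> and its negatives have
  grade 0, and reflecting in them preserves the grade.\<close>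

lemma grade_zero_not_orthogonal:
  assumes "\<phi> \<in> \<Phi>" "grade \<phi> = 0"
  shows "\<exists>\<beta>\<in>P. \<phi> \<bullet> \<beta> \<noteq> 0"
proof (rule not_orthogonal_to_stable_set[OF _ _ _ assms(1)])
  show "P \<subseteq> \<Phi>" using roots_above_iff by blast
  have "\<alpha> \<in> P" using roots_above_iff grade_simple[OF alpha] base_subset[OF base alpha] by simp
  then show "P \<noteq> {}" by blast
  fix \<psi> \<sigma> assume h: "\<psi> \<in> \<Phi>" "\<psi> \<notin> P" "- \<psi> \<notin> P" "\<sigma> \<in> P"
  then have "grade \<psi> = 0" using grade_cases[OF h(1)] root_uminus[OF h(1)] by (auto simp: roots_above_iff)
  then show "reflect \<psi> \<sigma> \<in> P"
    using h reflect_root by (simp add: roots_above_iff) (simp add: reflect_def inner_diff_right)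
qed

section \<open>Posets settled by linear relations\<close>

lemma toggle_cde_equal_norms:
  assumes "\<And>\<gamma>. \<gamma> \<in> P \<Longrightarrow> \<gamma> \<bullet> \<gamma> = \<nu>"
  shows "toggle_cde P R"
  unfolding toggle_cde_def
proof (intro exI[of _ "\<nu> / 2 * (coweight \<bullet> coweight)"] exI[of _ "\<lambda>\<beta>. - (\<nu> / 2 * coef (below \<beta>) \<beta>)"] ballI)
  fix I assume I: "I \<in> J"
  have \<nu>: "\<nu> > 0"
    using assms[of \<alpha>] roots_above_iff grade_simple[OF alpha] base_subset[OF base alpha] root_norm_pos[of \<alpha>] by auto
  have "(\<Sum>\<gamma>\<in>removable P R I. 2 / (\<gamma> \<bullet> \<gamma>)) = (\<Sum>\<gamma>\<in>removable P R I. 2 / \<nu>)"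
    using assms ideal_subset[OF I] by (intro sum.cong refl) (auto simp: removable_def)
  then have "real (card (removable P R I)) * (2 / \<nu>) = coweight \<bullet> coweight
    - (\<Sum>\<beta>\<in>addable P R I. coef (below \<beta>) \<beta>) + (\<Sum>\<gamma>\<in>removable P R I. coef (below \<gamma>) \<gamma>)"
    using weighted_identity[OF I] by simp
  then have "real (card (removable P R I)) = \<nu> / 2 * (coweight \<bullet> coweight
    - (\<Sum>\<beta>\<in>addable P R I. coef (below \<beta>) \<beta>) + (\<Sum>\<gamma>\<in>removable P R I. coef (below \<gamma>) \<gamma>))"
    using \<nu> by (simp add: field_simps)
  then show "real (card (removable P R I)) = \<nu> / 2 * (coweight \<bullet> coweight) +
      (\<Sum>\<beta>\<in>addable P R I. - (\<nu> / 2 * coef (below \<beta>) \<beta>)) -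
      (\<Sum>\<beta>\<in>removable P R I. - (\<nu> / 2 * coef (below \<beta>) \<beta>))"
    by (simp add: sum_negf sum_distrib_left algebra_simps)
qed

text \<open>The simple long roots of an adapted base all have grade 1 or -1, so the long addable and
  long removable roots together have a constant number. This relation corrects the weights of
  \<open>weighted_identity\<close>.\<close>

lemma toggle_cde_long_graded:
  assumes norms: "\<And>\<gamma>. \<gamma> \<in> P \<Longrightarrow> \<gamma> \<bullet> \<gamma> = s \<or> \<gamma> \<bullet> \<gamma> = m" and "s > 0" "s < m"
    and graded: "\<And>\<eta>. \<eta> \<in> \<Phi> \<Longrightarrow> \<eta> \<bullet> \<eta> = m \<Longrightarrow> grade \<eta> \<noteq> 0"
  shows "toggle_cde P R"
proof -
  define long :: "'a \<Rightarrow> real" where "long \<gamma> = (if \<gamma> \<bullet> \<gamma> = m then 1 else 0)" for \<gamma>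
  define K where "K = real (card {\<delta> \<in> \<Delta>. \<delta> \<bullet> \<delta> = m})"
  \<comment> \<open>In \<open>s / 2\<close> times the weighted sum a short removable root counts 1
    but a long one only \<open>s / m\<close>; \<open>t\<close> is the deficit.\<close>
  define t where "t = 1 - s / m"
  have count: "(\<Sum>\<beta>\<in>addable P R I. long \<beta>) + (\<Sum>\<gamma>\<in>removable P R I. long \<gamma>) = K" if I: "I \<in> J" for I
  proof -
    let ?D = "ideal_base I"
    have finD: "finite ?D" using base_finite[OF simple_ideal_base[OF I]] .
    have DR: "\<delta> \<in> \<Phi>" if "\<delta> \<in> ?D" for \<delta> using base_subset[OF simple_ideal_base[OF I] that] .
    have "K = (\<Sum>\<delta>\<in>?D. long \<delta>)"
      unfolding K_def long_def card_ideal_base[OF I, symmetric] using finD by (simp add: sum.If_cases Int_def)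
    also have "\<dots> = (\<Sum>\<delta>\<in>{\<delta> \<in> ?D. grade \<delta> = 1} \<union> {\<delta> \<in> ?D. grade \<delta> = -1}. long \<delta>)"
      by (rule sum.mono_neutral_right) (use finD grade_cases[OF DR] graded[OF DR] in \<open>auto simp: long_def\<close>)
    also have "\<dots> = (\<Sum>\<delta>\<in>{\<delta> \<in> ?D. grade \<delta> = 1}. long \<delta>) + (\<Sum>\<delta>\<in>{\<delta> \<in> ?D. grade \<delta> = -1}. long \<delta>)"
      by (rule sum.union_disjoint) (use finD in auto)
    also have "(\<Sum>\<delta>\<in>{\<delta> \<in> ?D. grade \<delta> = -1}. long \<delta>) = (\<Sum>\<gamma>\<in>removable P R I. long \<gamma>)"
      unfolding ideal_base_grade_minus_one[OF I] by (subst sum.reindex) (auto simp: long_def)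
    finally show ?thesis unfolding ideal_base_grade_one[OF I] by simp
  qed
  have split: "real (card (removable P R I)) =
      s / 2 * (\<Sum>\<gamma>\<in>removable P R I. 2 / (\<gamma> \<bullet> \<gamma>)) + t * (\<Sum>\<gamma>\<in>removable P R I. long \<gamma>)" if I: "I \<in> J" for I
  proof -
    have one: "s / 2 * (2 / (\<gamma> \<bullet> \<gamma>)) + t * long \<gamma> = 1" if "\<gamma> \<in> removable P R I" for \<gamma>
    proof -
      have "\<gamma> \<in> P" using that ideal_subset[OF I] by (auto simp: removable_def)
      then show ?thesis using norms[of \<gamma>] assms(2,3) by (auto simp: long_def t_def)
    qed
    have "(\<Sum>\<gamma>\<in>removable P R I. s / 2 * (2 / (\<gamma> \<bullet> \<gamma>)) + t * long \<gamma>) = (\<Sum>\<gamma>\<in>removable P R I. 1)"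
      by (intro sum.cong refl one)
    then show ?thesis by (simp only: sum.distrib sum_distrib_left[symmetric]) simp
  qed
  define f where "f \<beta> = - (s / 2 * coef (below \<beta>) \<beta>) - t / 2 * long \<beta>" for \<beta>
  show ?thesis
    unfolding toggle_cde_def
  proof (intro exI[of _ "s / 2 * (coweight \<bullet> coweight) + t / 2 * K"] exI[of _ f] ballI)
    fix I assume I: "I \<in> J"
    have f: "(\<Sum>\<beta>\<in>A. f \<beta>) = - (s / 2 * (\<Sum>\<beta>\<in>A. coef (below \<beta>) \<beta>)) - t / 2 * (\<Sum>\<beta>\<in>A. long \<beta>)" for A
      by (simp add: f_def sum_subtractf sum_negf sum_distrib_left)
    \<comment> \<open>Half of the long removable roots are replaced by means of
      \<open>count\<close>. What remains is a constant and a difference between the two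
      sums.\<close>
    have "t * (\<Sum>\<gamma>\<in>removable P R I. long \<gamma>) =
        t / 2 * K - t / 2 * (\<Sum>\<beta>\<in>addable P R I. long \<beta>) + t / 2 * (\<Sum>\<gamma>\<in>removable P R I. long \<gamma>)"
      unfolding count[OF I, symmetric] by (simp add: field_simps)
    then show "real (card (removable P R I)) = s / 2 * (coweight \<bullet> coweight) + t / 2 * K +
        (\<Sum>\<beta>\<in>addable P R I. f \<beta>) - (\<Sum>\<beta>\<in>removable P R I. f \<beta>)"
      unfolding split[OF I] f weighted_identity[OF I] by (simp add: algebra_simps)
  qed
qed

end

section \<open>Long roots of grade zero\<close>

text \<open>\<open>s\<close> and \<open>m\<close> are the squared lengths of short and long roots.
  The poset contains a short root and some long root has grade 0; under these conditions
  \<open>P\<close> is shown to be a chain.\<close>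

locale long_grade_zero = irreducible_minuscule +
  fixes s m :: real and \<gamma>0 \<eta>0
  assumes norms: "\<phi> \<in> \<Phi> \<Longrightarrow> \<phi> \<bullet> \<phi> = s \<or> \<phi> \<bullet> \<phi> = m" and short_less: "s < m"
    and short: "\<gamma>0 \<in> P" "\<gamma>0 \<bullet> \<gamma>0 = s"
    and long: "\<eta>0 \<in> \<Phi>" "\<eta>0 \<bullet> \<eta>0 = m" "grade \<eta>0 = 0"
begin

lemma short_pos: "s > 0"
  using root_norm_pos[of \<gamma>0] short roots_above_iff by auto

lemma PD: "\<beta> \<in> P \<Longrightarrow> \<beta> \<in> \<Phi>" "\<beta> \<in> P \<Longrightarrow> grade \<beta> = 1"
  by (simp_all add: roots_above_iff)

lemma PI: "\<beta> \<in> \<Phi> \<Longrightarrow> grade \<beta> = 1 \<Longrightarrow> \<beta> \<in> P"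
  by (simp add: roots_above_iff)

lemma inner_P: "\<beta> \<in> P \<Longrightarrow> \<gamma> \<in> P \<Longrightarrow> \<beta> \<bullet> \<gamma> \<ge> 0"
  using inner_grade_one PD by blast

section \<open>Long roots against short roots\<close>

text \<open>The Cartan integer relative to the shorter root is the larger one, so reflecting \<beta>
  in \<gamma> subtracts \<gamma> at least twice. Such a step easily leaves the grades -1, 0 and
  1.\<close>

lemma long_short_pairing:
  assumes "\<beta> \<in> \<Phi>" "\<beta> \<bullet> \<beta> = m" "\<gamma> \<in> \<Phi>" "\<gamma> \<bullet> \<gamma> = s" "\<beta> \<bullet> \<gamma> > 0"
  obtains k l :: int where "2 * (\<beta> \<bullet> \<gamma>) = k * s" "2 * (\<beta> \<bullet> \<gamma>) = l * m" "1 \<le> l" "l < k"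
    "\<beta> - k *\<^sub>R \<gamma> \<in> \<Phi>"
proof -
  have ne: "\<beta> \<noteq> \<gamma>" using assms short_less by auto
  obtain k l :: int where kl: "2 * (\<beta> \<bullet> \<gamma>) = k * (\<gamma> \<bullet> \<gamma>)" "2 * (\<beta> \<bullet> \<gamma>) = l * (\<beta> \<bullet> \<beta>)"
    "k \<ge> 1" "l \<ge> 1" "k * l \<le> 3" using pairing_positive[OF assms(1,3) ne assms(5)] .
  have "real_of_int l * s < real_of_int l * m" using kl(4) short_less by simp
  also have "\<dots> = real_of_int k * s" using kl(1,2) assms by simp
  finally have "l < k" using short_pos by simp
  moreover have "reflect \<gamma> \<beta> = \<beta> - k *\<^sub>R \<gamma>"
    using kl(1) assms(4) short_pos by (simp add: reflect_def)
  then have "\<beta> - k *\<^sub>R \<gamma> \<in> \<Phi>" using reflect_root[OF assms(1,3)] by simp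
  ultimately show ?thesis using that[of k l] kl(1,2,4) assms(2,4) by simp
qed

text \<open>Otherwise, up to the sign of \<eta>, the reflection in \<gamma> would produce a root of
  grade at most -2.\<close>

lemma long_grade_zero_orthogonal:
  assumes \<eta>: "\<eta> \<in> \<Phi>" "\<eta> \<bullet> \<eta> = m" "grade \<eta> = 0" and \<gamma>: "\<gamma> \<in> P" "\<gamma> \<bullet> \<gamma> = s"
  shows "\<eta> \<bullet> \<gamma> = 0"
proof -
  have no: False if x: "x \<in> \<Phi>" "x \<bullet> x = m" "grade x = 0" "x \<bullet> \<gamma> > 0" for x
  proof -
    obtain k l :: int where kl: "1 \<le> l" "l < k" "x - k *\<^sub>R \<gamma> \<in> \<Phi>"
      using long_short_pairing[OF x(1,2) PD(1)[OF \<gamma>(1)] \<gamma>(2) x(4)] .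
    have "grade (x - k *\<^sub>R \<gamma>) = - real_of_int k" using x(3) PD(2)[OF \<gamma>(1)] by (simp add: inner_diff_right)
    then show False using grade_cases[OF kl(3)] kl(1,2) by auto
  qed
  show ?thesis using no[of \<eta>] no[of "- \<eta>"] \<eta> root_uminus by force
qed

text \<open>The reflected root has grade \<open>1 - k\<close>, so \<open>k = 2\<close> and hence
  \<open>l = 1\<close>.\<close>

lemma long_short_inner:
  assumes "\<beta> \<in> P" "\<beta> \<bullet> \<beta> = m" "\<gamma> \<in> P" "\<gamma> \<bullet> \<gamma> = s" "\<beta> \<bullet> \<gamma> > 0"
  shows "\<beta> \<bullet> \<gamma> = s" "m = 2 * s"
proof -
  obtain k l :: int where kl: "2 * (\<beta> \<bullet> \<gamma>) = k * s" "2 * (\<beta> \<bullet> \<gamma>) = l * m" "1 \<le> l" "l < k" "\<beta> - k *\<^sub>R \<gamma> \<in> \<Phi>"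
    using long_short_pairing[OF PD(1)[OF assms(1)] assms(2) PD(1)[OF assms(3)] assms(4,5)] .
  have "grade (\<beta> - k *\<^sub>R \<gamma>) = 1 - real_of_int k" using PD(2) assms by (simp add: inner_diff_right)
  then have "k \<le> 2" using grade_cases[OF kl(5)] by auto
  then have "k = 2" "l = 1" using kl(3,4) by auto
  then show "\<beta> \<bullet> \<gamma> = s" "m = 2 * s" using kl(1,2) by auto
qed

text \<open>Some long root is not orthogonal to \<gamma>. It cannot have grade 0, so it or its
  negative lies in \<open>P\<close>.\<close>

lemma long_above_short:
  assumes "\<gamma> \<in> P" "\<gamma> \<bullet> \<gamma> = s"
  shows "\<exists>\<beta>\<in>P. \<beta> \<bullet> \<beta> = m \<and> \<beta> \<bullet> \<gamma> > 0"
proof -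
  obtain \<sigma> where \<sigma>: "\<sigma> \<in> \<Phi>" "\<sigma> \<bullet> \<sigma> = m" "\<gamma> \<bullet> \<sigma> \<noteq> 0"
    using not_orthogonal_to_norm[OF PD(1)[OF assms(1)] long(1)] long(2) by auto
  have "grade \<sigma> \<noteq> 0" using long_grade_zero_orthogonal[OF \<sigma>(1,2) _ assms] \<sigma>(3) by (auto simp: inner_commute)
  then consider "grade \<sigma> = 1" | "grade \<sigma> = -1" using grade_cases[OF \<sigma>(1)] by blast
  then show ?thesis
  proof cases
    case 1
    then have "\<sigma> \<in> P" using \<sigma> PI by blast
    then show ?thesis using inner_P[OF _ assms(1), of \<sigma>] \<sigma> by (intro bexI[of _ \<sigma>]) (auto simp: inner_commute)
  next
    case 2
    then have "- \<sigma> \<in> P" using \<sigma> root_uminus by (intro PI) auto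
    then show ?thesis using inner_P[OF _ assms(1), of "- \<sigma>"] \<sigma>
      by (intro bexI[of _ "- \<sigma>"]) (auto simp: inner_commute)
  qed
qed

text \<open>Otherwise \<open>a - b\<close> would be a long root of grade 0 that is not orthogonal to
  the short root \<gamma>.\<close>

lemma long_orthogonal:
  assumes a: "a \<in> P" "a \<bullet> a = m" "a \<bullet> \<gamma> > 0" and b: "b \<in> P" "b \<bullet> b = m" "b \<bullet> \<gamma> = 0"
    and \<gamma>: "\<gamma> \<in> P" "\<gamma> \<bullet> \<gamma> = s"
  shows "a \<bullet> b = 0"
proof (rule ccontr)
  assume "a \<bullet> b \<noteq> 0"
  then have ab: "a \<bullet> b > 0" using inner_P[OF a(1) b(1)] by simp
  have ne: "a \<noteq> b" using a b by auto
  have R: "a - b \<in> \<Phi>" using root_diff PD(1) a b ne ab by blast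
  have "2 * (a \<bullet> b) = m" using equal_norm_inner[OF PD(1) PD(1), OF a(1) b(1) ne ab] a b by simp
  then have "(a - b) \<bullet> (a - b) = m" using a b by (simp add: inner_diff_left inner_diff_right inner_commute)
  moreover have "grade (a - b) = 0" using PD(2) a b by (simp add: inner_diff_right)
  ultimately have "(a - b) \<bullet> \<gamma> = 0" using long_grade_zero_orthogonal R \<gamma> by blast
  then show False using a b by (simp add: inner_diff_left)
qed

lemma reflect_P:
  assumes "\<beta> \<in> P" "\<delta> \<in> \<Delta>" "\<delta> \<noteq> \<alpha>"
  shows "reflect \<delta> \<beta> \<in> P"
  using reflect_root[OF PD(1)[OF assms(1)] base_subset[OF base assms(2)]] PD(2)[OF assms(1)] grade_simple[OF assms(2)] assms(3)
  by (intro PI) (auto simp: reflect_def inner_diff_right)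

section \<open>Propagation by simple reflections\<close>

text \<open>A minimal \<open>x\<close> in \<open>S\<close> is \<alpha>. If not,
  \<open>x \<bullet> \<alpha> < x \<bullet> x\<close>, and as \<open>x\<close> has coefficient 1 at
  \<alpha>, some other simple \<delta> has \<open>x \<bullet> \<delta> > 0\<close>. Reflecting in
  \<delta> gives a smaller member of \<open>S\<close>.\<close>

lemma alpha_in_stable_set:
  assumes S: "S \<subseteq> {\<beta> \<in> P. \<beta> \<bullet> \<beta> = m}" "S \<noteq> {}"
    and stable: "\<And>x \<delta>. x \<in> S \<Longrightarrow> \<delta> \<in> \<Delta> \<Longrightarrow> \<delta> \<noteq> \<alpha> \<Longrightarrow> reflect \<delta> x \<in> S"
  shows "\<alpha> \<in> S"
proof -
  have "S \<subseteq> P" using S by blast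
  from minimal_exists[OF this S(2)] obtain x where x: "x \<in> S" "\<And>y. y \<in> S \<Longrightarrow> (y, x) \<in> R \<Longrightarrow> y = x"
    by blast
  have xP: "x \<in> P" "x \<bullet> x = m" using x S by auto
  have "x = \<alpha>"
  proof (rule ccontr)
    assume ne: "x \<noteq> \<alpha>"
    have aR: "\<alpha> \<in> \<Phi>" "grade \<alpha> = 1" using base_subset[OF base alpha] grade_simple[OF alpha] by auto
    have xR: "x \<in> \<Phi>" "grade x = 1" using PD xP by auto
    have "x \<noteq> - \<alpha>" using xR aR by auto
    then have "(x \<bullet> \<alpha>)\<^sup>2 < m * (\<alpha> \<bullet> \<alpha>)" using strict_Cauchy_Schwarz[OF xR(1) aR(1) ne] xP by simp
    also have "\<dots> \<le> m * m" using norms[OF aR(1)] short_less short_pos by (intro mult_left_mono) auto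
    finally have "x \<bullet> \<alpha> < m" using short_less short_pos power_less_imp_less_base[of "x \<bullet> \<alpha>" 2 m]
      by (simp add: power2_eq_square)
    moreover have "x \<bullet> x = x \<bullet> \<alpha> + (\<Sum>\<delta>\<in>\<Delta> - {\<alpha>}. representation \<Delta> x \<delta> * (x \<bullet> \<delta>))"
    proof -
      have "x \<bullet> x = x \<bullet> (\<Sum>\<delta>\<in>\<Delta>. representation \<Delta> x \<delta> *\<^sub>R \<delta>)"
        using base_sum[OF base root_in_span[OF base xR(1)]] by simp
      also have "\<dots> = (\<Sum>\<delta>\<in>\<Delta>. representation \<Delta> x \<delta> * (x \<bullet> \<delta>))" by (simp add: inner_sum_right)
      also have "\<dots> = representation \<Delta> x \<alpha> * (x \<bullet> \<alpha>) + (\<Sum>\<delta>\<in>\<Delta> - {\<alpha>}. representation \<Delta> x \<delta> * (x \<bullet> \<delta>))"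
        by (rule sum.remove[OF base_finite[OF base] alpha])
      finally show ?thesis using grade_root[OF xR(1)] xR(2) by simp
    qed
    ultimately have "0 < (\<Sum>\<delta>\<in>\<Delta> - {\<alpha>}. representation \<Delta> x \<delta> * (x \<bullet> \<delta>))" using xP by simp
    then obtain \<delta> where d: "\<delta> \<in> \<Delta>" "\<delta> \<noteq> \<alpha>" "representation \<Delta> x \<delta> * (x \<bullet> \<delta>) > 0"
      by (metis (no_types, lifting) DiffE insertI1 not_le sum_nonpos)
    then have xd: "x \<bullet> \<delta> > 0"
      using positiveD[OF base grade_one_positive[OF xR] d(1)] by (simp add: zero_less_mult_iff)
    have dR: "\<delta> \<in> \<Phi>" using base_subset[OF base d(1)] .
    let ?y = "reflect \<delta> x"
    obtain k :: int where k: "2 * (x \<bullet> \<delta>) / (\<delta> \<bullet> \<delta>) = k" using pairing_int[OF xR(1) dR] by (auto elim: Ints_cases)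
    have kpos: "real_of_int k > 0" using k xd root_norm_pos[OF dR] by (metis divide_pos_pos mult_pos_pos zero_less_numeral)
    have y: "x - ?y = real (nat k) *\<^sub>R \<delta>" using k kpos by (simp add: reflect_def)
    have "?y \<in> S" using stable x(1) d by blast
    moreover have "(?y, x) \<in> R"
      using \<open>?y \<in> S\<close> S xP y nonneg_combinations_scale[of \<delta> \<Delta> "nat k"] positive_nonneg[OF base_positive[OF base d(1)]]
      by (auto simp: R_iff)
    ultimately have "?y = x" using x(2) by blast
    then show False using y kpos root_nonzero[OF dR] by simp
  qed
  then show ?thesis using x by simp
qed

text \<open>Simple reflections are involutions, so if \<open>Q\<close> failed somewhere, the long
  elements with \<open>Q\<close> and those without would both be nonempty stable sets. Both would
  contain \<alpha>.\<close>

lemma long_induct: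
  assumes start: "\<beta>0 \<in> P" "\<beta>0 \<bullet> \<beta>0 = m" "Q \<beta>0"
    and step: "\<And>x \<delta>. x \<in> P \<Longrightarrow> x \<bullet> x = m \<Longrightarrow> Q x \<Longrightarrow> \<delta> \<in> \<Delta> \<Longrightarrow> \<delta> \<noteq> \<alpha> \<Longrightarrow> Q (reflect \<delta> x)"
    and b: "\<beta> \<in> P" "\<beta> \<bullet> \<beta> = m"
  shows "Q \<beta>"
proof (rule ccontr)
  assume nQ: "\<not> Q \<beta>"
  have norm: "reflect \<delta> x \<bullet> reflect \<delta> x = m" if "x \<bullet> x = m" "\<delta> \<in> \<Delta>" for x \<delta>
    using that norm_reflect base_subset[OF base] by simp
  have "\<alpha> \<in> {\<beta> \<in> P. \<beta> \<bullet> \<beta> = m \<and> Q \<beta>}"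
    by (rule alpha_in_stable_set) (use start step reflect_P norm in auto)
  moreover have "\<alpha> \<in> {\<beta> \<in> P. \<beta> \<bullet> \<beta> = m \<and> \<not> Q \<beta>}"
  proof (rule alpha_in_stable_set)
    show "{\<beta> \<in> P. \<beta> \<bullet> \<beta> = m \<and> \<not> Q \<beta>} \<noteq> {}" using b nQ by blast
    fix x \<delta> assume x: "x \<in> {\<beta> \<in> P. \<beta> \<bullet> \<beta> = m \<and> \<not> Q \<beta>}" and d: "\<delta> \<in> \<Delta>" "\<delta> \<noteq> \<alpha>"
    have "reflect \<delta> (reflect \<delta> x) = x" using reflect_reflect root_nonzero base_subset[OF base d(1)] by blast
    then have "\<not> Q (reflect \<delta> x)" using step[of "reflect \<delta> x" \<delta>] x d reflect_P norm by auto
    then show "reflect \<delta> x \<in> {\<beta> \<in> P. \<beta> \<bullet> \<beta> = m \<and> \<not> Q \<beta>}" using x d reflect_P norm by auto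
  qed blast
  ultimately show False by blast
qed

text \<open>\<open>\<eta>0\<close> is not orthogonal to some element of \<open>P\<close>, which must
  be long. Reflecting both roots carries the property to all long elements.\<close>

lemma long_not_orthogonal_grade_zero:
  assumes "\<beta> \<in> P" "\<beta> \<bullet> \<beta> = m"
  shows "\<exists>\<eta>\<in>\<Phi>. \<eta> \<bullet> \<eta> = m \<and> grade \<eta> = 0 \<and> \<eta> \<bullet> \<beta> > 0"
proof -
  obtain \<beta>0 where b0: "\<beta>0 \<in> P" "\<eta>0 \<bullet> \<beta>0 \<noteq> 0" using grade_zero_not_orthogonal[OF long(1,3)] by blast
  have b0m: "\<beta>0 \<bullet> \<beta>0 = m"
    using norms[OF PD(1)[OF b0(1)]] long_grade_zero_orthogonal[OF long b0(1)] b0(2) by blast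
  have "\<exists>\<eta>\<in>\<Phi>. \<eta> \<bullet> \<eta> = m \<and> grade \<eta> = 0 \<and> \<eta> \<bullet> \<beta> \<noteq> 0"
  proof (rule long_induct[OF b0(1) b0m _ _ assms])
    show "\<exists>\<eta>\<in>\<Phi>. \<eta> \<bullet> \<eta> = m \<and> grade \<eta> = 0 \<and> \<eta> \<bullet> \<beta>0 \<noteq> 0" using long b0 by blast
    fix x \<delta> assume "\<exists>\<eta>\<in>\<Phi>. \<eta> \<bullet> \<eta> = m \<and> grade \<eta> = 0 \<and> \<eta> \<bullet> x \<noteq> 0" and d: "\<delta> \<in> \<Delta>" "\<delta> \<noteq> \<alpha>"
    then obtain \<eta> where e: "\<eta> \<in> \<Phi>" "\<eta> \<bullet> \<eta> = m" "grade \<eta> = 0" "\<eta> \<bullet> x \<noteq> 0" by blast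
    have dR: "\<delta> \<in> \<Phi>" using base_subset[OF base d(1)] .
    have "grade (reflect \<delta> \<eta>) = 0" using e(3) grade_simple[OF d(1)] d(2) by (simp add: reflect_def inner_diff_right)
    then show "\<exists>\<eta>\<in>\<Phi>. \<eta> \<bullet> \<eta> = m \<and> grade \<eta> = 0 \<and> \<eta> \<bullet> reflect \<delta> x \<noteq> 0"
      using reflect_root[OF e(1) dR] norm_reflect[OF dR] inner_reflect[OF root_nonzero[OF dR]] e
      by (intro bexI[of _ "reflect \<delta> \<eta>"]) simp_all
  qed
  then obtain \<eta> where e: "\<eta> \<in> \<Phi>" "\<eta> \<bullet> \<eta> = m" "grade \<eta> = 0" "\<eta> \<bullet> \<beta> \<noteq> 0" by blast
  show ?thesis
  proof (cases "\<eta> \<bullet> \<beta> > 0")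
    case True then show ?thesis using e by blast
  next
    case False
    then show ?thesis using e root_uminus by (intro bexI[of _ "- \<eta>"]) auto
  qed
qed

text \<open>Induction from a long element given by \<open>long_above_short\<close>. The step can
  only fail if a simple reflection takes \<open>x\<close> to some \<open>y\<close> orthogonal to
  \<gamma>, and then \<open>x\<close> and \<open>y\<close> are orthogonal too.\<close>

lemma long_short_positive:
  assumes b: "\<beta> \<in> P" "\<beta> \<bullet> \<beta> = m" and \<gamma>: "\<gamma> \<in> P" "\<gamma> \<bullet> \<gamma> = s"
  shows "\<beta> \<bullet> \<gamma> > 0"
proof -
  obtain \<beta>0 where b0: "\<beta>0 \<in> P" "\<beta>0 \<bullet> \<beta>0 = m" "\<beta>0 \<bullet> \<gamma> > 0" using long_above_short[OF \<gamma>] by blast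
  have ms: "m = 2 * s" using long_short_inner[OF b0(1,2) \<gamma> b0(3)] by blast
  show ?thesis
  proof (rule long_induct[of \<beta>0 "\<lambda>x. x \<bullet> \<gamma> > 0", OF b0 _ b])
    fix x \<delta> assume x: "x \<in> P" "x \<bullet> x = m" "x \<bullet> \<gamma> > 0" and d: "\<delta> \<in> \<Delta>" "\<delta> \<noteq> \<alpha>"
    have dR: "\<delta> \<in> \<Phi>" "grade \<delta> = 0" using base_subset[OF base d(1)] grade_simple[OF d(1)] d(2) by auto
    define y where "y = reflect \<delta> x"
    have y: "y \<in> P" "y \<bullet> y = m" using reflect_P[OF x(1) d] norm_reflect[OF dR(1)] x by (auto simp: y_def)
    show "reflect \<delta> x \<bullet> \<gamma> > 0"
    proof (rule ccontr)
      assume "\<not> ?thesis"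
      then have y0: "y \<bullet> \<gamma> = 0" using inner_P[OF y(1) \<gamma>(1)] by (simp add: y_def)
      have xy: "x \<bullet> y = 0" using long_orthogonal[OF x y y0 \<gamma>] .
      define k where "k = 2 * (x \<bullet> \<delta>) / (\<delta> \<bullet> \<delta>)"
      have yk: "y = x - k *\<^sub>R \<delta>" by (simp add: y_def reflect_def k_def)
      have "\<delta> \<bullet> \<gamma> \<noteq> 0" using y0 x(3) yk by (auto simp: inner_diff_left)
      then have ds: "\<delta> \<bullet> \<delta> = s" using long_grade_zero_orthogonal[OF dR(1) _ dR(2) \<gamma>] norms[OF dR(1)] by blast
      have xd: "x \<bullet> \<delta> = k * s / 2" using short_pos by (simp add: k_def ds)
      have "k * (x \<bullet> \<delta>) = m" using xy x(2) by (simp add: yk inner_diff_right)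
      then have "k * k = 4" using xd ms short_pos by simp
      then have "(k - 2) * (k + 2) = 0" using \<open>k * k = 4\<close> by (simp add: algebra_simps)
      then have "(k - 2) * (k + 2) = 0" using \<open>k * k = 4\<close> by (simp add: algebra_simps)
      then have k2: "k = 2 \<or> k = -2" by auto
      \<comment> \<open>The sign is chosen so that \<open>y\<close> is \<open>x\<close> minus twice
        \<open>d'\<close>. The midpoint \<open>x - d'\<close> of \<open>x\<close> and
        \<open>y\<close> is then a short element of \<open>P\<close>.\<close>
      define d' where "d' = (k / 2) *\<^sub>R \<delta>"
      have d'R: "d' \<in> \<Phi>" "grade d' = 0" using k2 dR root_uminus by (auto simp: d'_def)
      have d's: "d' \<bullet> d' = s" "x \<bullet> d' = s" using k2 ds xd by (auto simp: d'_def)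
      have yd': "y = x - 2 *\<^sub>R d'" by (simp add: yk d'_def)
      have "x \<noteq> d'" using d'R PD(2)[OF x(1)] by auto
      then have "x - d' \<in> \<Phi>" using root_diff[OF PD(1)[OF x(1)] d'R(1)] d's short_pos by simp
      then have gP: "x - d' \<in> P" using PD(2)[OF x(1)] d'R(2) by (intro PI) (auto simp: inner_diff_right)
      have gs: "(x - d') \<bullet> (x - d') = s"
        using x(2) d's ms by (simp add: inner_diff_left inner_diff_right inner_commute)
      \<comment> \<open>\<eta> is orthogonal to the short midpoint, so its pairings with
        \<open>x\<close> and \<open>y\<close> are opposite. But \<open>x - \<eta>\<close> is a long
        element of \<open>P\<close> that pairs positively with \<gamma>, hence orthogonal to
        \<open>y\<close>, which makes \<eta> orthogonal to \<open>y\<close> as well.\<close>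
      obtain \<eta> where e: "\<eta> \<in> \<Phi>" "\<eta> \<bullet> \<eta> = m" "grade \<eta> = 0" "\<eta> \<bullet> x > 0"
        using long_not_orthogonal_grade_zero[OF x(1,2)] by blast
      have ed: "\<eta> \<bullet> d' = \<eta> \<bullet> x"
        using long_grade_zero_orthogonal[OF e(1-3) gP gs] by (simp add: inner_diff_right)
      have ne: "x \<noteq> \<eta>" using e(3) PD(2)[OF x(1)] by auto
      have xe: "x \<bullet> \<eta> > 0" using e(4) by (simp add: inner_commute)
      have aR: "x - \<eta> \<in> \<Phi>" using root_diff[OF PD(1)[OF x(1)] e(1) ne xe] .
      have "2 * (x \<bullet> \<eta>) = m" using equal_norm_inner[OF PD(1)[OF x(1)] e(1) ne xe] x(2) e(2) by simp
      then have am: "(x - \<eta>) \<bullet> (x - \<eta>) = m"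
        using x(2) e(2) by (simp add: inner_diff_left inner_diff_right inner_commute)
      have aP: "x - \<eta> \<in> P" using aR PD(2)[OF x(1)] e(3) by (intro PI) (auto simp: inner_diff_right)
      have ag: "(x - \<eta>) \<bullet> \<gamma> > 0"
        using long_grade_zero_orthogonal[OF e(1-3) \<gamma>] x(3) by (simp add: inner_diff_left)
      have "(x - \<eta>) \<bullet> y = 0" using long_orthogonal[OF aP am ag y y0 \<gamma>] .
      moreover have "\<eta> \<bullet> y = - (\<eta> \<bullet> x)" using ed by (simp add: yd' inner_diff_right)
      ultimately show False using xy e(4) by (simp add: inner_diff_left)
    qed
  qed
qed

section \<open>The poset is a chain\<close>

text \<open>For a long \<beta> in \<open>P\<close>, the vector
  \<open>\<gamma>1 + \<gamma>2 - \<beta>\<close> has grade 1 and squared length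
  \<open>2 * (\<gamma>1 \<bullet> \<gamma>2)\<close>, so it is not zero. If the length is positive,
  the vector is a short root in \<open>P\<close> orthogonal to \<beta>, against
  \<open>long_short_positive\<close>.\<close>

lemma short_unique:
  assumes g1: "\<gamma>1 \<in> P" "\<gamma>1 \<bullet> \<gamma>1 = s" and g2: "\<gamma>2 \<in> P" "\<gamma>2 \<bullet> \<gamma>2 = s"
  shows "\<gamma>1 = \<gamma>2"
proof (rule ccontr)
  assume ne: "\<gamma>1 \<noteq> \<gamma>2"
  obtain \<beta> where b: "\<beta> \<in> P" "\<beta> \<bullet> \<beta> = m" "\<beta> \<bullet> \<gamma>1 > 0" using long_above_short[OF g1] by blast
  have b1: "\<beta> \<bullet> \<gamma>1 = s" "m = 2 * s" using long_short_inner[OF b(1,2) g1 b(3)] by blast+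
  have b2: "\<beta> \<bullet> \<gamma>2 = s" using long_short_inner(1)[OF b(1,2) g2] long_short_positive[OF b(1,2) g2] by blast
  have n3: "(\<gamma>1 + \<gamma>2 - \<beta>) \<bullet> (\<gamma>1 + \<gamma>2 - \<beta>) = 2 * (\<gamma>1 \<bullet> \<gamma>2)"
    using b(2) b1 b2 g1(2) g2(2)
    by (simp add: inner_diff_left inner_diff_right inner_add_left inner_add_right inner_commute)
  have grade3: "grade (\<gamma>1 + \<gamma>2 - \<beta>) = 1"
    using PD(2) g1 g2 b by (simp add: inner_diff_right inner_add_right)
  show False
  proof (cases "\<gamma>1 \<bullet> \<gamma>2 > 0")
    case False
    then have "\<gamma>1 + \<gamma>2 - \<beta> = 0" using n3 inner_P[OF g1(1) g2(1)] by simp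
    then show False using grade3 by simp
  next
    case True
    then have half: "2 * (\<gamma>1 \<bullet> \<gamma>2) = s" using equal_norm_inner[OF PD(1) PD(1), OF g1(1) g2(1) ne] g1 g2 by simp
    have "\<beta> \<noteq> \<gamma>1" using b(2) g1(2) short_less by auto
    then have z: "\<beta> - \<gamma>1 \<in> \<Phi>" using root_diff[OF PD(1)[OF b(1)] PD(1)[OF g1(1)]] b(3) by blast
    have "\<gamma>2 \<bullet> (\<beta> - \<gamma>1) > 0" using b2 half short_pos by (simp add: inner_diff_right inner_commute)
    moreover have "grade (\<beta> - \<gamma>1) = 0" using PD(2) g1 b by (simp add: inner_diff_right)
    then have "\<gamma>2 \<noteq> \<beta> - \<gamma>1" using PD(2)[OF g2(1)] by auto
    ultimately have "\<gamma>2 - (\<beta> - \<gamma>1) \<in> \<Phi>" using root_diff[OF PD(1)[OF g2(1)] z] by blast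
    then have "\<gamma>1 + \<gamma>2 - \<beta> \<in> \<Phi>" by (simp add: algebra_simps)
    then have "\<beta> \<bullet> (\<gamma>1 + \<gamma>2 - \<beta>) > 0"
      using long_short_positive[OF b(1,2) PI[OF _ grade3]] n3 half by simp
    then show False using b(2) b1 b2 by (simp add: inner_diff_right inner_add_right)
  qed
qed

lemma comparable:
  assumes "x \<in> P" "y \<in> P" "n > 0" "x - y = real n *\<^sub>R \<phi>" "\<phi> \<in> \<Phi>"
  shows "(x, y) \<in> R \<or> (y, x) \<in> R"
proof -
  have "\<phi> \<in> nonneg_combinations \<Delta> \<or> - \<phi> \<in> nonneg_combinations \<Delta>" using base_cases[OF base assms(5)] .
  then show ?thesis
  proof
    assume "\<phi> \<in> nonneg_combinations \<Delta>"
    then show ?thesis using nonneg_combinations_scale[of \<phi> \<Delta> n] assms by (simp add: R_iff)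
  next
    assume "- \<phi> \<in> nonneg_combinations \<Delta>"
    moreover have "y - x = real n *\<^sub>R (- \<phi>)" using assms(4) by (simp add: algebra_simps)
    ultimately show ?thesis using nonneg_combinations_scale[of "- \<phi>" \<Delta> n] assms by (simp only: R_iff) simp
  qed
qed

lemma poset_total:
  assumes x: "x \<in> P" and y: "y \<in> P"
  shows "(x, y) \<in> R \<or> (y, x) \<in> R"
proof -
  consider "x = y" | "x \<noteq> y" "x \<bullet> y > 0" | "x \<noteq> y" "x \<bullet> y = 0" using inner_P[OF x y] by fastforce
  then show ?thesis
  proof cases
    case 1 then show ?thesis using x refl_in by blast
  next
    case 2
    then have "x - y \<in> \<Phi>" using root_diff PD(1) x y by blast
    then show ?thesis using comparable[OF x y, of 1 "x - y"] by simp
  next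
    case 3
    \<comment> \<open>Two distinct elements are not both short, and a short one is never orthogonal
      to a long one.\<close>
    have xl: "x \<bullet> x = m"
      using norms[OF PD(1)[OF x]] norms[OF PD(1)[OF y]] short_unique[OF x _ y] long_short_positive[OF y _ x] 3
      by (auto simp: inner_commute)
    have yl: "y \<bullet> y = m"
      using norms[OF PD(1)[OF y]] long_short_positive[OF x xl y] 3 by auto
    have xg: "x \<bullet> \<gamma>0 > 0" "y \<bullet> \<gamma>0 > 0" using long_short_positive x y xl yl short by blast+
    have ip: "x \<bullet> \<gamma>0 = s" "m = 2 * s" "y \<bullet> \<gamma>0 = s"
      using long_short_inner[OF x xl short xg(1)] long_short_inner[OF y yl short xg(2)] by blast+
    \<comment> \<open>The squared length is \<open>2 * m - 4 * s\<close> with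
      \<open>m = 2 * s\<close>, so \<open>\<gamma>0\<close> is the midpoint of \<open>x\<close> and
      \<open>y\<close>, and \<open>x - y\<close> is twice a root.\<close>
    have "(x + y - 2 *\<^sub>R \<gamma>0) \<bullet> (x + y - 2 *\<^sub>R \<gamma>0) = 0"
      using xl yl ip short 3(2)
      by (simp add: inner_diff_left inner_diff_right inner_add_left inner_add_right inner_commute)
    then have "x + y - 2 *\<^sub>R \<gamma>0 = 0" by simp
    then have "y = 2 *\<^sub>R \<gamma>0 - x" by (simp add: algebra_simps)
    then have "x - y = real 2 *\<^sub>R (x - \<gamma>0)" by (simp add: scaleR_2 scaleR_diff_right)
    moreover have "x \<noteq> \<gamma>0" using xl short short_less by auto
    then have "x - \<gamma>0 \<in> \<Phi>" using root_diff[OF PD(1)[OF x] PD(1)[OF short(1)]] xg by blast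
    ultimately show ?thesis using comparable[OF x y, of 2 "x - \<gamma>0"] by simp
  qed
qed

lemma toggle_cde_roots: "toggle_cde P R"
  using toggle_cde_chain poset_total by blast

end

section \<open>Connected minuscule posets and their disjoint unions\<close>

lemma (in irreducible_minuscule) toggle_cde_roots_above: "toggle_cde P R"
proof (cases "\<exists>\<beta>\<in>P. \<exists>\<gamma>\<in>P. \<beta> \<bullet> \<beta> < \<gamma> \<bullet> \<gamma>")
  case False
  have aP: "\<alpha> \<in> P" using roots_above_iff grade_simple[OF alpha] base_subset[OF base alpha] by simp
  have "\<gamma> \<bullet> \<gamma> = \<alpha> \<bullet> \<alpha>" if "\<gamma> \<in> P" for \<gamma>
    using False aP that by (meson linorder_neqE)
  then show ?thesis by (rule toggle_cde_equal_norms)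
next
  case True
  then obtain \<beta> \<gamma> where bg: "\<beta> \<in> P" "\<gamma> \<in> P" "\<beta> \<bullet> \<beta> < \<gamma> \<bullet> \<gamma>" by blast
  have R: "\<beta> \<in> \<Phi>" "\<gamma> \<in> \<Phi>" using bg roots_above_iff by blast+
  show ?thesis
  proof (cases "\<exists>\<eta>\<in>\<Phi>. \<eta> \<bullet> \<eta> = \<gamma> \<bullet> \<gamma> \<and> grade \<eta> = 0")
    case True
    then obtain \<eta> where e: "\<eta> \<in> \<Phi>" "\<eta> \<bullet> \<eta> = \<gamma> \<bullet> \<gamma>" "grade \<eta> = 0" by blast
    interpret long_grade_zero \<Phi> \<Delta> \<alpha> "\<beta> \<bullet> \<beta>" "\<gamma> \<bullet> \<gamma>" \<beta> \<eta>
      by unfold_locales (use two_norms[OF R bg(3)] bg e in auto)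
    show ?thesis by (rule toggle_cde_roots)
  next
    case False
    show ?thesis
      by (rule toggle_cde_long_graded[OF _ root_norm_pos[OF R(1)] bg(3)])
         (use two_norms[OF R bg(3)] roots_above_iff False in auto)
  qed
qed

lemma toggle_cde_connected_minuscule:
  assumes "connected_minuscule_poset TYPE('v::euclidean_space) A r"
  shows "toggle_cde A r" "finite A"
proof -
  obtain \<Phi> :: "'v set" and \<Delta> \<alpha> where h: "irreducible_root_system \<Phi>" "simple_roots \<Phi> \<Delta>"
      "minuscule_simple_root \<Phi> \<Delta> \<alpha>"
      "poset_isomorphic A r (roots_above \<Phi> \<Delta> \<alpha>) (relation_of (root_le \<Delta>) (roots_above \<Phi> \<Delta> \<alpha>))"
    using assms unfolding connected_minuscule_poset_def by blast
  interpret root_system \<Phi>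
    using h(1) by unfold_locales (simp add: irreducible_root_system_def)
  obtain \<theta> where t: "\<theta> \<in> positive_roots \<Phi> \<Delta>" "\<And>\<beta>. \<beta> \<in> positive_roots \<Phi> \<Delta> \<Longrightarrow> root_le \<Delta> \<beta> \<theta>"
      "representation \<Delta> \<theta> \<alpha> = 1" and a: "\<alpha> \<in> \<Delta>"
    using h(3) by (auto simp: minuscule_simple_root_def highest_root_def)
  \<comment> \<open>\<open>\<theta> - \<beta>\<close> is a nonnegative combination, so the
    coefficient of \<beta> at \<alpha> is bounded by that of \<theta>.\<close>
  have "representation \<Delta> \<beta> \<alpha> \<le> 1" if b: "\<beta> \<in> positive_roots \<Phi> \<Delta>" for \<beta>
  proof -
    have sp: "\<beta> \<in> span \<Delta>" "\<theta> \<in> span \<Delta>" using root_in_span[OF h(2)] positive_nonneg b t(1) by blast+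
    have "representation \<Delta> (\<theta> - \<beta>) \<alpha> \<in> \<nat>"
      using t(2)[OF b] base_nonneg_iff[OF h(2)] a by (auto simp: root_le_def)
    then show ?thesis
      using fun_cong[OF representation_diff[OF base_independent[OF h(2)] sp], of \<alpha>] t(3)
      by (auto simp: Nats_def)
  qed
  then interpret irreducible_minuscule \<Phi> \<Delta> \<alpha>
    using h a by unfold_locales auto
  show "toggle_cde A r" using toggle_cde_isomorphic[OF h(4) toggle_cde_roots_above] .
  show "finite A" using h(4) fin bij_betw_finite by (auto simp: poset_isomorphic_def)
qed

theorem theorem2p11:
  fixes P :: "'a set" and r :: "'a rel"
  assumes "minuscule_poset TYPE('v::euclidean_space) P r"
  shows "cde (order_ideals P r) (relation_of (\<subseteq>) (order_ideals P r))"
proof -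
  obtain \<C> where \<C>: "finite \<C>" "partition_on P \<C>"
      "\<forall>A\<in>\<C>. connected_minuscule_poset TYPE('v) A (Restr r A)"
      "\<forall>A\<in>\<C>. \<forall>B\<in>\<C>. A \<noteq> B \<longrightarrow> (\<forall>x\<in>A. \<forall>y\<in>B. (x, y) \<notin> r)"
    using assms unfolding minuscule_poset_def by (elim conjE exE) (rule that)
  have po: "partial_order_on P r" using assms unfolding minuscule_poset_def by (rule conjunct1)
  have comp: "connected_minuscule_poset TYPE('v) A (Restr r A)" if "A \<in> \<C>" for A
    using \<C>(3) that by (rule bspec)
  have cross: "(x, y) \<notin> r" if "A \<in> \<C>" "B \<in> \<C>" "A \<noteq> B" "x \<in> A" "y \<in> B" for A B x y
    using \<C>(4) that by simp
  have fin: "finite P"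
    using \<C>(1,2) toggle_cde_connected_minuscule(2)[OF comp] by (auto simp: partition_on_def)
  interpret finite_order P r by unfold_locales (fact fin po)+
  have "toggle_cde P r"
    by (rule toggle_cde_disjoint_union[OF fin \<C>(2)]) (use cross toggle_cde_connected_minuscule(1)[OF comp] in blast)+
  then show ?thesis by (rule toggle_cde_imp_cde)
qed

end
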